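(* There are faithful Markov functors $\mathsf{Gauss}\to\mathsf{GaussEx}$ and $\mathsf{TLinRel}\to\mathsf{GaussEx}$, which are the identity on objects and are given on morphisms as follows: 1. A Gaussian map $(f,\psi)$ is sent to the decorated copartial map $(f,\psi,\mathsf{id})$. 2. A total linear relation $\{(x,y):\ell(x)=p(y)\}\subseteq X\times Y$, represented by a copartial map $X\xrightarrow{\ell}P\xleftarrow{p}Y$, is sent to the decorated copartial map $(\ell,\delta_0,p)$.
   Context: A Markov category is a symmetric monoidal category in which every object $X$ carries a commutative comonoid structure $\mathsf{copy}_X:X\to X\otimes X$, $\mathsf{del}_X:X\to I$, compatible with the tensor product, such that $\mathsf{del}$ is natural. A Markov functor is a symmetric monoidal functor preserving $\mathsf{copy}$ and $\mathsf{del}$. A Gaussian distribution on $\mathbb R^k$ is a multivariate normal distribution $\mathcal N(\mu,\Sigma)$ with $\Sigma$ positive semidefinite (possibly singular, so Dirac measures $\delta_\mu=\mathcal N(\mu,0)$ are included). $M_*\psi$ denotes pushforward under a linear map, $\psi\otimes\psi'$ the product measure, and $\psi+\psi'$ convolution. In all three categories below, objects are the spaces $\mathbb R^n$ ($n\ge 0$), the tensor on objects is the product, and the unit is $\mathbb R^0$. **$\mathsf{Gauss}$:** morphisms $\mathbb R^m\to\mathbb R^n$ are pairs $(M,\psi)$ with $M:\mathbb R^m\to\mathbb R^n$ linear and $\psi$ a Gaussian distribution on $\mathbb R^n$ (thought of as $x\mapsto Mx+\psi$). Composition is $(M,\psi)\circ(N,\chi)=(MN,\psi+M_*\chi)$,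 and the tensor is $(M,\psi)\otimes(M',\psi')=(M\times M',\psi\otimes\psi')$. A linear map $h$ gives the morphism $(h,\delta_0)$, and copy and delete come from the linear maps $x\mapsto(x,x)$ and $x\mapsto 0\in\mathbb R^0$. **$\mathsf{TLinRel}$:** morphisms $X\to Y$ are vector subspaces $\mathbb L\subseteq X\times Y$ such that for every $x\in X$ there is $y\in Y$ with $(x,y)\in\mathbb L$. Composition is relational composition, the tensor is the componentwise product of relations, and copy and delete are the graphs of $x\mapsto(x,x)$ and $x\mapsto0\in\mathbb R^0$. A copartial map is a cospan of linear maps $X\xrightarrow{\ell}P\xleftarrow{p}Y$ with $p$ surjective. Every total linear relation can be written as $\{(x,y):\ell(x)=p(y)\}$ for some copartial map, unique up to isomorphism of the apex $P$. **$\mathsf{GaussEx}$:** morphisms $\mathbb R^m\to\mathbb R^n$ are equivalence classes of triples $(f,\psi,p)$ (decorated copartial maps) with $f:\mathbb R^m\to\mathbb R^k$ linear, $p:\mathbb R^n\to\mathbb R^k$ linear surjective (for some $k$), and $\psi$ a Gaussian distribution on $\mathbb R^k$, where $(f,\psi,p)$ and $(\tau f,\tau_*\psi,\tau p)$ are identified for every linear isomorphism $\tau$. The identity is $(\mathsf{id},\delta_0,\mathsf{id})$. The composite of $(f,\psi,p):X\to Y$ followed by $(g,\chi,q):Y\to Z$ is $(i_1f,(i_1)_*\psi+(i_2)_*\chi,i_2q)$, where $P\xrightarrow{i_1}W\xleftarrow{i_2}Q$ is the pushout of $P\xleftarrow{p}Y\xrightarrow{g}Q$ in finite-dimensional vector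 spaces. The tensor is $(f,\psi,p)\otimes(f',\psi',p')=(f\times f',\psi\otimes\psi',p\times p')$. A linear map $h$ gives the morphism $(h,\delta_0,\mathsf{id})$, and copy and delete come from the linear maps $x\mapsto(x,x)$ and $x\mapsto0\in\mathbb R^0$. *)

theory Defs
  imports "HOL-Probability.Probability" "Jordan_Normal_Form.Matrix"
begin

unbundle no inner_syntax
unbundle no vec_syntax
hide_type (open) Finite_Cartesian_Product.vec
hide_const (open) Finite_Cartesian_Product.vec Finite_Cartesian_Product.mat

section \<open>Markov categories and Markov functors\<close>

text \<open>Composition is written in the applicative order: \<open>g \<cdot> f\<close> is \<open>f\<close> followed by \<open>g\<close>.
  The operations \<open>\<boxdot>\<close> and \<open>\<boxtimes>\<close> are the tensor product of objects and of morphisms.\<close>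

record ('o, 'm) markov_struct =
  Obj :: "'o set"
  Hom :: "'o \<Rightarrow> 'o \<Rightarrow> 'm set"
  Ident :: "'o \<Rightarrow> 'm"
  Comp :: "'m \<Rightarrow> 'm \<Rightarrow> 'm" (infixl "\<cdot>\<index>" 70)
  TensorObj :: "'o \<Rightarrow> 'o \<Rightarrow> 'o" (infixr "\<boxdot>\<index>" 75)
  Tensor :: "'m \<Rightarrow> 'm \<Rightarrow> 'm" (infixr "\<boxtimes>\<index>" 75)
  UnitObj :: "'o"
  Assoc :: "'o \<Rightarrow> 'o \<Rightarrow> 'o \<Rightarrow> 'm"
  LUnit :: "'o \<Rightarrow> 'm"
  RUnit :: "'o \<Rightarrow> 'm"
  Braid :: "'o \<Rightarrow> 'o \<Rightarrow> 'm"
  Copy :: "'o \<Rightarrow> 'm"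
  Del :: "'o \<Rightarrow> 'm"

definition inverse_arrows :: "('o, 'm) markov_struct \<Rightarrow> 'o \<Rightarrow> 'o \<Rightarrow> 'm \<Rightarrow> 'm \<Rightarrow> bool" where
  "inverse_arrows C X Y f g \<longleftrightarrow> f \<in> Hom C X Y \<and> g \<in> Hom C Y X \<and>
     g \<cdot>\<^bsub>C\<^esub> f = Ident C X \<and> f \<cdot>\<^bsub>C\<^esub> g = Ident C Y"

definition iso_arrow :: "('o, 'm) markov_struct \<Rightarrow> 'o \<Rightarrow> 'o \<Rightarrow> 'm \<Rightarrow> bool" where
  "iso_arrow C X Y f \<longleftrightarrow> (\<exists>g. inverse_arrows C X Y f g)"

definition inv_arrow :: "('o, 'm) markov_struct \<Rightarrow> 'o \<Rightarrow> 'o \<Rightarrow> 'm \<Rightarrow> 'm" where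
  "inv_arrow C X Y f = (THE g. inverse_arrows C X Y f g)"

locale category =
  fixes C :: "('o, 'm) markov_struct" (structure)
  assumes hom_disjoint:
      "\<lbrakk>X \<in> Obj C; Y \<in> Obj C; X' \<in> Obj C; Y' \<in> Obj C; f \<in> Hom C X Y; f \<in> Hom C X' Y'\<rbrakk>
        \<Longrightarrow> X = X' \<and> Y = Y'"
    and ident_in: "X \<in> Obj C \<Longrightarrow> Ident C X \<in> Hom C X X"
    and comp_in: "\<lbrakk>X \<in> Obj C; Y \<in> Obj C; Z \<in> Obj C; f \<in> Hom C X Y; g \<in> Hom C Y Z\<rbrakk>
        \<Longrightarrow> g \<cdot> f \<in> Hom C X Z"
    and comp_ident: "\<lbrakk>X \<in> Obj C; Y \<in> Obj C; f \<in> Hom C X Y\<rbrakk> \<Longrightarrow> f \<cdot> Ident C X = f"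
    and ident_comp: "\<lbrakk>X \<in> Obj C; Y \<in> Obj C; f \<in> Hom C X Y\<rbrakk> \<Longrightarrow> Ident C Y \<cdot> f = f"
    and comp_assoc: "\<lbrakk>W \<in> Obj C; X \<in> Obj C; Y \<in> Obj C; Z \<in> Obj C;
        f \<in> Hom C W X; g \<in> Hom C X Y; h \<in> Hom C Y Z\<rbrakk> \<Longrightarrow> (h \<cdot> g) \<cdot> f = h \<cdot> (g \<cdot> f)"

locale symmetric_monoidal_category = category C
  for C :: "('o, 'm) markov_struct" (structure) +
  assumes unit_obj: "UnitObj C \<in> Obj C"
    and tensor_obj: "\<lbrakk>X \<in> Obj C; Y \<in> Obj C\<rbrakk> \<Longrightarrow> X \<boxdot> Y \<in> Obj C"
    and tensor_in: "\<lbrakk>X \<in> Obj C; Y \<in> Obj C; X' \<in> Obj C; Y' \<in> Obj C;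
        f \<in> Hom C X Y; f' \<in> Hom C X' Y'\<rbrakk> \<Longrightarrow> f \<boxtimes> f' \<in> Hom C (X \<boxdot> X') (Y \<boxdot> Y')"
    and tensor_ident: "\<lbrakk>X \<in> Obj C; Y \<in> Obj C\<rbrakk>
        \<Longrightarrow> Ident C X \<boxtimes> Ident C Y = Ident C (X \<boxdot> Y)"
    and tensor_comp: "\<lbrakk>X \<in> Obj C; Y \<in> Obj C; Z \<in> Obj C; X' \<in> Obj C; Y' \<in> Obj C; Z' \<in> Obj C;
        f \<in> Hom C X Y; g \<in> Hom C Y Z; f' \<in> Hom C X' Y'; g' \<in> Hom C Y' Z'\<rbrakk>
        \<Longrightarrow> (g \<cdot> f) \<boxtimes> (g' \<cdot> f') = (g \<boxtimes> g') \<cdot> (f \<boxtimes> f')"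
    and assoc_iso: "\<lbrakk>X \<in> Obj C; Y \<in> Obj C; Z \<in> Obj C\<rbrakk>
        \<Longrightarrow> iso_arrow C ((X \<boxdot> Y) \<boxdot> Z) (X \<boxdot> (Y \<boxdot> Z)) (Assoc C X Y Z)"
    and assoc_natural: "\<lbrakk>X \<in> Obj C; Y \<in> Obj C; Z \<in> Obj C; X' \<in> Obj C; Y' \<in> Obj C; Z' \<in> Obj C;
        f \<in> Hom C X X'; g \<in> Hom C Y Y'; h \<in> Hom C Z Z'\<rbrakk>
        \<Longrightarrow> Assoc C X' Y' Z' \<cdot> ((f \<boxtimes> g) \<boxtimes> h) = (f \<boxtimes> (g \<boxtimes> h)) \<cdot> Assoc C X Y Z"
    and lunit_iso: "X \<in> Obj C \<Longrightarrow> iso_arrow C (UnitObj C \<boxdot> X) X (LUnit C X)"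
    and lunit_natural: "\<lbrakk>X \<in> Obj C; Y \<in> Obj C; f \<in> Hom C X Y\<rbrakk>
        \<Longrightarrow> LUnit C Y \<cdot> (Ident C (UnitObj C) \<boxtimes> f) = f \<cdot> LUnit C X"
    and runit_iso: "X \<in> Obj C \<Longrightarrow> iso_arrow C (X \<boxdot> UnitObj C) X (RUnit C X)"
    and runit_natural: "\<lbrakk>X \<in> Obj C; Y \<in> Obj C; f \<in> Hom C X Y\<rbrakk>
        \<Longrightarrow> RUnit C Y \<cdot> (f \<boxtimes> Ident C (UnitObj C)) = f \<cdot> RUnit C X"
    and pentagon: "\<lbrakk>W \<in> Obj C; X \<in> Obj C; Y \<in> Obj C; Z \<in> Obj C\<rbrakk>
        \<Longrightarrow> (Ident C W \<boxtimes> Assoc C X Y Z) \<cdot> Assoc C W (X \<boxdot> Y) Z \<cdot> (Assoc C W X Y \<boxtimes> Ident C Z)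
          = Assoc C W X (Y \<boxdot> Z) \<cdot> Assoc C (W \<boxdot> X) Y Z"
    and triangle: "\<lbrakk>X \<in> Obj C; Y \<in> Obj C\<rbrakk>
        \<Longrightarrow> (Ident C X \<boxtimes> LUnit C Y) \<cdot> Assoc C X (UnitObj C) Y = RUnit C X \<boxtimes> Ident C Y"
    and braid_in: "\<lbrakk>X \<in> Obj C; Y \<in> Obj C\<rbrakk> \<Longrightarrow> Braid C X Y \<in> Hom C (X \<boxdot> Y) (Y \<boxdot> X)"
    and braid_natural: "\<lbrakk>X \<in> Obj C; Y \<in> Obj C; X' \<in> Obj C; Y' \<in> Obj C;
        f \<in> Hom C X X'; g \<in> Hom C Y Y'\<rbrakk>
        \<Longrightarrow> Braid C X' Y' \<cdot> (f \<boxtimes> g) = (g \<boxtimes> f) \<cdot> Braid C X Y"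
    and braid_symmetric: "\<lbrakk>X \<in> Obj C; Y \<in> Obj C\<rbrakk>
        \<Longrightarrow> Braid C Y X \<cdot> Braid C X Y = Ident C (X \<boxdot> Y)"
    and hexagon: "\<lbrakk>X \<in> Obj C; Y \<in> Obj C; Z \<in> Obj C\<rbrakk>
        \<Longrightarrow> Assoc C Y Z X \<cdot> Braid C X (Y \<boxdot> Z) \<cdot> Assoc C X Y Z
          = (Ident C Y \<boxtimes> Braid C X Z) \<cdot> Assoc C Y X Z \<cdot> (Braid C X Y \<boxtimes> Ident C Z)"

text \<open>The canonical morphism from \<open>(X \<boxdot> X) \<boxdot> (Y \<boxdot> Y)\<close> to \<open>(X \<boxdot> Y) \<boxdot> (X \<boxdot> Y)\<close> exchanging the two
  middle factors.\<close>

definition middle_swap :: "('o, 'm) markov_struct \<Rightarrow> 'o \<Rightarrow> 'o \<Rightarrow> 'm" where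
  "middle_swap C X Y =
     inv_arrow C ((X \<boxdot>\<^bsub>C\<^esub> Y) \<boxdot>\<^bsub>C\<^esub> (X \<boxdot>\<^bsub>C\<^esub> Y)) (X \<boxdot>\<^bsub>C\<^esub> (Y \<boxdot>\<^bsub>C\<^esub> (X \<boxdot>\<^bsub>C\<^esub> Y))) (Assoc C X Y (X \<boxdot>\<^bsub>C\<^esub> Y))
     \<cdot>\<^bsub>C\<^esub> (Ident C X \<boxtimes>\<^bsub>C\<^esub>
           (Assoc C Y X Y \<cdot>\<^bsub>C\<^esub> (Braid C X Y \<boxtimes>\<^bsub>C\<^esub> Ident C Y) \<cdot>\<^bsub>C\<^esub>
            inv_arrow C ((X \<boxdot>\<^bsub>C\<^esub> Y) \<boxdot>\<^bsub>C\<^esub> Y) (X \<boxdot>\<^bsub>C\<^esub> (Y \<boxdot>\<^bsub>C\<^esub> Y)) (Assoc C X Y Y)))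
     \<cdot>\<^bsub>C\<^esub> Assoc C X X (Y \<boxdot>\<^bsub>C\<^esub> Y)"

locale markov_category = symmetric_monoidal_category C
  for C :: "('o, 'm) markov_struct" (structure) +
  assumes copy_in: "X \<in> Obj C \<Longrightarrow> Copy C X \<in> Hom C X (X \<boxdot> X)"
    and del_in: "X \<in> Obj C \<Longrightarrow> Del C X \<in> Hom C X (UnitObj C)"
    and copy_coassoc: "X \<in> Obj C \<Longrightarrow> Assoc C X X X \<cdot> (Copy C X \<boxtimes> Ident C X) \<cdot> Copy C X
        = (Ident C X \<boxtimes> Copy C X) \<cdot> Copy C X"
    and copy_counit_left: "X \<in> Obj C \<Longrightarrow> LUnit C X \<cdot> (Del C X \<boxtimes> Ident C X) \<cdot> Copy C X = Ident C X"
    and copy_counit_right: "X \<in> Obj C \<Longrightarrow> RUnit C X \<cdot> (Ident C X \<boxtimes> Del C X) \<cdot> Copy C X = Ident C X"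
    and copy_commutative: "X \<in> Obj C \<Longrightarrow> Braid C X X \<cdot> Copy C X = Copy C X"
    and copy_tensor: "\<lbrakk>X \<in> Obj C; Y \<in> Obj C\<rbrakk>
        \<Longrightarrow> Copy C (X \<boxdot> Y) = middle_swap C X Y \<cdot> (Copy C X \<boxtimes> Copy C Y)"
    and del_tensor: "\<lbrakk>X \<in> Obj C; Y \<in> Obj C\<rbrakk>
        \<Longrightarrow> Del C (X \<boxdot> Y) = LUnit C (UnitObj C) \<cdot> (Del C X \<boxtimes> Del C Y)"
    and copy_unit: "LUnit C (UnitObj C) \<cdot> Copy C (UnitObj C) = Ident C (UnitObj C)"
    and del_unit: "Del C (UnitObj C) = Ident C (UnitObj C)"
    and del_natural: "\<lbrakk>X \<in> Obj C; Y \<in> Obj C; f \<in> Hom C X Y\<rbrakk> \<Longrightarrow> Del C Y \<cdot> f = Del C X"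

text \<open>A (strong) symmetric monoidal functor has coherence isomorphisms
  \<open>\<mu> X Y : F X \<boxdot> F Y \<rightarrow> F (X \<boxdot> Y)\<close> and \<open>\<epsilon> : I \<rightarrow> F I\<close>; preservation of copy and delete is up to them.\<close>

locale markov_functor = C: markov_category C + D: markov_category D
  for C :: "('o, 'm) markov_struct" and D :: "('p, 'n) markov_struct" +
  fixes FO :: "'o \<Rightarrow> 'p" and F :: "'m \<Rightarrow> 'n" and \<mu> :: "'o \<Rightarrow> 'o \<Rightarrow> 'n" and \<epsilon> :: "'n"
  assumes functor_obj: "X \<in> Obj C \<Longrightarrow> FO X \<in> Obj D"
    and functor_in: "\<lbrakk>X \<in> Obj C; Y \<in> Obj C; f \<in> Hom C X Y\<rbrakk> \<Longrightarrow> F f \<in> Hom D (FO X) (FO Y)"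
    and functor_ident: "X \<in> Obj C \<Longrightarrow> F (Ident C X) = Ident D (FO X)"
    and functor_comp: "\<lbrakk>X \<in> Obj C; Y \<in> Obj C; Z \<in> Obj C; f \<in> Hom C X Y; g \<in> Hom C Y Z\<rbrakk>
        \<Longrightarrow> F (g \<cdot>\<^bsub>C\<^esub> f) = F g \<cdot>\<^bsub>D\<^esub> F f"
    and mult_iso: "\<lbrakk>X \<in> Obj C; Y \<in> Obj C\<rbrakk>
        \<Longrightarrow> iso_arrow D (FO X \<boxdot>\<^bsub>D\<^esub> FO Y) (FO (X \<boxdot>\<^bsub>C\<^esub> Y)) (\<mu> X Y)"
    and mult_natural: "\<lbrakk>X \<in> Obj C; Y \<in> Obj C; X' \<in> Obj C; Y' \<in> Obj C;
        f \<in> Hom C X X'; g \<in> Hom C Y Y'\<rbrakk>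
        \<Longrightarrow> \<mu> X' Y' \<cdot>\<^bsub>D\<^esub> (F f \<boxtimes>\<^bsub>D\<^esub> F g) = F (f \<boxtimes>\<^bsub>C\<^esub> g) \<cdot>\<^bsub>D\<^esub> \<mu> X Y"
    and unit_iso: "iso_arrow D (UnitObj D) (FO (UnitObj C)) \<epsilon>"
    and mult_assoc: "\<lbrakk>X \<in> Obj C; Y \<in> Obj C; Z \<in> Obj C\<rbrakk>
        \<Longrightarrow> F (Assoc C X Y Z) \<cdot>\<^bsub>D\<^esub> \<mu> (X \<boxdot>\<^bsub>C\<^esub> Y) Z \<cdot>\<^bsub>D\<^esub> (\<mu> X Y \<boxtimes>\<^bsub>D\<^esub> Ident D (FO Z))
          = \<mu> X (Y \<boxdot>\<^bsub>C\<^esub> Z) \<cdot>\<^bsub>D\<^esub> (Ident D (FO X) \<boxtimes>\<^bsub>D\<^esub> \<mu> Y Z) \<cdot>\<^bsub>D\<^esub> Assoc D (FO X) (FO Y) (FO Z)"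
    and mult_lunit: "X \<in> Obj C
        \<Longrightarrow> F (LUnit C X) \<cdot>\<^bsub>D\<^esub> \<mu> (UnitObj C) X \<cdot>\<^bsub>D\<^esub> (\<epsilon> \<boxtimes>\<^bsub>D\<^esub> Ident D (FO X)) = LUnit D (FO X)"
    and mult_runit: "X \<in> Obj C
        \<Longrightarrow> F (RUnit C X) \<cdot>\<^bsub>D\<^esub> \<mu> X (UnitObj C) \<cdot>\<^bsub>D\<^esub> (Ident D (FO X) \<boxtimes>\<^bsub>D\<^esub> \<epsilon>) = RUnit D (FO X)"
    and mult_braid: "\<lbrakk>X \<in> Obj C; Y \<in> Obj C\<rbrakk>
        \<Longrightarrow> F (Braid C X Y) \<cdot>\<^bsub>D\<^esub> \<mu> X Y = \<mu> Y X \<cdot>\<^bsub>D\<^esub> Braid D (FO X) (FO Y)"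
    and functor_copy: "X \<in> Obj C \<Longrightarrow> F (Copy C X) = \<mu> X X \<cdot>\<^bsub>D\<^esub> Copy D (FO X)"
    and functor_del: "X \<in> Obj C \<Longrightarrow> F (Del C X) = \<epsilon> \<cdot>\<^bsub>D\<^esub> Del D (FO X)"

definition faithful :: "('o, 'm) markov_struct \<Rightarrow> ('m \<Rightarrow> 'n) \<Rightarrow> bool" where
  "faithful C F \<longleftrightarrow> (\<forall>X \<in> Obj C. \<forall>Y \<in> Obj C. inj_on F (Hom C X Y))"


section \<open>Linear maps and Gaussian distributions on \<open>\<real>\<^sup>n\<close>\<close>

text \<open>\<open>\<real>\<^sup>n\<close> is \<^term>\<open>carrier_vec n :: real Matrix.vec set\<close>, and a linear map from \<open>\<real>\<^sup>m\<close> to \<open>\<real>\<^sup>n\<close> is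
  its matrix in \<^term>\<open>carrier_mat n m :: real Matrix.mat set\<close>.  The product of \<open>\<real>\<^sup>m\<close> and \<open>\<real>\<^sup>n\<close>
  is identified with \<open>\<real>\<close> to the power \<open>m + n\<close> by concatenation of vectors.\<close>

definition matrix_of :: "nat \<Rightarrow> nat \<Rightarrow> (real Matrix.vec \<Rightarrow> real Matrix.vec) \<Rightarrow> real Matrix.mat" where
  "matrix_of m n h = Matrix.mat n m (\<lambda>(i, j). h (unit_vec m j) $ i)"

definition mat_prod :: "real Matrix.mat \<Rightarrow> real Matrix.mat \<Rightarrow> real Matrix.mat" where
  "mat_prod M N =
     four_block_mat M (0\<^sub>m (dim_row M) (dim_col N)) (0\<^sub>m (dim_row N) (dim_col M)) N"

definition surj_mat :: "real Matrix.mat \<Rightarrow> bool" where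
  "surj_mat p \<longleftrightarrow>
     (\<forall>z \<in> carrier_vec (dim_row p). \<exists>y \<in> carrier_vec (dim_col p). p *\<^sub>v y = z)"

definition vec_borel :: "nat \<Rightarrow> real Matrix.vec measure" where
  "vec_borel n =
     vimage_algebra (carrier_vec n) (\<lambda>x. \<lambda>i\<in>{..<n}. x $ i) (\<Pi>\<^sub>M i\<in>{..<n}. (borel :: real measure))"

definition psd :: "nat \<Rightarrow> real Matrix.mat \<Rightarrow> bool" where
  "psd n S \<longleftrightarrow> S \<in> carrier_mat n n \<and> transpose_mat S = S \<and>
     (\<forall>t \<in> carrier_vec n. 0 \<le> t \<bullet> (S *\<^sub>v t))"

text \<open>The normal distribution with mean \<open>m\<close> and covariance \<open>S\<close> is specified by its characteristic
  function, because for singular \<open>S\<close> it has no Lebesgue density.\<close>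

definition is_normal :: "nat \<Rightarrow> real Matrix.vec \<Rightarrow> real Matrix.mat \<Rightarrow> real Matrix.vec measure \<Rightarrow> bool" where
  "is_normal n m S \<psi> \<longleftrightarrow> prob_space \<psi> \<and> sets \<psi> = sets (vec_borel n) \<and>
     (\<forall>t \<in> carrier_vec n. (LINT x|\<psi>. iexp (t \<bullet> x)) =
        exp (\<i> * complex_of_real (t \<bullet> m) - complex_of_real (t \<bullet> (S *\<^sub>v t)) / 2))"

definition gaussian :: "nat \<Rightarrow> real Matrix.vec measure \<Rightarrow> bool" where
  "gaussian n \<psi> \<longleftrightarrow> (\<exists>m \<in> carrier_vec n. \<exists>S. psd n S \<and> is_normal n m S \<psi>)"

definition dirac0 :: "nat \<Rightarrow> real Matrix.vec measure" where
  "dirac0 n = return (vec_borel n) (0\<^sub>v n)"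

definition push :: "real Matrix.mat \<Rightarrow> real Matrix.vec measure \<Rightarrow> real Matrix.vec measure" where
  "push M \<psi> = distr \<psi> (vec_borel (dim_row M)) (\<lambda>x. M *\<^sub>v x)"

definition prod_dist ::
    "nat \<Rightarrow> nat \<Rightarrow> real Matrix.vec measure \<Rightarrow> real Matrix.vec measure \<Rightarrow> real Matrix.vec measure" where
  "prod_dist m n \<psi> \<psi>' = distr (\<psi> \<Otimes>\<^sub>M \<psi>') (vec_borel (m + n)) (\<lambda>(x, y). x @\<^sub>v y)"

definition conv_dist ::
    "nat \<Rightarrow> real Matrix.vec measure \<Rightarrow> real Matrix.vec measure \<Rightarrow> real Matrix.vec measure" where
  "conv_dist n \<psi> \<psi>' = distr (\<psi> \<Otimes>\<^sub>M \<psi>') (vec_borel n) (\<lambda>(x, y). x + y)"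


section \<open>The three categories\<close>

text \<open>The object \<open>\<real>\<^sup>n\<close> is encoded by \<open>n\<close>.  The parameter \<open>J\<close> sends a linear map to the
  corresponding morphism, and all structure morphisms are the images under \<open>J\<close> of those of linear
  maps.  Since concatenation of vectors is strictly associative and unital, associators and unitors
  come from identity matrices.\<close>

definition linear_markov_struct ::
    "(nat \<Rightarrow> nat \<Rightarrow> 'm set) \<Rightarrow> ('m \<Rightarrow> 'm \<Rightarrow> 'm) \<Rightarrow> ('m \<Rightarrow> 'm \<Rightarrow> 'm) \<Rightarrow> (real Matrix.mat \<Rightarrow> 'm)
      \<Rightarrow> (nat, 'm) markov_struct" where
  "linear_markov_struct H cmp tens J = \<lparr>
     Obj = UNIV,
     Hom = H,
     Ident = (\<lambda>n. J (1\<^sub>m n)),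
     Comp = cmp,
     TensorObj = (+),
     Tensor = tens,
     UnitObj = 0,
     Assoc = (\<lambda>m n k. J (1\<^sub>m (m + n + k))),
     LUnit = (\<lambda>n. J (1\<^sub>m n)),
     RUnit = (\<lambda>n. J (1\<^sub>m n)),
     Braid = (\<lambda>m n. J (matrix_of (m + n) (n + m) (\<lambda>x. vec_last x n @\<^sub>v vec_first x m))),
     Copy = (\<lambda>n. J (matrix_of n (n + n) (\<lambda>x. x @\<^sub>v x))),
     Del = (\<lambda>n. J (matrix_of n 0 (\<lambda>x. 0\<^sub>v 0))) \<rparr>"

subsection \<open>Gaussian maps\<close>

type_synonym gauss_map = "real Matrix.mat \<times> real Matrix.vec measure"

definition gauss_hom :: "nat \<Rightarrow> nat \<Rightarrow> gauss_map set" where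
  "gauss_hom m n = {(M, \<psi>). M \<in> carrier_mat n m \<and> gaussian n \<psi>}"

definition gauss_comp :: "gauss_map \<Rightarrow> gauss_map \<Rightarrow> gauss_map" where
  "gauss_comp = (\<lambda>(M, \<psi>) (N, \<chi>). (M * N, conv_dist (dim_row M) \<psi> (push M \<chi>)))"

definition gauss_tensor :: "gauss_map \<Rightarrow> gauss_map \<Rightarrow> gauss_map" where
  "gauss_tensor = (\<lambda>(M, \<psi>) (M', \<psi>'). (mat_prod M M', prod_dist (dim_row M) (dim_row M') \<psi> \<psi>'))"

definition Gauss :: "(nat, gauss_map) markov_struct" where
  "Gauss = linear_markov_struct gauss_hom gauss_comp gauss_tensor (\<lambda>h. (h, dirac0 (dim_row h)))"

subsection \<open>Total linear relations\<close>

type_synonym vec_rel = "(real Matrix.vec \<times> real Matrix.vec) set"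

definition linear_relation :: "nat \<Rightarrow> nat \<Rightarrow> vec_rel \<Rightarrow> bool" where
  "linear_relation m n L \<longleftrightarrow> L \<subseteq> carrier_vec m \<times> carrier_vec n \<and> (0\<^sub>v m, 0\<^sub>v n) \<in> L \<and>
     (\<forall>x y x' y'. (x, y) \<in> L \<longrightarrow> (x', y') \<in> L \<longrightarrow> (x + x', y + y') \<in> L) \<and>
     (\<forall>c x y. (x, y) \<in> L \<longrightarrow> (c \<cdot>\<^sub>v x, c \<cdot>\<^sub>v y) \<in> L)"

definition tlinrel_hom :: "nat \<Rightarrow> nat \<Rightarrow> vec_rel set" where
  "tlinrel_hom m n = {L. linear_relation m n L \<and> (\<forall>x \<in> carrier_vec m. \<exists>y. (x, y) \<in> L)}"

definition tlinrel_tensor :: "vec_rel \<Rightarrow> vec_rel \<Rightarrow> vec_rel" where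
  "tlinrel_tensor L L' = {(x @\<^sub>v x', y @\<^sub>v y') | x y x' y'. (x, y) \<in> L \<and> (x', y') \<in> L'}"

definition graph_rel :: "real Matrix.mat \<Rightarrow> vec_rel" where
  "graph_rel h = {(x, h *\<^sub>v x) | x. x \<in> carrier_vec (dim_col h)}"

text \<open>\<^const>\<open>relcomp\<close> composes in diagrammatic order.\<close>

definition TLinRel :: "(nat, vec_rel) markov_struct" where
  "TLinRel = linear_markov_struct tlinrel_hom (\<lambda>K L. L O K) tlinrel_tensor graph_rel"

definition copartial_map :: "nat \<Rightarrow> nat \<Rightarrow> real Matrix.mat \<Rightarrow> real Matrix.mat \<Rightarrow> bool" where
  "copartial_map m n l p \<longleftrightarrow>
     (\<exists>k. l \<in> carrier_mat k m \<and> p \<in> carrier_mat k n \<and> surj_mat p)"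

definition copartial_rel :: "real Matrix.mat \<Rightarrow> real Matrix.mat \<Rightarrow> vec_rel" where
  "copartial_rel l p =
     {(x, y). x \<in> carrier_vec (dim_col l) \<and> y \<in> carrier_vec (dim_col p) \<and> l *\<^sub>v x = p *\<^sub>v y}"

subsection \<open>Decorated copartial maps\<close>

type_synonym decorated = "real Matrix.mat \<times> real Matrix.vec measure \<times> real Matrix.mat"

definition decorated_copartial :: "nat \<Rightarrow> nat \<Rightarrow> decorated set" where
  "decorated_copartial m n =
     {(f, \<psi>, p). copartial_map m n f p \<and> gaussian (dim_row p) \<psi>}"

definition decorated_eq :: "nat \<Rightarrow> nat \<Rightarrow> (decorated \<times> decorated) set" where
  "decorated_eq m n =
     {((f, \<psi>, p), (\<tau> * f, push \<tau> \<psi>, \<tau> * p)) | f \<psi> p \<tau>.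
        (f, \<psi>, p) \<in> decorated_copartial m n \<and>
        \<tau> \<in> carrier_mat (dim_row p) (dim_row p) \<and> invertible_mat \<tau>}"

definition gaussex_hom :: "nat \<Rightarrow> nat \<Rightarrow> decorated set set" where
  "gaussex_hom m n = decorated_copartial m n // decorated_eq m n"

definition gaussex_class :: "decorated \<Rightarrow> decorated set" where
  "gaussex_class = (\<lambda>(f, \<psi>, p). decorated_eq (dim_col f) (dim_col p) `` {(f, \<psi>, p)})"

definition is_pushout ::
    "real Matrix.mat \<Rightarrow> real Matrix.mat \<Rightarrow> real Matrix.mat \<Rightarrow> real Matrix.mat \<Rightarrow> bool" where
  "is_pushout p g i1 i2 \<longleftrightarrow>
     i1 \<in> carrier_mat (dim_row i1) (dim_row p) \<and> i2 \<in> carrier_mat (dim_row i1) (dim_row g) \<and>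
     i1 * p = i2 * g \<and>
     (\<forall>z. \<forall>j1 \<in> carrier_mat z (dim_row p). \<forall>j2 \<in> carrier_mat z (dim_row g).
        j1 * p = j2 * g \<longrightarrow>
        (\<exists>!u. u \<in> carrier_mat z (dim_row i1) \<and> u * i1 = j1 \<and> u * i2 = j2))"

text \<open>Operations on equivalence classes are unions of the classes obtained from all representatives
  (and, for composition, from all choices of the pushout).\<close>

definition gaussex_comp :: "decorated set \<Rightarrow> decorated set \<Rightarrow> decorated set" where
  "gaussex_comp B A =
     (\<Union>(f, \<psi>, p) \<in> A. \<Union>(g, \<chi>, q) \<in> B. \<Union>(i1, i2) \<in> {(i1, i2). is_pushout p g i1 i2}.
        gaussex_class (i1 * f, conv_dist (dim_row i1) (push i1 \<psi>) (push i2 \<chi>), i2 * q))"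

definition gaussex_tensor :: "decorated set \<Rightarrow> decorated set \<Rightarrow> decorated set" where
  "gaussex_tensor A A' =
     (\<Union>(f, \<psi>, p) \<in> A. \<Union>(f', \<psi>', p') \<in> A'.
        gaussex_class (mat_prod f f', prod_dist (dim_row p) (dim_row p') \<psi> \<psi>', mat_prod p p'))"

definition GaussEx :: "(nat, decorated set) markov_struct" where
  "GaussEx = linear_markov_struct gaussex_hom gaussex_comp gaussex_tensor
     (\<lambda>h. gaussex_class (h, dirac0 (dim_row h), 1\<^sub>m (dim_row h)))"

end

theory Submission
  imports Defs
begin

text \<open>A pushout of a surjection \<open>p\<close> along \<open>g\<close> is a commuting square whose leg \<open>i2\<close> is surjective with
  kernel \<open>g (ker p)\<close>.  With this description, existence, pasting and products of pushouts are diagram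
  chases, and the composite of two classes of decorated copartial maps can be computed from any
  representatives and any pushout; this gives the category axioms of \<open>GaussEx\<close>.  The structure morphisms
  come from linear maps, so that all coherence conditions are matrix identities.

  The other two categories need no separate verification: the maps \<open>(f, \<psi>) \<mapsto> (f, \<psi>, id)\<close> and
  \<open>(l, p) \<mapsto> (l, \<delta>\<^sub>0, p)\<close> are injective on hom-sets and preserve all operations, and the axioms are
  equations, so they are inherited from \<open>GaussEx\<close>.  Injectivity in the first case holds because an
  isomorphism of apexes that fixes the right leg \<open>id\<close> is the identity.\<close>

section \<open>Linear maps as matrices\<close>

text \<open>The composite in \<open>GaussEx\<close> ranges over all representatives and all squares
  with a universal property, which is hard to compute with. Describing pushouts by kernels turns
  each use into a chase with vectors, and the same chase shows that composing total linear relations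
  amounts to pushing out their copartial maps. A universal property determines the apex only up to
  isomorphism, so its dimension must be shown unique as well; a trace identity does this. Quotients
  are built by dividing out one line at a time, so that no basis has to be chosen.

  Identities between distributions are proved for arbitrary probability measures, by testing against
  nonnegative measurable functions and exchanging integrals. Characteristic functions enter only
  where pushforward, product and convolution are shown to preserve Gaussian distributions.

  A relation carries no decoration, and every linear map fixes the Dirac measure at 0. Hence the
  choice of a copartial map for a relation leaves no trace in the class, and the second functor can
  be defined on the bare relation.\<close>

lemma mat_eqI_vec:
  fixes M N :: "'a :: comm_semiring_1 Matrix.mat"
  assumes M: "M \<in> carrier_mat n m" and N: "N \<in> carrier_mat n m"
    and eq: "\<And>x. x \<in> carrier_vec m \<Longrightarrow> M *\<^sub>v x = N *\<^sub>v x"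
  shows "M = N"
proof (rule eq_matI)
  fix i j assume ij: "i < dim_row N" "j < dim_col N"
  have "(M *\<^sub>v unit_vec m j) $ i = (N *\<^sub>v unit_vec m j) $ i"
    using eq[of "unit_vec m j"] by simp
  then show "M $$ (i, j) = N $$ (i, j)"
    using ij M N by simp
qed (use M N in auto)

lemma matrix_of_carrier [simp]: "matrix_of m n h \<in> carrier_mat n m"
  by (simp add: matrix_of_def)

lemma mat_prod_carrier [simp, intro]:
  "M \<in> carrier_mat n m \<Longrightarrow> N \<in> carrier_mat n' m' \<Longrightarrow> mat_prod M N \<in> carrier_mat (n + n') (m + m')"
  by (auto simp: mat_prod_def)

lemma dim_mat_prod [simp]:
  "dim_row (mat_prod M N) = dim_row M + dim_row N"
  "dim_col (mat_prod M N) = dim_col M + dim_col N"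
  by (auto simp: mat_prod_def)

lemma mat_prod_mult_vec:
  assumes "M \<in> carrier_mat n m" "N \<in> carrier_mat n' m'" "x \<in> carrier_vec m" "y \<in> carrier_vec m'"
  shows "mat_prod M N *\<^sub>v (x @\<^sub>v y) = (M *\<^sub>v x) @\<^sub>v (N *\<^sub>v y)"
proof -
  have "four_block_mat M (0\<^sub>m n m') (0\<^sub>m n' m) N *\<^sub>v (x @\<^sub>v y)
      = (M *\<^sub>v x + 0\<^sub>m n m' *\<^sub>v y) @\<^sub>v (0\<^sub>m n' m *\<^sub>v x + N *\<^sub>v y)"
    by (rule four_block_mat_mult_vec) (use assms in auto)
  moreover have "0\<^sub>m n m' *\<^sub>v y = 0\<^sub>v n" "0\<^sub>m n' m *\<^sub>v x = 0\<^sub>v n'"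
    using assms by auto
  moreover have "M *\<^sub>v x + 0\<^sub>v n = M *\<^sub>v x" "0\<^sub>v n' + N *\<^sub>v y = N *\<^sub>v y"
    using assms by auto
  ultimately show ?thesis
    using assms by (auto simp: mat_prod_def)
qed

lemma carrier_vec_appendE:
  assumes "z \<in> carrier_vec (m + n)"
  obtains x y where "x \<in> carrier_vec m" "y \<in> carrier_vec n" "z = x @\<^sub>v y"
  using assms vec_first_last_append vec_first_carrier vec_last_carrier by metis

text \<open>The form of extensionality used for block maps: on concatenated vectors
  \<open>mat_prod\<close> and \<open>braid_mat\<close> act by explicit formulas.\<close>

lemma mat_eqI_append:
  fixes M N :: "'a :: comm_semiring_1 Matrix.mat"
  assumes "M \<in> carrier_mat k (m + n)" "N \<in> carrier_mat k (m + n)"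
    and "\<And>x y. x \<in> carrier_vec m \<Longrightarrow> y \<in> carrier_vec n \<Longrightarrow> M *\<^sub>v (x @\<^sub>v y) = N *\<^sub>v (x @\<^sub>v y)"
  shows "M = N"
  using assms by (intro mat_eqI_vec[of M k "m + n"]) (auto elim!: carrier_vec_appendE)

lemma append_vec_assoc: "(x @\<^sub>v y) @\<^sub>v z = x @\<^sub>v (y @\<^sub>v z)"
  by (rule eq_vecI) auto

lemma append_vec_0_left: "x \<in> carrier_vec 0 \<Longrightarrow> x @\<^sub>v y = y"
  by (rule eq_vecI) auto

lemma append_vec_0_right: "y \<in> carrier_vec 0 \<Longrightarrow> x @\<^sub>v y = x"
  by (rule eq_vecI) auto

lemma zero_append_zero: "0\<^sub>v m @\<^sub>v 0\<^sub>v n = 0\<^sub>v (m + n)"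
  by (rule eq_vecI) auto

lemma smult_append_vec: "c \<cdot>\<^sub>v (x @\<^sub>v y) = (c \<cdot>\<^sub>v x) @\<^sub>v (c \<cdot>\<^sub>v y)"
  by (rule eq_vecI) auto

lemma mat_prod_comp:
  assumes "M \<in> carrier_mat k n" "N \<in> carrier_mat n m" "M' \<in> carrier_mat k' n'" "N' \<in> carrier_mat n' m'"
  shows "mat_prod (M * N) (M' * N') = mat_prod M M' * mat_prod N N'"
proof (rule mat_eqI_append)
  show "mat_prod (M * N) (M' * N') \<in> carrier_mat (k + k') (m + m')" using assms by auto
  show "mat_prod M M' * mat_prod N N' \<in> carrier_mat (k + k') (m + m')"
    using assms by (intro mult_carrier_mat[of _ _ "n + n'"] mat_prod_carrier)
  fix x y :: "real Matrix.vec" assume xy: "x \<in> carrier_vec m" "y \<in> carrier_vec m'"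
  have "mat_prod (M * N) (M' * N') *\<^sub>v (x @\<^sub>v y) = (M * N *\<^sub>v x) @\<^sub>v (M' * N' *\<^sub>v y)"
    using assms xy by (intro mat_prod_mult_vec) auto
  also have "\<dots> = (M *\<^sub>v (N *\<^sub>v x)) @\<^sub>v (M' *\<^sub>v (N' *\<^sub>v y))" using assms xy by simp
  also have "\<dots> = mat_prod M M' *\<^sub>v (mat_prod N N' *\<^sub>v (x @\<^sub>v y))"
    using assms xy
    by (subst mat_prod_mult_vec[OF assms(2,4) xy], subst mat_prod_mult_vec[OF assms(1,3)]) auto
  also have "\<dots> = mat_prod M M' * mat_prod N N' *\<^sub>v (x @\<^sub>v y)"
    using assms xy
    by (subst assoc_mult_mat_vec[where ?n\<^sub>1="k+k'" and ?n\<^sub>2="n+n'" and ?n\<^sub>3="m+m'"]) auto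
  finally show "mat_prod (M * N) (M' * N') *\<^sub>v (x @\<^sub>v y) = mat_prod M M' * mat_prod N N' *\<^sub>v (x @\<^sub>v y)" .
qed

lemma mat_prod_one: "mat_prod (1\<^sub>m m) (1\<^sub>m n) = 1\<^sub>m (m + n)"
  by (rule mat_eqI_append[of _ "m + n" m n]) (auto simp: mat_prod_mult_vec[of _ m m _ n n])

lemma mat_prod_assoc: "mat_prod (mat_prod M N) K = mat_prod M (mat_prod N K)"
proof (rule mat_eqI_append)
  let ?C = "carrier_mat (dim_row M + dim_row N + dim_row K) (dim_col M + dim_col N + dim_col K)"
  show "mat_prod (mat_prod M N) K \<in> ?C"
    by auto
  show "mat_prod M (mat_prod N K) \<in> ?C"
    by auto
  fix u z :: "real Matrix.vec"
  assume "u \<in> carrier_vec (dim_col M + dim_col N)" and z: "z \<in> carrier_vec (dim_col K)"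
  then obtain x y where xy: "x \<in> carrier_vec (dim_col M)" "y \<in> carrier_vec (dim_col N)" "u = x @\<^sub>v y"
    by (elim carrier_vec_appendE)
  have MNK: "M \<in> carrier_mat (dim_row M) (dim_col M)" "N \<in> carrier_mat (dim_row N) (dim_col N)"
    "K \<in> carrier_mat (dim_row K) (dim_col K)"
    by auto
  have "mat_prod (mat_prod M N) K *\<^sub>v (u @\<^sub>v z) = (mat_prod M N *\<^sub>v (x @\<^sub>v y)) @\<^sub>v (K *\<^sub>v z)"
    unfolding xy(3) using xy z
    by (intro mat_prod_mult_vec[OF mat_prod_carrier[OF MNK(1,2)] MNK(3)]) auto
  also have "\<dots> = (M *\<^sub>v x) @\<^sub>v (mat_prod N K *\<^sub>v (y @\<^sub>v z))"
    using mat_prod_mult_vec[OF MNK(1,2) xy(1,2)] mat_prod_mult_vec[OF MNK(2,3) xy(2) z]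
    by (simp only: append_vec_assoc)
  also have "\<dots> = mat_prod M (mat_prod N K) *\<^sub>v (x @\<^sub>v (y @\<^sub>v z))"
    using xy z
    by (intro mat_prod_mult_vec[OF MNK(1) mat_prod_carrier[OF MNK(2,3)], symmetric]) auto
  finally show "mat_prod (mat_prod M N) K *\<^sub>v (u @\<^sub>v z) = mat_prod M (mat_prod N K) *\<^sub>v (u @\<^sub>v z)"
    unfolding xy(3) append_vec_assoc .
qed

lemma mat_prod_one_left: "mat_prod (1\<^sub>m 0) M = M"
  unfolding mat_prod_def four_block_mat_def Let_def by (rule eq_matI) auto

lemma mat_prod_one_right: "mat_prod M (1\<^sub>m 0) = M"
  unfolding mat_prod_def four_block_mat_def Let_def by (rule eq_matI) auto

section \<open>Invertible matrices and uniqueness of the dimension\<close>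

text \<open>The traces of \<open>U * V\<close> and \<open>V * U\<close> agree, and here they are
  \<open>n\<close> and \<open>m\<close>; characteristic 0 makes these natural numbers equal.\<close>

lemma dim_unique_of_inverse:
  fixes U V :: "'a :: {comm_ring_1, ring_char_0} Matrix.mat"
  assumes U: "U \<in> carrier_mat n m" and V: "V \<in> carrier_mat m n"
    and UV: "U * V = 1\<^sub>m n" and VU: "V * U = 1\<^sub>m m"
  shows "n = m"
proof -
  have "(\<Sum>i<n. (U * V) $$ (i, i)) = (\<Sum>i<n. \<Sum>j<m. U $$ (i, j) * V $$ (j, i))"
    using U V by (intro sum.cong) (auto simp: scalar_prod_def atLeast0LessThan)
  also have "\<dots> = (\<Sum>j<m. \<Sum>i<n. V $$ (j, i) * U $$ (i, j))"
    by (subst sum.swap) (simp add: mult.commute)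
  also have "\<dots> = (\<Sum>j<m. (V * U) $$ (j, j))"
    using U V by (intro sum.cong) (auto simp: scalar_prod_def atLeast0LessThan)
  finally show ?thesis using UV VU by simp
qed

lemma invertible_matI:
  assumes "U \<in> carrier_mat n n" "V \<in> carrier_mat n n" "U * V = 1\<^sub>m n" "V * U = 1\<^sub>m n"
  shows "invertible_mat U"
  using assms by (auto simp: invertible_mat_def inverts_mat_def)

text \<open>\<open>invertible_mat\<close> does not state the shape of the inverse; it is read off
  from the column counts of the two products.\<close>

lemma invertible_matE:
  assumes "invertible_mat U" "U \<in> carrier_mat n n"
  obtains V where "V \<in> carrier_mat n n" "U * V = 1\<^sub>m n" "V * U = 1\<^sub>m n"
proof -
  obtain V where V: "U * V = 1\<^sub>m n" "V * U = 1\<^sub>m (dim_row V)"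
    using assms by (auto simp: invertible_mat_def inverts_mat_def)
  have "dim_col V = n" using arg_cong[OF V(1), of dim_col] by simp
  moreover have "dim_row V = n" using arg_cong[OF V(2), of dim_col] assms by simp
  ultimately show ?thesis using V that[of V] by auto
qed

lemma invertible_mat_mult:
  assumes "invertible_mat M" "invertible_mat N" "M \<in> carrier_mat n n" "N \<in> carrier_mat n n"
  shows "invertible_mat (M * N)"
proof -
  obtain M' N' where *: "M' \<in> carrier_mat n n" "M * M' = 1\<^sub>m n" "M' * M = 1\<^sub>m n"
    "N' \<in> carrier_mat n n" "N * N' = 1\<^sub>m n" "N' * N = 1\<^sub>m n"
    using assms by (metis invertible_matE)
  have "(M * N) * (N' * M') = M * ((N * N') * M')" "(N' * M') * (M * N) = N' * ((M' * M) * N)"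
    using *(1,4) assms(3,4) by (auto simp: assoc_mult_mat[of _ n n _ n _ n])
  then show ?thesis
    using * assms by (intro invertible_matI[of _ n "N' * M'"]) auto
qed

lemma invertible_mat_prod:
  assumes "invertible_mat M" "invertible_mat N" "M \<in> carrier_mat m m" "N \<in> carrier_mat n n"
  shows "invertible_mat (mat_prod M N)"
proof -
  obtain M' N' where *: "M' \<in> carrier_mat m m" "M * M' = 1\<^sub>m m" "M' * M = 1\<^sub>m m"
    "N' \<in> carrier_mat n n" "N * N' = 1\<^sub>m n" "N' * N = 1\<^sub>m n"
    using assms by (metis invertible_matE)
  show ?thesis
    using * assms mat_prod_comp[of M m m M' m N n n N' n] mat_prod_comp[of M' m m M m N' n n N n]
    by (intro invertible_matI[of _ "m + n" "mat_prod M' N'"]) (auto simp: mat_prod_one)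
qed

section \<open>Surjections and their linear sections\<close>

text \<open>The columns of a section are chosen preimages of the unit vectors. With a section at
  hand, factorizations through \<open>p\<close> become matrix products.\<close>

lemma surj_mat_iff_right_inverse:
  assumes p: "p \<in> carrier_mat k n"
  shows "surj_mat p \<longleftrightarrow> (\<exists>s \<in> carrier_mat n k. p * s = 1\<^sub>m k)"
proof
  assume "surj_mat p"
  then have "\<forall>j. \<exists>y \<in> carrier_vec n. p *\<^sub>v y = unit_vec k j"
    using p by (auto simp: surj_mat_def)
  then obtain y where y: "\<And>j. y j \<in> carrier_vec n" "\<And>j. p *\<^sub>v y j = unit_vec k j" by metis
  let ?s = "Matrix.mat n k (\<lambda>(i, j). y j $ i)"
  have "p * ?s = 1\<^sub>m k"
  proof (rule eq_matI)
    fix i j assume ij: "i < dim_row (1\<^sub>m k)" "j < dim_col (1\<^sub>m k)"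
    have "Matrix.col ?s j = y j" using ij y(1)[of j] by (intro eq_vecI) auto
    then have "(p * ?s) $$ (i, j) = (p *\<^sub>v y j) $ i" using ij p by simp
    then show "(p * ?s) $$ (i, j) = 1\<^sub>m k $$ (i, j)" using ij by (simp add: y unit_vec_def)
  qed (use p in auto)
  then show "\<exists>s \<in> carrier_mat n k. p * s = 1\<^sub>m k" by auto
next
  assume "\<exists>s \<in> carrier_mat n k. p * s = 1\<^sub>m k"
  then obtain s where s: "s \<in> carrier_mat n k" "p * s = 1\<^sub>m k" by auto
  have "p *\<^sub>v (s *\<^sub>v z) = z" if "z \<in> carrier_vec k" for z
    using assoc_mult_mat_vec[OF p s(1) that] s(2) that by simp
  then show "surj_mat p"
    using p s unfolding surj_mat_def by (metis carrier_matD mult_mat_vec_carrier)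
qed

lemma surj_mat_one: "surj_mat (1\<^sub>m n)"
  by (auto simp: surj_mat_def)

lemma surj_mat_mult:
  fixes p q :: "real Matrix.mat"
  assumes "surj_mat p" "surj_mat q" "p \<in> carrier_mat k n" "q \<in> carrier_mat n m"
  shows "surj_mat (p * q)"
  unfolding surj_mat_def
proof
  fix z :: "real Matrix.vec" assume z: "z \<in> carrier_vec (dim_row (p * q))"
  then obtain y where y: "y \<in> carrier_vec n" "p *\<^sub>v y = z"
    using assms by (auto simp: surj_mat_def)
  then obtain x where "x \<in> carrier_vec m" "q *\<^sub>v x = y"
    using assms by (fastforce simp: surj_mat_def)
  with y assms show "\<exists>y \<in> carrier_vec (dim_col (p * q)). p * q *\<^sub>v y = z"
    by (intro bexI[of _ x]) auto
qed

lemma surj_mat_invertible: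
  assumes "invertible_mat u" "u \<in> carrier_mat n n" shows "surj_mat u"
  using assms by (metis invertible_matE surj_mat_iff_right_inverse)

lemma surj_mat_prod:
  assumes "surj_mat p" "surj_mat q" "p \<in> carrier_mat k n" "q \<in> carrier_mat k' n'"
  shows "surj_mat (mat_prod p q)"
proof -
  obtain s t where "s \<in> carrier_mat n k" "p * s = 1\<^sub>m k" "t \<in> carrier_mat n' k'" "q * t = 1\<^sub>m k'"
    using assms by (auto simp: surj_mat_iff_right_inverse)
  with assms show ?thesis
    using mat_prod_comp[of p k n s k q k' n' t k']
    by (subst surj_mat_iff_right_inverse[of _ "k + k'" "n + n'"])
       (auto simp: mat_prod_one intro!: bexI[of _ "mat_prod s t"])
qed

text \<open>Surjections are epimorphisms: multiply on the right by a section.\<close>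

lemma mat_mult_right_cancel_surj:
  assumes p: "p \<in> carrier_mat k n" "surj_mat p" and "u \<in> carrier_mat w k" "v \<in> carrier_mat w k"
    and eq: "u * p = v * p"
  shows "u = v"
proof -
  obtain s where s: "s \<in> carrier_mat n k" "p * s = 1\<^sub>m k"
    using p by (auto simp: surj_mat_iff_right_inverse)
  have "u * p * s = u" "v * p * s = v"
    using assms(1,3,4) s by (auto simp: assoc_mult_mat[of _ w k _ n _ k])
  then show ?thesis using eq by metis
qed

text \<open>The homomorphism theorem in matrix form: a map \<open>N\<close> that vanishes on the
  kernel of \<open>p\<close> factors through \<open>p\<close>, with factor \<open>N * s\<close>. The
  reason is that \<open>s *\<^sub>v (p *\<^sub>v y) - y\<close> always lies in that kernel.\<close>

lemma mult_right_inverse_cancel: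
  fixes N :: "'a :: comm_ring_1 Matrix.mat"
  assumes p: "p \<in> carrier_mat k n" and s: "s \<in> carrier_mat n k" "p * s = 1\<^sub>m k" and N: "N \<in> carrier_mat z n"
    and ker: "\<And>y. y \<in> carrier_vec n \<Longrightarrow> p *\<^sub>v y = 0\<^sub>v k \<Longrightarrow> N *\<^sub>v y = 0\<^sub>v z"
  shows "N * s * p = N"
proof (rule mat_eqI_vec)
  show Ns: "N * s * p \<in> carrier_mat z n" using N s p by auto
  fix y :: "'a Matrix.vec" assume y: "y \<in> carrier_vec n"
  have py: "p *\<^sub>v y \<in> carrier_vec k" using p y by auto
  have spy: "s *\<^sub>v (p *\<^sub>v y) \<in> carrier_vec n" using s py by auto
  have "p *\<^sub>v (s *\<^sub>v (p *\<^sub>v y)) = p *\<^sub>v y"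
    using assoc_mult_mat_vec[OF p s(1) py] s(2) py by simp
  then have "p *\<^sub>v (s *\<^sub>v (p *\<^sub>v y) - y) = 0\<^sub>v k"
    using mult_minus_distrib_mat_vec[OF p spy y] py by simp
  then have *: "N *\<^sub>v (s *\<^sub>v (p *\<^sub>v y)) - N *\<^sub>v y = 0\<^sub>v z"
    using ker[of "s *\<^sub>v (p *\<^sub>v y) - y"] mult_minus_distrib_mat_vec[OF N spy y] spy y by simp
  have "N * s * p *\<^sub>v y = N *\<^sub>v (s *\<^sub>v (p *\<^sub>v y))"
    using assoc_mult_mat_vec[OF mult_carrier_mat[OF N s(1)] p y] assoc_mult_mat_vec[OF N s(1) py] by simp
  also have "\<dots> = N *\<^sub>v y"
  proof (rule eq_vecI)
    fix i assume "i < dim_vec (N *\<^sub>v y)"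
    then show "(N *\<^sub>v (s *\<^sub>v (p *\<^sub>v y))) $ i = (N *\<^sub>v y) $ i"
      using arg_cong[OF *, of "\<lambda>v. v $ i"] N by simp
  qed simp
  finally show "N * s * p *\<^sub>v y = N *\<^sub>v y" .
qed (rule N)

section \<open>Quotients of coordinate spaces by subspaces\<close>

text \<open>The quotient by a single line: a coordinate \<open>i\<close> with \<open>v $ i\<close>
  nonzero is cleared by subtracting a multiple of \<open>v\<close>, and then dropped.\<close>

lemma exists_matrix_killing_vector:
  fixes v :: "real Matrix.vec"
  assumes v: "v \<in> carrier_vec (Suc w)" "v \<noteq> 0\<^sub>v (Suc w)"
  obtains D where "D \<in> carrier_mat w (Suc w)" "surj_mat D"
    "\<And>x. x \<in> carrier_vec (Suc w) \<Longrightarrow> D *\<^sub>v x = 0\<^sub>v w \<Longrightarrow> \<exists>c. x = c \<cdot>\<^sub>v v" "D *\<^sub>v v = 0\<^sub>v w"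
proof -
  obtain i where i: "i < Suc w" "v $ i \<noteq> 0"
    using v by (metis eq_vecI carrier_vecD index_zero_vec)
  \<comment> \<open>\<open>?e\<close> enumerates the coordinates other than \<open>i\<close>, and
    \<open>?d\<close> is its inverse. Row \<open>k\<close> of \<open>D\<close> reads coordinate
    \<open>?e k\<close> of \<open>x - (x $ i / v $ i) \<cdot>\<^sub>v v\<close>.\<close>
  let ?e = "\<lambda>k. if k < i then k else Suc k" and ?d = "\<lambda>j. if j < i then j else j - 1"
  define D where "D = Matrix.mat w (Suc w) (\<lambda>(k, j). (if j = ?e k then 1 else 0)
    - (if j = i then v $ ?e k / v $ i else 0))"
  have D: "D \<in> carrier_mat w (Suc w)" by (simp add: D_def)
  have e: "?e k < Suc w" "?e k \<noteq> i" if "k < w" for k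
    using that by auto
  have Dx: "(D *\<^sub>v x) $ k = x $ ?e k - x $ i * v $ ?e k / v $ i"
    if x: "x \<in> carrier_vec (Suc w)" and k: "k < w" for x k
  proof -
    have "(D *\<^sub>v x) $ k = (\<Sum>j = 0..<Suc w. ((if j = ?e k then 1 else 0)
        - (if j = i then v $ ?e k / v $ i else 0)) * x $ j)"
      using x k by (simp add: D_def scalar_prod_def del: sum.op_ivl_Suc)
    also have "\<dots> = (\<Sum>j = 0..<Suc w. (if j = ?e k then x $ j else 0))
        - (\<Sum>j = 0..<Suc w. if j = i then v $ ?e k / v $ i * x $ j else 0)"
      unfolding sum_subtractf[symmetric] by (intro sum.cong) auto
    also have "\<dots> = x $ ?e k - x $ i * v $ ?e k / v $ i"
      using e[OF k] i by (simp del: sum.op_ivl_Suc)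
    finally show ?thesis .
  qed
  show thesis
  proof (rule that[of D])
    show "D \<in> carrier_mat w (Suc w)" by fact
    show "D *\<^sub>v v = 0\<^sub>v w"
      using Dx[OF v(1)] i D by (intro eq_vecI) auto
    \<comment> \<open>The factor is dictated by coordinate \<open>i\<close>; at every other
      coordinate the vanishing of \<open>D *\<^sub>v x\<close> says exactly that \<open>x\<close>
      agrees with this multiple of \<open>v\<close>.\<close>
    show "\<exists>c. x = c \<cdot>\<^sub>v v" if x: "x \<in> carrier_vec (Suc w)" and Dx0: "D *\<^sub>v x = 0\<^sub>v w" for x
    proof (intro exI[of _ "x $ i / v $ i"] eq_vecI)
      fix j assume "j < dim_vec ((x $ i / v $ i) \<cdot>\<^sub>v v)"
      then have j: "j < Suc w" using v by simp
      show "x $ j = ((x $ i / v $ i) \<cdot>\<^sub>v v) $ j"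
      proof (cases "j = i")
        case False
        then have "j = ?e (?d j)" "?d j < w"
          using j i by auto
        then show ?thesis
          using Dx[OF x, of "?d j"] j v Dx0 by simp
      qed (use i v in auto)
    qed (use x v in auto)
    show "surj_mat D"
      unfolding surj_mat_def
    proof
      fix z :: "real Matrix.vec" assume z: "z \<in> carrier_vec (dim_row D)"
      \<comment> \<open>A preimage of \<open>z\<close> with entry 0 at \<open>i\<close>: for such a
        vector no correction by \<open>v\<close> takes place, and \<open>D\<close> just deletes
        coordinate \<open>i\<close>.\<close>
      define x where "x = vec (Suc w) (\<lambda>j. if j = i then 0 else z $ ?d j)"
      have x: "x \<in> carrier_vec (Suc w)" by (simp add: x_def)
      have "D *\<^sub>v x = z"
      proof (rule eq_vecI)
        fix k assume "k < dim_vec z"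
        then have k: "k < w" using z D by simp
        moreover have "?d (?e k) = k"
          by simp
        ultimately show "(D *\<^sub>v x) $ k = z $ k"
          using Dx[OF x k] e[OF k] i by (simp add: x_def)
      qed (use z in auto)
      then show "\<exists>y \<in> carrier_vec (dim_col D). D *\<^sub>v y = z"
        using x D by auto
    qed
  qed
qed

text \<open>Induction on the number of rows of a surjection \<open>C\<close> whose kernel lies in
  \<open>S\<close>. Either \<open>C\<close> kills all of \<open>S\<close> and is the quotient map,
  or some \<open>s\<close> in \<open>S\<close> survives; then dividing out the line through
  \<open>C *\<^sub>v s\<close> removes a row and enlarges the kernel within
  \<open>S\<close>.\<close>

lemma exists_quotient_matrix_aux:
  assumes S: "S \<subseteq> carrier_vec q"
    and add: "\<And>x y. x \<in> S \<Longrightarrow> y \<in> S \<Longrightarrow> x + y \<in> S"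
    and smult: "\<And>c x. x \<in> S \<Longrightarrow> c \<cdot>\<^sub>v x \<in> S"
    and C: "C \<in> carrier_mat w q" "surj_mat C" "\<And>x. x \<in> carrier_vec q \<Longrightarrow> C *\<^sub>v x = 0\<^sub>v w \<Longrightarrow> x \<in> S"
  shows "\<exists>w C. C \<in> carrier_mat w q \<and> surj_mat C \<and> (\<forall>x \<in> carrier_vec q. C *\<^sub>v x = 0\<^sub>v w \<longleftrightarrow> x \<in> S)"
  using C
proof (induction w arbitrary: C)
  case 0
  then have "C *\<^sub>v x = 0\<^sub>v 0" if "x \<in> carrier_vec q" for x using that by (intro eq_vecI) auto
  with 0 show ?case by blast
next
  case (Suc w)
  show ?case
  proof (cases "\<forall>x \<in> S. C *\<^sub>v x = 0\<^sub>v (Suc w)")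
    case True
    with Suc.prems S show ?thesis by blast
  next
    case False
    then obtain s where s: "s \<in> S" "C *\<^sub>v s \<noteq> 0\<^sub>v (Suc w)" by blast
    then have sq: "s \<in> carrier_vec q" using S by auto
    have "C *\<^sub>v s \<in> carrier_vec (Suc w)" using Suc.prems sq by auto
    then obtain D where D: "D \<in> carrier_mat w (Suc w)" "surj_mat D"
      "\<And>x. x \<in> carrier_vec (Suc w) \<Longrightarrow> D *\<^sub>v x = 0\<^sub>v w \<Longrightarrow> \<exists>c. x = c \<cdot>\<^sub>v (C *\<^sub>v s)"
      using exists_matrix_killing_vector[of "C *\<^sub>v s" w] s by metis
    show ?thesis
    proof (rule Suc.IH)
      show "D * C \<in> carrier_mat w q" using D Suc.prems by auto
      show "surj_mat (D * C)" using D Suc.prems by (intro surj_mat_mult)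
      fix x assume x: "x \<in> carrier_vec q" and "D * C *\<^sub>v x = 0\<^sub>v w"
      then have "D *\<^sub>v (C *\<^sub>v x) = 0\<^sub>v w" "C *\<^sub>v x \<in> carrier_vec (Suc w)" using D Suc.prems by auto
      then obtain c where c: "C *\<^sub>v x = c \<cdot>\<^sub>v (C *\<^sub>v s)" using D(3) by blast
      \<comment> \<open>As \<open>C *\<^sub>v x\<close> is the multiple \<open>c\<close> of
        \<open>C *\<^sub>v s\<close>, the difference lies in the kernel of \<open>C\<close>, hence
        in \<open>S\<close>; adding back the multiple of \<open>s\<close> stays in
        \<open>S\<close>.\<close>
      have "C *\<^sub>v (x - c \<cdot>\<^sub>v s) = C *\<^sub>v x - C *\<^sub>v (c \<cdot>\<^sub>v s)"
        using x sq Suc.prems by (intro mult_minus_distrib_mat_vec) auto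
      also have "\<dots> = 0\<^sub>v (Suc w)"
        using c sq Suc.prems by (auto simp: mult_mat_vec)
      finally have "x - c \<cdot>\<^sub>v s \<in> S"
        using x sq Suc.prems(3) by auto
      moreover have "(x - c \<cdot>\<^sub>v s) + c \<cdot>\<^sub>v s = x"
        using x sq by (intro eq_vecI) auto
      ultimately show "x \<in> S"
        using add[of "x - c \<cdot>\<^sub>v s" "c \<cdot>\<^sub>v s"] smult[OF s(1)] by simp
    qed
  qed
qed

text \<open>The induction starts from the identity matrix, whose kernel is zero.\<close>

lemma exists_quotient_matrix:
  assumes S: "S \<subseteq> carrier_vec q" "0\<^sub>v q \<in> S"
    and "\<And>x y. x \<in> S \<Longrightarrow> y \<in> S \<Longrightarrow> x + y \<in> S"
    and "\<And>c x. x \<in> S \<Longrightarrow> c \<cdot>\<^sub>v x \<in> S"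
  obtains w C where "C \<in> carrier_mat w q" "surj_mat C"
    "\<And>x. x \<in> carrier_vec q \<Longrightarrow> C *\<^sub>v x = 0\<^sub>v w \<longleftrightarrow> x \<in> S"
  using exists_quotient_matrix_aux[of S q "1\<^sub>m q" q] assms surj_mat_one by fastforce

section \<open>Pushouts along surjections\<close>

text \<open>The mediating map is \<open>j2 * t\<close> for a section \<open>t\<close> of
  \<open>i2\<close>. It is well behaved because \<open>j2\<close> vanishes on the kernel of
  \<open>i2\<close>, every element of which is the image under \<open>g\<close> of something killed
  by \<open>p\<close>. Uniqueness holds since \<open>i2\<close> is epi.\<close>

lemma is_pushoutI_exact:
  assumes p: "p \<in> carrier_mat k n" "surj_mat p" and g: "g \<in> carrier_mat l n"
    and i1: "i1 \<in> carrier_mat w k" and i2: "i2 \<in> carrier_mat w l" "surj_mat i2"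
    and comm: "i1 * p = i2 * g"
    and exact: "\<And>b. b \<in> carrier_vec l \<Longrightarrow> i2 *\<^sub>v b = 0\<^sub>v w \<Longrightarrow>
      \<exists>y \<in> carrier_vec n. p *\<^sub>v y = 0\<^sub>v k \<and> g *\<^sub>v y = b"
  shows "is_pushout p g i1 i2"
proof -
  obtain t where t: "t \<in> carrier_mat l w" "i2 * t = 1\<^sub>m w"
    using i2 by (auto simp: surj_mat_iff_right_inverse)
  have "\<exists>!u. u \<in> carrier_mat z w \<and> u * i1 = j1 \<and> u * i2 = j2"
    if j1: "j1 \<in> carrier_mat z k" and j2: "j2 \<in> carrier_mat z l" and eq: "j1 * p = j2 * g"
    for z j1 j2
  proof (intro ex1I[of _ "j2 * t"] conjI)
    have ker: "j2 *\<^sub>v b = 0\<^sub>v z" if b: "b \<in> carrier_vec l" "i2 *\<^sub>v b = 0\<^sub>v w" for b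
    proof -
      obtain y where y: "y \<in> carrier_vec n" "p *\<^sub>v y = 0\<^sub>v k" "g *\<^sub>v y = b"
        using exact[OF b] by auto
      then have "j2 *\<^sub>v b = j2 * g *\<^sub>v y" using j2 g by auto
      also have "\<dots> = j1 *\<^sub>v (p *\<^sub>v y)" using eq[symmetric] j1 p y(1) by auto
      finally show ?thesis using y(2) j1 by auto
    qed
    show i2u: "j2 * t * i2 = j2"
      by (rule mult_right_inverse_cancel[OF i2(1) t j2 ker])
    show u: "j2 * t \<in> carrier_mat z w" using j2 t by auto
    \<comment> \<open>The condition on \<open>i1\<close> is checked after precomposition with the
      surjection \<open>p\<close>, where commutativity of the square reduces it to the condition on
      \<open>i2\<close>.\<close>
    have "j2 * t * i1 * p = j2 * t * (i1 * p)"
      using i1 p u by (intro assoc_mult_mat) auto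
    also have "\<dots> = j2 * t * i2 * g"
      unfolding comm using i2 g u by (intro assoc_mult_mat[symmetric]) auto
    finally have "j2 * t * i1 * p = j1 * p"
      unfolding i2u eq .
    then show "j2 * t * i1 = j1"
      using mat_mult_right_cancel_surj[OF p, of "j2 * t * i1" z j1] i1 u j1 by auto
    fix u' assume "u' \<in> carrier_mat z w \<and> u' * i1 = j1 \<and> u' * i2 = j2"
    then show "u' = j2 * t"
      using mat_mult_right_cancel_surj[OF i2, of u' z "j2 * t"] u i2u by auto
  qed
  then show ?thesis
    using assms by (auto simp: is_pushout_def)
qed

text \<open>The apex is the quotient of the codomain of \<open>g\<close> by the image of the kernel
  of \<open>p\<close>.\<close>

lemma exists_exact_pushout:
  assumes p: "p \<in> carrier_mat k n" "surj_mat p" and g: "g \<in> carrier_mat l n"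
  obtains w i1 i2 where "i1 \<in> carrier_mat w k" "i2 \<in> carrier_mat w l" "surj_mat i2" "i1 * p = i2 * g"
    "\<And>b. b \<in> carrier_vec l \<Longrightarrow> i2 *\<^sub>v b = 0\<^sub>v w \<Longrightarrow>
      \<exists>y \<in> carrier_vec n. p *\<^sub>v y = 0\<^sub>v k \<and> g *\<^sub>v y = b"
proof -
  obtain s where s: "s \<in> carrier_mat n k" "p * s = 1\<^sub>m k"
    using p by (auto simp: surj_mat_iff_right_inverse)
  define S where "S = {g *\<^sub>v y | y. y \<in> carrier_vec n \<and> p *\<^sub>v y = 0\<^sub>v k}"
  obtain w i2 where i2: "i2 \<in> carrier_mat w l" "surj_mat i2"
    "\<And>b. b \<in> carrier_vec l \<Longrightarrow> i2 *\<^sub>v b = 0\<^sub>v w \<longleftrightarrow> b \<in> S"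
  proof (rule exists_quotient_matrix[of S l])
    show "S \<subseteq> carrier_vec l" using g by (auto simp: S_def)
    show "0\<^sub>v l \<in> S" unfolding S_def using p g by (auto intro!: exI[of _ "0\<^sub>v n"])
    show "x + y \<in> S" if xy: "x \<in> S" "y \<in> S" for x y
    proof -
      obtain x' y' where "x' \<in> carrier_vec n" "p *\<^sub>v x' = 0\<^sub>v k" "x = g *\<^sub>v x'"
        "y' \<in> carrier_vec n" "p *\<^sub>v y' = 0\<^sub>v k" "y = g *\<^sub>v y'"
        using xy by (auto simp: S_def)
      then show ?thesis
        unfolding S_def using g p
        by (auto intro!: exI[of _ "x' + y'"] simp: mult_add_distrib_mat_vec[of _ _ n])
    qed
    show "c \<cdot>\<^sub>v x \<in> S" if x: "x \<in> S" for c x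
    proof -
      obtain x' where "x' \<in> carrier_vec n" "p *\<^sub>v x' = 0\<^sub>v k" "x = g *\<^sub>v x'"
        using x by (auto simp: S_def)
      then show ?thesis
        unfolding S_def using g p
        by (auto intro!: exI[of _ "c \<cdot>\<^sub>v x'"] simp: mult_mat_vec[of _ _ n])
    qed
  qed blast
  show thesis
  \<comment> \<open>The left leg is forced: multiplying \<open>i1 * p = i2 * g\<close> by the
    section \<open>s\<close> gives \<open>i1 = i2 * (g * s)\<close>. The square then commutes
    because \<open>i2 * g\<close> kills the kernel of \<open>p\<close>.\<close>
  proof (rule that[of "i2 * (g * s)" w i2])
    show "i2 * (g * s) \<in> carrier_mat w k" using i2 g s by auto
    have i2g: "i2 * g \<in> carrier_mat w n" using i2 g by auto
    have "i2 * g *\<^sub>v y = 0\<^sub>v w" if y: "y \<in> carrier_vec n" "p *\<^sub>v y = 0\<^sub>v k" for y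
    proof -
      have "g *\<^sub>v y \<in> S" using y by (auto simp: S_def)
      then show ?thesis using i2(3)[of "g *\<^sub>v y"] assoc_mult_mat_vec[OF i2(1) g y(1)] g y by simp
    qed
    then have "i2 * g * s * p = i2 * g"
      by (rule mult_right_inverse_cancel[OF p(1) s i2g])
    then show "i2 * (g * s) * p = i2 * g"
      by (simp only: assoc_mult_mat[OF i2(1) g s(1)])
    show "\<exists>y \<in> carrier_vec n. p *\<^sub>v y = 0\<^sub>v k \<and> g *\<^sub>v y = b"
      if "b \<in> carrier_vec l" "i2 *\<^sub>v b = 0\<^sub>v w" for b
      using i2(3)[OF that(1)] that(2) by (auto simp: S_def)
  qed (use i2 in auto)
qed

text \<open>The two mediating maps are mutually inverse by the uniqueness clauses, and then
  \<open>dim_unique_of_inverse\<close> makes the comparison a square matrix, as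
  \<open>decorated_eq\<close> requires.\<close>

lemma pushout_unique:
  assumes p: "p \<in> carrier_mat k n" and g: "g \<in> carrier_mat l n"
    and i: "is_pushout p g i1 i2" and j: "is_pushout p g j1 j2"
  obtains u where "u \<in> carrier_mat (dim_row i1) (dim_row i1)" "invertible_mat u"
    "u * i1 = j1" "u * i2 = j2" "dim_row j1 = dim_row i1"
proof -
  let ?w = "dim_row i1" and ?v = "dim_row j1"
  have ci: "i1 \<in> carrier_mat ?w k" "i2 \<in> carrier_mat ?w l" "i1 * p = i2 * g"
    and cj: "j1 \<in> carrier_mat ?v k" "j2 \<in> carrier_mat ?v l" "j1 * p = j2 * g"
    using i j p g by (auto simp: is_pushout_def)
  have univ_i: "\<exists>!u. u \<in> carrier_mat z ?w \<and> u * i1 = a \<and> u * i2 = b"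
    if "a \<in> carrier_mat z k" "b \<in> carrier_mat z l" "a * p = b * g" for z a b
    using i p g that by (auto simp: is_pushout_def)
  have univ_j: "\<exists>!u. u \<in> carrier_mat z ?v \<and> u * j1 = a \<and> u * j2 = b"
    if "a \<in> carrier_mat z k" "b \<in> carrier_mat z l" "a * p = b * g" for z a b
    using j p g that by (auto simp: is_pushout_def)
  obtain u where u: "u \<in> carrier_mat ?v ?w" "u * i1 = j1" "u * i2 = j2"
    using univ_i[OF cj] by blast
  obtain v where v: "v \<in> carrier_mat ?w ?v" "v * j1 = i1" "v * j2 = i2"
    using univ_j[OF ci] by blast
  have uv: "u * v * j1 = j1" "u * v * j2 = j2"
    using assoc_mult_mat[OF u(1) v(1)] cj(1,2) u(2,3) v(2,3) by metis+
  have vu: "v * u * i1 = i1" "v * u * i2 = i2"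
    using assoc_mult_mat[OF v(1) u(1)] ci(1,2) u(2,3) v(2,3) by metis+
  have UV: "u * v = 1\<^sub>m ?v"
    using univ_j[OF cj] uv u v cj by (metis left_mult_one_mat mult_carrier_mat one_carrier_mat)
  have VU: "v * u = 1\<^sub>m ?w"
    using univ_i[OF ci] vu u v ci by (metis left_mult_one_mat mult_carrier_mat one_carrier_mat)
  have dim: "?v = ?w" using dim_unique_of_inverse[OF u(1) v(1) UV VU] .
  have "invertible_mat u"
    using u v UV VU dim by (intro invertible_matI[of _ ?w v]) (simp_all only:)
  with u dim show thesis by (intro that[of u]) (simp_all only:)
qed

text \<open>For the converse, any pushout is compared with the one already constructed; surjectivity
  of the right leg and the kernel condition are transported along the isomorphism of apexes.\<close>

lemma pushout_iff_exact:
  assumes p: "p \<in> carrier_mat k n" "surj_mat p" and g: "g \<in> carrier_mat l n"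
    and i1: "i1 \<in> carrier_mat w k" and i2: "i2 \<in> carrier_mat w l"
  shows "is_pushout p g i1 i2 \<longleftrightarrow> surj_mat i2 \<and> i1 * p = i2 * g \<and>
    (\<forall>b \<in> carrier_vec l. i2 *\<^sub>v b = 0\<^sub>v w \<longrightarrow> (\<exists>y \<in> carrier_vec n. p *\<^sub>v y = 0\<^sub>v k \<and> g *\<^sub>v y = b))"
    (is "?L \<longleftrightarrow> ?R")
proof
  assume ?R
  then show ?L using is_pushoutI_exact[OF p g i1 i2] by blast
next
  assume L: ?L
  obtain v j1 j2 where j: "j1 \<in> carrier_mat v k" "j2 \<in> carrier_mat v l" "surj_mat j2" "j1 * p = j2 * g"
    "\<And>b. b \<in> carrier_vec l \<Longrightarrow> j2 *\<^sub>v b = 0\<^sub>v v \<Longrightarrow>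
      \<exists>y \<in> carrier_vec n. p *\<^sub>v y = 0\<^sub>v k \<and> g *\<^sub>v y = b"
    using exists_exact_pushout[OF p g] by metis
  then have "is_pushout p g j1 j2"
    using is_pushoutI_exact[OF p g] by blast
  then obtain u where u: "u \<in> carrier_mat v v" "invertible_mat u" "u * j1 = i1" "u * j2 = i2" "v = w"
    using pushout_unique[OF p(1) g _ L, of j1 j2] j i1 by auto
  have "j2 *\<^sub>v b = 0\<^sub>v w" if b: "b \<in> carrier_vec l" "i2 *\<^sub>v b = 0\<^sub>v w" for b
  proof -
    obtain u' where u': "u' \<in> carrier_mat v v" "u' * u = 1\<^sub>m v"
      using u by (metis invertible_matE)
    have "j2 *\<^sub>v b = (u' * u) *\<^sub>v (j2 *\<^sub>v b)" using j b u' by auto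
    also have "\<dots> = u' *\<^sub>v (u *\<^sub>v (j2 *\<^sub>v b))" using j b u' u by (intro assoc_mult_mat_vec) auto
    also have "u *\<^sub>v (j2 *\<^sub>v b) = i2 *\<^sub>v b" using j b u by auto
    finally show ?thesis using b u' u by auto
  qed
  moreover have "surj_mat i2"
    using surj_mat_mult[OF surj_mat_invertible[OF u(2,1)] j(3) u(1) j(2)] u(4) by simp
  moreover have "i1 * p = i2 * g"
    using L by (auto simp: is_pushout_def)
  ultimately show ?R using j u by blast
qed

lemma pushout_exists:
  assumes "p \<in> carrier_mat k n" "surj_mat p" "g \<in> carrier_mat l n"
  obtains w i1 i2 where "is_pushout p g i1 i2" "i1 \<in> carrier_mat w k" "i2 \<in> carrier_mat w l" "surj_mat i2"
  using exists_exact_pushout[OF assms] is_pushoutI_exact[OF assms] by metis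

text \<open>Covers every composite whose first map has the identity as right leg, thus in particular
  the images of Gaussian maps and of linear maps.\<close>

lemma pushout_one_left:
  assumes "g \<in> carrier_mat l n" shows "is_pushout (1\<^sub>m n) g g (1\<^sub>m l)"
  using assms
  by (subst pushout_iff_exact[where k=n and n=n and l=l and w=l]) (auto simp: surj_mat_one intro!: bexI[of _ "0\<^sub>v n"])

text \<open>Following a copartial map by an isomorphism \<open>h\<close> keeps the apex and replaces
  the right leg \<open>p\<close> by \<open>p * h'\<close>. Needed for identities and
  braidings.\<close>

lemma pushout_inverse:
  assumes p: "p \<in> carrier_mat k n" "surj_mat p"
    and h: "h \<in> carrier_mat n n" "h' \<in> carrier_mat n n" "h * h' = 1\<^sub>m n" "h' * h = 1\<^sub>m n"
  shows "is_pushout p h (1\<^sub>m k) (p * h')"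
proof (subst pushout_iff_exact[where k=k and n=n and l=n and w=k])
  have "surj_mat h'"
    using h by (subst surj_mat_iff_right_inverse[OF h(2)]) auto
  then have "surj_mat (p * h')"
    using p h by (intro surj_mat_mult[where k=k and n=n and m=n])
  moreover have "p * h' * h = p"
    using p h by (simp add: assoc_mult_mat[of _ k n _ n _ n])
  moreover have "h *\<^sub>v (h' *\<^sub>v b) = b" if "b \<in> carrier_vec n" for b
    using assoc_mult_mat_vec[OF h(1,2) that] h that by simp
  ultimately show "surj_mat (p * h') \<and> 1\<^sub>m k * p = p * h' * h \<and>
    (\<forall>b \<in> carrier_vec n. p * h' *\<^sub>v b = 0\<^sub>v k \<longrightarrow> (\<exists>y \<in> carrier_vec n. p *\<^sub>v y = 0\<^sub>v k \<and> h *\<^sub>v y = b))"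
    using p h by (auto intro!: bexI[of _ "h' *\<^sub>v _"])
qed (use p h in auto)

text \<open>A map into the zero space makes the apex collapse to zero; this is behind the naturality
  of delete.\<close>

lemma pushout_unit:
  assumes "p \<in> carrier_mat k n" "surj_mat p" "g \<in> carrier_mat 0 n"
  shows "is_pushout p g (0\<^sub>m 0 k) (1\<^sub>m 0)"
proof (subst pushout_iff_exact[where k=k and n=n and l=0 and w=0])
  have "0\<^sub>m 0 k * p = 1\<^sub>m 0 * g" using assms by (intro eq_matI) auto
  then show "surj_mat (1\<^sub>m 0) \<and> 0\<^sub>m 0 k * p = 1\<^sub>m 0 * g \<and> (\<forall>b \<in> carrier_vec 0. 1\<^sub>m 0 *\<^sub>v b = 0\<^sub>v 0 \<longrightarrow>
      (\<exists>y \<in> carrier_vec n. p *\<^sub>v y = 0\<^sub>v k \<and> g *\<^sub>v y = b))"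
    using assms surj_mat_one[of 0] by (auto intro!: bexI[of _ "0\<^sub>v n"])
qed (use assms in auto)

text \<open>For three composable maps with pushouts \<open>i\<close>, \<open>j\<close> and a pushout
  \<open>e\<close> of the inner legs, the outer square computes both bracketings. The two
  conclusions are the pushouts for composing last with the third map and for composing first with
  the first map.\<close>

lemma pushout_paste:
  assumes p: "p \<in> carrier_mat k n" "surj_mat p" and g: "g \<in> carrier_mat l n"
    and q: "q \<in> carrier_mat l n'" "surj_mat q" and h: "h \<in> carrier_mat r n'"
    and i: "i1 \<in> carrier_mat w k" "i2 \<in> carrier_mat w l" "is_pushout p g i1 i2"
    and j: "j1 \<in> carrier_mat v l" "j2 \<in> carrier_mat v r" "is_pushout q h j1 j2"
    and e: "e1 \<in> carrier_mat u w" "e2 \<in> carrier_mat u v" "is_pushout i2 j1 e1 e2"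
  shows "is_pushout (i2 * q) h e1 (e2 * j2)" "is_pushout p (j1 * g) (e1 * i1) e2"
proof -
  note I = i(3)[unfolded pushout_iff_exact[OF p g i(1,2)]]
  note J = j(3)[unfolded pushout_iff_exact[OF q h j(1,2)]]
  have si2: "surj_mat i2" using I by simp
  note E = e(3)[unfolded pushout_iff_exact[OF i(2) si2 j(1) e(1,2)]]
  show "is_pushout (i2 * q) h e1 (e2 * j2)"
  proof (subst pushout_iff_exact[where k=w and n=n' and l=r and w=u], safe)
    show "surj_mat (i2 * q)" using si2 q i by (intro surj_mat_mult)
    show "surj_mat (e2 * j2)" using E J e j by (intro surj_mat_mult) auto
    have "e1 * (i2 * q) = e1 * i2 * q" using e i q by (intro assoc_mult_mat[symmetric])
    also have "\<dots> = e2 * (j1 * q)" using E e j q by simp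
    also have "\<dots> = e2 * j2 * h" using J e j h by simp
    finally show "e1 * (i2 * q) = e2 * j2 * h" .
    fix b :: "real Matrix.vec" assume b: "b \<in> carrier_vec r" "e2 * j2 *\<^sub>v b = 0\<^sub>v u"
    then have "e2 *\<^sub>v (j2 *\<^sub>v b) = 0\<^sub>v u" "j2 *\<^sub>v b \<in> carrier_vec v" using e j by auto
    then obtain y where y: "y \<in> carrier_vec l" "i2 *\<^sub>v y = 0\<^sub>v w" "j1 *\<^sub>v y = j2 *\<^sub>v b"
      using E by blast
    \<comment> \<open>The lift \<open>y'\<close> of \<open>y\<close> through \<open>q\<close> is
      only a first candidate: \<open>h *\<^sub>v y'\<close> and \<open>b\<close> agree after
      \<open>j2\<close>. Exactness of \<open>j\<close> writes their difference as
      \<open>h *\<^sub>v c\<close> with \<open>c\<close> in the kernel of \<open>q\<close>, so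
      \<open>y' - c\<close> hits \<open>b\<close> without changing the image under
      \<open>q\<close>.\<close>
    obtain y' where y': "y' \<in> carrier_vec n'" "q *\<^sub>v y' = y"
      using q y by (auto simp: surj_mat_def)
    have "j2 *\<^sub>v (h *\<^sub>v y') = j2 * h *\<^sub>v y'" using j h y' by auto
    also have "\<dots> = j1 *\<^sub>v (q *\<^sub>v y')" using J[THEN conjunct2, THEN conjunct1, symmetric] j q y' by auto
    also have "\<dots> = j2 *\<^sub>v b" using y y' by simp
    finally have "j2 *\<^sub>v (h *\<^sub>v y' - b) = 0\<^sub>v v"
      using j h y' b by (auto simp: mult_minus_distrib_mat_vec[of _ v r])
    moreover have "h *\<^sub>v y' - b \<in> carrier_vec r" using h y' b by auto
    ultimately obtain c where c: "c \<in> carrier_vec n'" "q *\<^sub>v c = 0\<^sub>v l" "h *\<^sub>v c = h *\<^sub>v y' - b"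
      using J by blast
    have "q *\<^sub>v (y' - c) = y"
      using q c y' y by (auto simp: mult_minus_distrib_mat_vec[of _ l n'])
    then have "i2 * q *\<^sub>v (y' - c) = 0\<^sub>v w" using i q c y' y by simp
    moreover have "h *\<^sub>v (y' - c) = h *\<^sub>v y' - (h *\<^sub>v y' - b)"
      using h c y' by (auto simp: mult_minus_distrib_mat_vec[of _ r n'])
    moreover have "h *\<^sub>v y' - (h *\<^sub>v y' - b) = b" using h y' b by (intro eq_vecI) auto
    ultimately show "\<exists>y \<in> carrier_vec n'. i2 * q *\<^sub>v y = 0\<^sub>v w \<and> h *\<^sub>v y = b"
      using c y' by (intro bexI[of _ "y' - c"]) auto
  qed (use h i q e j in auto)
  show "is_pushout p (j1 * g) (e1 * i1) e2"
  proof (subst pushout_iff_exact[where k=k and n=n and l=v and w=u], safe)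
    show "surj_mat e2" using E by simp
    have "e1 * i1 * p = e1 * (i1 * p)" using e i p by (intro assoc_mult_mat)
    also have "\<dots> = e1 * i2 * g" using I e i g by simp
    also have "\<dots> = e2 * (j1 * g)" using E e j g by simp
    finally show "e1 * i1 * p = e2 * (j1 * g)" .
    fix b :: "real Matrix.vec" assume b: "b \<in> carrier_vec v" "e2 *\<^sub>v b = 0\<^sub>v u"
    then obtain y where y: "y \<in> carrier_vec l" "i2 *\<^sub>v y = 0\<^sub>v w" "j1 *\<^sub>v y = b"
      using E by blast
    then obtain x where "x \<in> carrier_vec n" "p *\<^sub>v x = 0\<^sub>v k" "g *\<^sub>v x = y"
      using I by blast
    with y show "\<exists>y \<in> carrier_vec n. p *\<^sub>v y = 0\<^sub>v k \<and> j1 * g *\<^sub>v y = b"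
      using j g by (intro bexI[of _ x]) auto
  qed (use p g i j e in auto)
qed

text \<open>A block map kills a concatenated vector exactly when each block kills its part, so
  preimages can be found blockwise. This is what the interchange law rests on.\<close>

lemma pushout_mat_prod:
  assumes p: "p \<in> carrier_mat k n" "surj_mat p" and g: "g \<in> carrier_mat l n"
    and i: "i1 \<in> carrier_mat w k" "i2 \<in> carrier_mat w l" "is_pushout p g i1 i2"
    and p': "p' \<in> carrier_mat k' n'" "surj_mat p'" and g': "g' \<in> carrier_mat l' n'"
    and i': "i1' \<in> carrier_mat w' k'" "i2' \<in> carrier_mat w' l'" "is_pushout p' g' i1' i2'"
  shows "is_pushout (mat_prod p p') (mat_prod g g') (mat_prod i1 i1') (mat_prod i2 i2')"
proof (subst pushout_iff_exact[where k="k+k'" and n="n+n'" and l="l+l'" and w="w+w'"], safe)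
  note I = i(3)[unfolded pushout_iff_exact[OF p g i(1,2)]]
  note I' = i'(3)[unfolded pushout_iff_exact[OF p' g' i'(1,2)]]
  show "surj_mat (mat_prod p p')" using p p' by (intro surj_mat_prod)
  show "surj_mat (mat_prod i2 i2')" using I I' i i' by (intro surj_mat_prod) auto
  show "mat_prod i1 i1' * mat_prod p p' = mat_prod i2 i2' * mat_prod g g'"
    using mat_prod_comp[OF i(1) p(1) i'(1) p'(1)] mat_prod_comp[OF i(2) g i'(2) g'] I I' by simp
  fix b :: "real Matrix.vec" assume b: "b \<in> carrier_vec (l + l')" "mat_prod i2 i2' *\<^sub>v b = 0\<^sub>v (w + w')"
  obtain x x' where x: "x \<in> carrier_vec l" "x' \<in> carrier_vec l'" "b = x @\<^sub>v x'"
    using b by (elim carrier_vec_appendE)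
  have "(i2 *\<^sub>v x) @\<^sub>v (i2' *\<^sub>v x') = 0\<^sub>v w @\<^sub>v 0\<^sub>v w'"
    using b x mat_prod_mult_vec[OF i(2) i'(2) x(1,2)] by (simp add: zero_append_zero)
  then have "i2 *\<^sub>v x = 0\<^sub>v w" "i2' *\<^sub>v x' = 0\<^sub>v w'"
    using append_vec_eq[of "i2 *\<^sub>v x" w "0\<^sub>v w"] i x by auto
  then obtain y y' where y: "y \<in> carrier_vec n" "p *\<^sub>v y = 0\<^sub>v k" "g *\<^sub>v y = x"
    "y' \<in> carrier_vec n'" "p' *\<^sub>v y' = 0\<^sub>v k'" "g' *\<^sub>v y' = x'"
    using I I' x by meson
  then show "\<exists>y \<in> carrier_vec (n + n'). mat_prod p p' *\<^sub>v y = 0\<^sub>v (k + k') \<and> mat_prod g g' *\<^sub>v y = b"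
    using mat_prod_mult_vec[OF p(1) p'(1) y(1,4)] mat_prod_mult_vec[OF g g' y(1,4)] x
    by (intro bexI[of _ "y @\<^sub>v y'"]) (auto simp: zero_append_zero)
qed (use p p' g g' i i' in auto)

section \<open>Markov categories built on linear maps\<close>

text \<open>This and the next two matrices are those inside \<open>linear_markov_struct\<close>,
  named so that coherence laws can be stated as equations between them.\<close>

definition braid_mat :: "nat \<Rightarrow> nat \<Rightarrow> real Matrix.mat" where
  "braid_mat m n = matrix_of (m + n) (n + m) (\<lambda>x. vec_last x n @\<^sub>v vec_first x m)"

definition copy_mat :: "nat \<Rightarrow> real Matrix.mat" where
  "copy_mat n = matrix_of n (n + n) (\<lambda>x. x @\<^sub>v x)"

definition del_mat :: "nat \<Rightarrow> real Matrix.mat" where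
  "del_mat n = matrix_of n 0 (\<lambda>x. 0\<^sub>v 0)"

lemma structure_mat_carrier [simp]:
  "braid_mat m n \<in> carrier_mat (n + m) (m + n)"
  "copy_mat n \<in> carrier_mat (n + n) n"
  "del_mat n \<in> carrier_mat 0 n"
  by (simp_all add: braid_mat_def copy_mat_def del_mat_def)

lemma dim_structure_mat [simp]:
  "dim_row (braid_mat m n) = n + m" "dim_col (braid_mat m n) = m + n"
  "dim_row (copy_mat n) = n + n" "dim_col (copy_mat n) = n"
  "dim_row (del_mat n) = 0" "dim_col (del_mat n) = n"
  using structure_mat_carrier by (blast dest: carrier_matD)+

lemma braid_mat_mult_vec:
  assumes x: "x \<in> carrier_vec m" and y: "y \<in> carrier_vec n"
  shows "braid_mat m n *\<^sub>v (x @\<^sub>v y) = y @\<^sub>v x"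
proof (rule eq_vecI)
  fix i assume "i < dim_vec (y @\<^sub>v x)"
  then have i: "i < n + m" using assms by simp
  \<comment> \<open>\<open>c\<close> is the position in \<open>x @\<^sub>v y\<close> of the entry
    that appears at position \<open>i\<close> of \<open>y @\<^sub>v x\<close>; the sum keeps only
    this summand.\<close>
  define c where "c = (if i < n then m + i else i - n)"
  have c: "c < m + n" using i by (auto simp: c_def)
  have "(braid_mat m n *\<^sub>v (x @\<^sub>v y)) $ i
      = (\<Sum>j = 0..<m + n. (vec_last (unit_vec (m + n) j) n @\<^sub>v vec_first (unit_vec (m + n) j) m) $ i
          * (x @\<^sub>v y) $ j)"
    using i assms by (simp add: braid_mat_def matrix_of_def scalar_prod_def)
  also have "\<dots> = (\<Sum>j = 0..<m + n. if j = c then (x @\<^sub>v y) $ j else 0)"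
    using i by (intro sum.cong) (auto simp: vec_last_def vec_first_def c_def unit_vec_def)
  also have "\<dots> = (y @\<^sub>v x) $ i"
    using c i assms by (auto simp: c_def)
  finally show "(braid_mat m n *\<^sub>v (x @\<^sub>v y)) $ i = (y @\<^sub>v x) $ i" .
qed (use assms in auto)

lemma copy_mat_mult_vec:
  assumes x: "x \<in> carrier_vec n"
  shows "copy_mat n *\<^sub>v x = x @\<^sub>v x"
proof (rule eq_vecI)
  fix i assume "i < dim_vec (x @\<^sub>v x)"
  then have i: "i < n + n" using assms by simp
  define c where "c = (if i < n then i else i - n)"
  have c: "c < n" using i by (auto simp: c_def)
  have "(copy_mat n *\<^sub>v x) $ i = (\<Sum>j = 0..<n. (unit_vec n j @\<^sub>v unit_vec n j) $ i * x $ j)"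
    using i assms by (simp add: copy_mat_def matrix_of_def scalar_prod_def)
  also have "\<dots> = (\<Sum>j = 0..<n. if j = c then x $ j else 0)"
    using i by (intro sum.cong) (auto simp: c_def unit_vec_def)
  also have "\<dots> = (x @\<^sub>v x) $ i"
    using c i assms by (auto simp: c_def)
  finally show "(copy_mat n *\<^sub>v x) $ i = (x @\<^sub>v x) $ i" .
qed (use assms in auto)

lemma mat_0_rows_eq: "M \<in> carrier_mat 0 n \<Longrightarrow> N \<in> carrier_mat 0 n \<Longrightarrow> M = N"
  by (rule eq_matI) auto

lemma mult_mat_assoc_vec:
  assumes "M \<in> carrier_mat k n" "N \<in> carrier_mat n m" "x \<in> carrier_vec m"
  shows "M * N *\<^sub>v x = M *\<^sub>v (N *\<^sub>v x)"
  using assms by simp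

lemma braid_mat_natural:
  assumes f: "f \<in> carrier_mat m' m" and g: "g \<in> carrier_mat n' n"
  shows "braid_mat m' n' * mat_prod f g = mat_prod g f * braid_mat m n"
proof (rule mat_eqI_append)
  show "braid_mat m' n' * mat_prod f g \<in> carrier_mat (n' + m') (m + n)"
    using f g by (intro mult_carrier_mat[of _ _ "m' + n'"]) auto
  show "mat_prod g f * braid_mat m n \<in> carrier_mat (n' + m') (m + n)"
    using f g by (intro mult_carrier_mat[of _ _ "n + m"]) auto
  fix x y :: "real Matrix.vec" assume xy: "x \<in> carrier_vec m" "y \<in> carrier_vec n"
  show "braid_mat m' n' * mat_prod f g *\<^sub>v (x @\<^sub>v y) = mat_prod g f * braid_mat m n *\<^sub>v (x @\<^sub>v y)"
    using f g xy
    by (simp add: mult_mat_assoc_vec[OF structure_mat_carrier(1) mat_prod_carrier[OF f g]]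
      mult_mat_assoc_vec[OF mat_prod_carrier[OF g f] structure_mat_carrier(1)]
      mat_prod_mult_vec[OF f g xy] mat_prod_mult_vec[OF g f xy(2,1)] braid_mat_mult_vec
      mult_mat_vec_carrier[OF f] mult_mat_vec_carrier[OF g])
qed

lemma braid_mat_symmetric: "braid_mat n m * braid_mat m n = 1\<^sub>m (m + n)"
proof (rule mat_eqI_append)
  show "braid_mat n m * braid_mat m n \<in> carrier_mat (m + n) (m + n)"
    by (intro mult_carrier_mat[of _ _ "n + m"]) auto
qed (simp_all add: mult_mat_assoc_vec[OF structure_mat_carrier(1) structure_mat_carrier(1)] braid_mat_mult_vec)

text \<open>What remains of the hexagon when associators are identities: moving a block past
  \<open>n + k\<close> coordinates is moving it past \<open>n\<close> and then past
  \<open>k\<close>.\<close>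

lemma braid_mat_hexagon:
  "braid_mat m (n + k) = mat_prod (1\<^sub>m n) (braid_mat m k) * mat_prod (braid_mat m n) (1\<^sub>m k)"
proof (rule mat_eqI_append)
  let ?A = "mat_prod (1\<^sub>m n) (braid_mat m k)" and ?B = "mat_prod (braid_mat m n) (1\<^sub>m k)"
  have A: "?A \<in> carrier_mat (n + k + m) (n + m + k)"
    by (rule carrier_matI) auto
  have B: "?B \<in> carrier_mat (n + m + k) (m + (n + k))"
    by (rule carrier_matI) auto
  show "?A * ?B \<in> carrier_mat (n + k + m) (m + (n + k))" using A B by (rule mult_carrier_mat)
  fix x w :: "real Matrix.vec" assume x: "x \<in> carrier_vec m" and w: "w \<in> carrier_vec (n + k)"
  obtain y z where yz: "y \<in> carrier_vec n" "z \<in> carrier_vec k" "w = y @\<^sub>v z"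
    using w by (elim carrier_vec_appendE)
  have "?B *\<^sub>v (x @\<^sub>v w) = ?B *\<^sub>v ((x @\<^sub>v y) @\<^sub>v z)" by (simp add: yz append_vec_assoc)
  also have "\<dots> = (y @\<^sub>v x) @\<^sub>v z"
    using x yz by (subst mat_prod_mult_vec[of _ "n + m" "m + n" _ k k]) (auto simp: braid_mat_mult_vec)
  also have "\<dots> = y @\<^sub>v (x @\<^sub>v z)" by (rule append_vec_assoc)
  also have "?A *\<^sub>v \<dots> = y @\<^sub>v (z @\<^sub>v x)"
    using x yz by (subst mat_prod_mult_vec[of _ n n _ "k + m" "m + k"]) (auto simp: braid_mat_mult_vec)
  also have "\<dots> = w @\<^sub>v x" by (simp add: yz append_vec_assoc)
  finally show "braid_mat m (n + k) *\<^sub>v (x @\<^sub>v w) = ?A * ?B *\<^sub>v (x @\<^sub>v w)"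
    using x w yz by (subst mult_mat_assoc_vec[OF A B]) (auto simp: braid_mat_mult_vec)
qed (use structure_mat_carrier(1)[of m "n + k"] in simp)

lemma braid_copy_mat: "braid_mat n n * copy_mat n = copy_mat n"
proof (rule mat_eqI_vec)
  show "braid_mat n n * copy_mat n \<in> carrier_mat (n + n) n"
    by (intro mult_carrier_mat[of _ _ "n + n"]) auto
qed (simp_all add: mult_mat_assoc_vec[OF structure_mat_carrier(1) structure_mat_carrier(2)] braid_mat_mult_vec
  copy_mat_mult_vec)

lemma copy_mat_coassoc: "mat_prod (copy_mat n) (1\<^sub>m n) * copy_mat n = mat_prod (1\<^sub>m n) (copy_mat n) * copy_mat n"
proof (rule mat_eqI_vec)
  let ?A = "mat_prod (copy_mat n) (1\<^sub>m n)" and ?B = "mat_prod (1\<^sub>m n) (copy_mat n)"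
  have A: "?A \<in> carrier_mat (n + n + n) (n + n)" and B: "?B \<in> carrier_mat (n + n + n) (n + n)"
    by (auto intro!: carrier_matI)
  show "?A * copy_mat n \<in> carrier_mat (n + n + n) n" "?B * copy_mat n \<in> carrier_mat (n + n + n) n"
    using A B by (auto intro!: mult_carrier_mat[of _ _ "n + n"])
  fix x :: "real Matrix.vec" assume x: "x \<in> carrier_vec n"
  show "?A * copy_mat n *\<^sub>v x = ?B * copy_mat n *\<^sub>v x"
    using x mat_prod_mult_vec[of "copy_mat n" "n + n" n "1\<^sub>m n" n n x x]
      mat_prod_mult_vec[of "1\<^sub>m n" n n "copy_mat n" "n + n" n x x]
    by (simp add: mult_mat_assoc_vec[OF A structure_mat_carrier(2)]
        mult_mat_assoc_vec[OF B structure_mat_carrier(2)] copy_mat_mult_vec append_vec_assoc)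
qed

lemma copy_mat_counit:
  "mat_prod (del_mat n) (1\<^sub>m n) * copy_mat n = 1\<^sub>m n"
  "mat_prod (1\<^sub>m n) (del_mat n) * copy_mat n = 1\<^sub>m n"
proof -
  let ?A = "mat_prod (del_mat n) (1\<^sub>m n)" and ?B = "mat_prod (1\<^sub>m n) (del_mat n)"
  have A: "?A \<in> carrier_mat n (n + n)" and B: "?B \<in> carrier_mat n (n + n)"
    by (auto intro!: carrier_matI)
  have del: "del_mat n *\<^sub>v x \<in> carrier_vec 0" for x
    by (rule carrier_vecI) simp
  show "?A * copy_mat n = 1\<^sub>m n"
  proof (rule mat_eqI_vec)
    show "?A * copy_mat n \<in> carrier_mat n n"
      using A by (auto intro!: mult_carrier_mat[of _ _ "n + n"])
    fix x :: "real Matrix.vec" assume x: "x \<in> carrier_vec n"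
    show "?A * copy_mat n *\<^sub>v x = 1\<^sub>m n *\<^sub>v x"
      using x mat_prod_mult_vec[of "del_mat n" 0 n "1\<^sub>m n" n n x x]
      by (simp add: mult_mat_assoc_vec[OF A structure_mat_carrier(2)] copy_mat_mult_vec append_vec_0_left del)
  qed simp
  show "?B * copy_mat n = 1\<^sub>m n"
  proof (rule mat_eqI_vec)
    show "?B * copy_mat n \<in> carrier_mat n n"
      using B by (auto intro!: mult_carrier_mat[of _ _ "n + n"])
    fix x :: "real Matrix.vec" assume x: "x \<in> carrier_vec n"
    show "?B * copy_mat n *\<^sub>v x = 1\<^sub>m n *\<^sub>v x"
      using x mat_prod_mult_vec[of "1\<^sub>m n" n n "del_mat n" 0 n x x]
      by (simp add: mult_mat_assoc_vec[OF B structure_mat_carrier(2)] copy_mat_mult_vec append_vec_0_right del)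
  qed simp
qed

text \<open>The left factor is the matrix of the middle exchange, the form to which
  \<open>middle_swap\<close> reduces below.\<close>

lemma copy_mat_tensor:
  "copy_mat (m + n) = mat_prod (1\<^sub>m m) (mat_prod (braid_mat m n) (1\<^sub>m n)) * mat_prod (copy_mat m) (copy_mat n)"
proof (rule mat_eqI_append)
  let ?A = "mat_prod (1\<^sub>m m) (mat_prod (braid_mat m n) (1\<^sub>m n))" and ?B = "mat_prod (copy_mat m) (copy_mat n)"
  have A: "?A \<in> carrier_mat (m + n + (m + n)) (m + m + (n + n))"
    by (rule carrier_matI) auto
  have B: "?B \<in> carrier_mat (m + m + (n + n)) (m + n)"
    by (rule carrier_matI) auto
  show "?A * ?B \<in> carrier_mat (m + n + (m + n)) (m + n)" using A B by (rule mult_carrier_mat)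
  fix x y :: "real Matrix.vec" assume xy: "x \<in> carrier_vec m" "y \<in> carrier_vec n"
  have "?B *\<^sub>v (x @\<^sub>v y) = (x @\<^sub>v x) @\<^sub>v (y @\<^sub>v y)"
    using xy by (subst mat_prod_mult_vec[of _ "m + m" m _ "n + n" n]) (auto simp: copy_mat_mult_vec)
  also have "\<dots> = x @\<^sub>v ((x @\<^sub>v y) @\<^sub>v y)" by (simp only: append_vec_assoc)
  also have "?A *\<^sub>v \<dots> = x @\<^sub>v (mat_prod (braid_mat m n) (1\<^sub>m n) *\<^sub>v ((x @\<^sub>v y) @\<^sub>v y))"
    using xy by (subst mat_prod_mult_vec[of _ m m _ "n + m + n" "m + n + n"]) auto
  also have "mat_prod (braid_mat m n) (1\<^sub>m n) *\<^sub>v ((x @\<^sub>v y) @\<^sub>v y) = (y @\<^sub>v x) @\<^sub>v y"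
    using xy by (subst mat_prod_mult_vec[of _ "n + m" "m + n" _ n n]) (auto simp: braid_mat_mult_vec)
  also have "x @\<^sub>v ((y @\<^sub>v x) @\<^sub>v y) = (x @\<^sub>v y) @\<^sub>v (x @\<^sub>v y)" by (simp only: append_vec_assoc)
  finally show "copy_mat (m + n) *\<^sub>v (x @\<^sub>v y) = ?A * ?B *\<^sub>v (x @\<^sub>v y)"
    using xy by (subst mult_mat_assoc_vec[OF A B]) (auto simp: copy_mat_mult_vec)
qed (use structure_mat_carrier(2)[of "m + n"] in simp)

lemma copy_mat_0: "copy_mat 0 = 1\<^sub>m 0"
  by (rule mat_0_rows_eq[of _ 0]) (use structure_mat_carrier(2)[of 0] in auto)

lemma del_mat_0: "del_mat 0 = 1\<^sub>m 0"
  by (rule mat_0_rows_eq[of _ 0]) auto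

lemma del_mat_tensor: "del_mat (m + n) = mat_prod (del_mat m) (del_mat n)"
  by (rule mat_0_rows_eq[of _ "m + n"]) (auto intro!: carrier_matI)

section \<open>Strict Markov categories generated by linear maps\<close>

text \<open>Strict associativity and unitality of \<open>tens\<close> replace naturality and
  coherence of associators and unitors. Naturality then has to be asked only of the braiding and of
  delete; copy, braiding and delete satisfy their other laws because \<open>J\<close> respects
  products and composition of matrices.\<close>

locale linear_markov =
  fixes H :: "nat \<Rightarrow> nat \<Rightarrow> 'm set" and cmp :: "'m \<Rightarrow> 'm \<Rightarrow> 'm" and tens :: "'m \<Rightarrow> 'm \<Rightarrow> 'm"
    and J :: "real Matrix.mat \<Rightarrow> 'm"
  assumes disjoint: "f \<in> H m n \<Longrightarrow> f \<in> H m' n' \<Longrightarrow> m = m' \<and> n = n'"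
    and cmp_closed: "f \<in> H m n \<Longrightarrow> g \<in> H n k \<Longrightarrow> cmp g f \<in> H m k"
    and tens_closed: "f \<in> H m n \<Longrightarrow> f' \<in> H m' n' \<Longrightarrow> tens f f' \<in> H (m + m') (n + n')"
    and J_closed: "M \<in> carrier_mat n m \<Longrightarrow> J M \<in> H m n"
    and cmp_one_right: "f \<in> H m n \<Longrightarrow> cmp f (J (1\<^sub>m m)) = f"
    and cmp_one_left: "f \<in> H m n \<Longrightarrow> cmp (J (1\<^sub>m n)) f = f"
    and cmp_assoc: "f \<in> H m n \<Longrightarrow> g \<in> H n k \<Longrightarrow> h \<in> H k l \<Longrightarrow> cmp (cmp h g) f = cmp h (cmp g f)"
    and J_mult: "M \<in> carrier_mat n m \<Longrightarrow> N \<in> carrier_mat k n \<Longrightarrow> J (N * M) = cmp (J N) (J M)"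
    and J_mat_prod: "M \<in> carrier_mat n m \<Longrightarrow> N \<in> carrier_mat n' m' \<Longrightarrow> J (mat_prod M N) = tens (J M) (J N)"
    and interchange: "f \<in> H m n \<Longrightarrow> g \<in> H n k \<Longrightarrow> f' \<in> H m' n' \<Longrightarrow> g' \<in> H n' k' \<Longrightarrow>
      tens (cmp g f) (cmp g' f') = cmp (tens g g') (tens f f')"
    and tens_assoc: "f \<in> H m n \<Longrightarrow> f' \<in> H m' n' \<Longrightarrow> f'' \<in> H m'' n'' \<Longrightarrow>
      tens (tens f f') f'' = tens f (tens f' f'')"
    and tens_unit_left: "f \<in> H m n \<Longrightarrow> tens (J (1\<^sub>m 0)) f = f"
    and tens_unit_right: "f \<in> H m n \<Longrightarrow> tens f (J (1\<^sub>m 0)) = f"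
    and braid_natural: "f \<in> H m m' \<Longrightarrow> g \<in> H n n' \<Longrightarrow>
      cmp (J (braid_mat m' n')) (tens f g) = cmp (tens g f) (J (braid_mat m n))"
    and del_natural: "f \<in> H m n \<Longrightarrow> cmp (J (del_mat n)) f = J (del_mat m)"

lemma linear_markov_struct_simps [simp]:
  "Obj (linear_markov_struct H cmp tens J) = UNIV"
  "Hom (linear_markov_struct H cmp tens J) = H"
  "Ident (linear_markov_struct H cmp tens J) = (\<lambda>n. J (1\<^sub>m n))"
  "Comp (linear_markov_struct H cmp tens J) = cmp"
  "TensorObj (linear_markov_struct H cmp tens J) = (+)"
  "Tensor (linear_markov_struct H cmp tens J) = tens"
  "UnitObj (linear_markov_struct H cmp tens J) = 0"
  "Assoc (linear_markov_struct H cmp tens J) = (\<lambda>m n k. J (1\<^sub>m (m + n + k)))"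
  "LUnit (linear_markov_struct H cmp tens J) = (\<lambda>n. J (1\<^sub>m n))"
  "RUnit (linear_markov_struct H cmp tens J) = (\<lambda>n. J (1\<^sub>m n))"
  "Braid (linear_markov_struct H cmp tens J) = (\<lambda>m n. J (braid_mat m n))"
  "Copy (linear_markov_struct H cmp tens J) = (\<lambda>n. J (copy_mat n))"
  "Del (linear_markov_struct H cmp tens J) = (\<lambda>n. J (del_mat n))"
  by (simp_all add: linear_markov_struct_def braid_mat_def copy_mat_def del_mat_def)

context linear_markov
begin

lemma J_one_closed: "J (1\<^sub>m n) \<in> H n n"
  by (rule J_closed) simp

lemma inverse_arrows_one:
  "inverse_arrows (linear_markov_struct H cmp tens J) n n (J (1\<^sub>m n)) (J (1\<^sub>m n))"
  by (simp add: inverse_arrows_def J_one_closed cmp_one_left[OF J_one_closed])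

lemma iso_arrow_one: "iso_arrow (linear_markov_struct H cmp tens J) n n (J (1\<^sub>m n))"
  using inverse_arrows_one by (auto simp: iso_arrow_def)

text \<open>\<open>inv_arrow\<close> is a definite description, so uniqueness has to be shown too: a
  left inverse of an identity equals that identity.\<close>

lemma inv_arrow_one: "inv_arrow (linear_markov_struct H cmp tens J) n n (J (1\<^sub>m n)) = J (1\<^sub>m n)"
  unfolding inv_arrow_def
proof (rule the_equality)
  fix g assume "inverse_arrows (linear_markov_struct H cmp tens J) n n (J (1\<^sub>m n)) g"
  then have "g \<in> H n n" "cmp g (J (1\<^sub>m n)) = J (1\<^sub>m n)"
    by (auto simp: inverse_arrows_def)
  then show "g = J (1\<^sub>m n)" by (simp add: cmp_one_right)
qed (rule inverse_arrows_one)

lemma tens_one: "tens (J (1\<^sub>m m)) (J (1\<^sub>m n)) = J (1\<^sub>m (m + n))"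
  using J_mat_prod[of "1\<^sub>m m" m m "1\<^sub>m n" n n] by (simp add: mat_prod_one)

lemma J_structure_closed:
  "J (braid_mat m n) \<in> H (m + n) (n + m)" "J (copy_mat n) \<in> H n (n + n)" "J (del_mat n) \<in> H n 0"
  by (auto intro!: J_closed)

text \<open>All associators and their inverses are images of identity matrices and cancel, leaving
  the braiding of the two inner factors.\<close>

lemma middle_swap_eq:
  "middle_swap (linear_markov_struct H cmp tens J) m n
    = J (mat_prod (1\<^sub>m m) (mat_prod (braid_mat m n) (1\<^sub>m n)))"
proof -
  let ?b = "J (mat_prod (braid_mat m n) (1\<^sub>m n))"
  have b: "mat_prod (braid_mat m n) (1\<^sub>m n) \<in> carrier_mat (n + m + n) (m + n + n)"
    by (rule carrier_matI) auto
  have "tens (J (braid_mat m n)) (J (1\<^sub>m n)) = ?b"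
    by (rule J_mat_prod[symmetric]) auto
  moreover have "cmp (J (1\<^sub>m (n + m + n))) ?b = ?b" "cmp ?b (J (1\<^sub>m (m + n + n))) = ?b"
    using cmp_one_left[OF J_closed[OF b]] cmp_one_right[OF J_closed[OF b]] by auto
  moreover have "tens (J (1\<^sub>m m)) ?b = J (mat_prod (1\<^sub>m m) (mat_prod (braid_mat m n) (1\<^sub>m n)))"
    by (rule J_mat_prod[OF _ b, symmetric]) auto
  moreover have s: "mat_prod (1\<^sub>m m) (mat_prod (braid_mat m n) (1\<^sub>m n))
      \<in> carrier_mat (m + n + (m + n)) (m + m + (n + n))"
    by (rule carrier_matI) auto
  \<comment> \<open>Source and target of an associator are equal numbers written with different
    brackets; \<open>add.assoc\<close> brings \<open>inv_arrow_one\<close> into that form. The next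
    fact does the same for the other inverse.\<close>
  moreover have "inv_arrow (linear_markov_struct H cmp tens J) (m + n + n) (m + (n + n)) (J (1\<^sub>m (m + n + n)))
      = J (1\<^sub>m (m + n + n))"
    using inv_arrow_one[of "m + n + n"] by (simp add: add.assoc)
  moreover have "inv_arrow (linear_markov_struct H cmp tens J) (m + n + (m + n)) (m + (n + (m + n)))
      (J (1\<^sub>m (m + n + (m + n)))) = J (1\<^sub>m (m + n + (m + n)))"
    using inv_arrow_one[of "m + n + (m + n)"] by (simp add: add.assoc)
  ultimately show ?thesis
    unfolding middle_swap_def linear_markov_struct_simps
    by (simp only: cmp_one_left[OF J_closed[OF s]] cmp_one_right[OF J_closed[OF s]])
qed

text \<open>Coherence laws made of associators and unitors collapse to identities by
  \<open>tens_one\<close>. Those with braiding, copy or delete are gathered into \<open>J\<close> of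
  one matrix on each side and become the matrix identities above.\<close>

lemma markov_category: "markov_category (linear_markov_struct H cmp tens J)"
proof (unfold_locales, unfold linear_markov_struct_simps, goal_cases)
  case (1 X Y X' Y' f) then show ?case using disjoint by blast
next
  case (2 X) show ?case by (rule J_one_closed)
next
  case (3 X Y Z f g) then show ?case using cmp_closed by blast
next
  case (4 X Y f) then show ?case by (rule_tac cmp_one_right)
next
  case (5 X Y f) then show ?case by (rule_tac cmp_one_left)
next
  case (6 W X Y Z f g h) then show ?case using cmp_assoc by blast
next
  case 7 show ?case by simp
next
  case 8 show ?case by simp
next
  case (9 X Y X' Y' f f') then show ?case using tens_closed by blast
next
  case (10 X Y) show ?case by (rule tens_one)
next
  case (11 X Y Z X' Y' Z' f g f' g') then show ?case using interchange by blast
next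
  case (12 X Y Z) show ?case using iso_arrow_one[of "X + Y + Z"] by (simp add: add.assoc)
next
  case (13 X Y Z X' Y' Z' f g h)
  then show ?case
    using cmp_one_left[OF tens_closed[OF tens_closed[of f X X' g Y Y'], of h Z Z']]
      cmp_one_right[OF tens_closed[OF tens_closed[of f X X' g Y Y'], of h Z Z']]
    by (simp add: tens_assoc[of f X X' g Y Y' h Z Z'])
next
  case (14 X) show ?case using iso_arrow_one by simp
next
  case (15 X Y f) then show ?case by (simp add: tens_unit_left cmp_one_left cmp_one_right)
next
  case (16 X) show ?case using iso_arrow_one by simp
next
  case (17 X Y f) then show ?case by (simp add: tens_unit_right cmp_one_left cmp_one_right)
next
  case (18 W X Y Z) show ?case by (simp add: tens_one cmp_one_left[OF J_one_closed] add.assoc)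
next
  case (19 X Y) show ?case by (simp add: tens_one cmp_one_left[OF J_one_closed])
next
  case (20 X Y) show ?case by (rule J_structure_closed)
next
  case (21 X Y X' Y' f g) then show ?case using braid_natural by blast
next
  case (22 X Y) show ?case
    using J_mult[of "braid_mat X Y" "Y + X" "X + Y" "braid_mat Y X" "X + Y"] by (simp add: braid_mat_symmetric)
next
  case (23 X Y Z)
  have a: "mat_prod (1\<^sub>m Y) (braid_mat X Z) \<in> carrier_mat (Y + Z + X) (Y + X + Z)"
    "mat_prod (braid_mat X Y) (1\<^sub>m Z) \<in> carrier_mat (Y + X + Z) (X + Y + Z)"
    by (auto intro!: carrier_matI)
  have b: "J (braid_mat X (Y + Z)) \<in> H (X + Y + Z) (Y + Z + X)"
    using J_structure_closed(1)[of X "Y + Z"] by (simp only: add.assoc)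
  have "cmp (J (1\<^sub>m (Y + Z + X))) (J (braid_mat X (Y + Z))) = J (braid_mat X (Y + Z))"
    "cmp (J (braid_mat X (Y + Z))) (J (1\<^sub>m (X + Y + Z))) = J (braid_mat X (Y + Z))"
    by (rule cmp_one_left[OF b], rule cmp_one_right[OF b])
  moreover have "tens (J (1\<^sub>m Y)) (J (braid_mat X Z)) = J (mat_prod (1\<^sub>m Y) (braid_mat X Z))"
    "tens (J (braid_mat X Y)) (J (1\<^sub>m Z)) = J (mat_prod (braid_mat X Y) (1\<^sub>m Z))"
    by (auto intro!: J_mat_prod[symmetric])
  moreover have "cmp (J (mat_prod (1\<^sub>m Y) (braid_mat X Z))) (J (1\<^sub>m (Y + X + Z)))
      = J (mat_prod (1\<^sub>m Y) (braid_mat X Z))"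
    by (rule cmp_one_right[OF J_closed[OF a(1)]])
  ultimately show ?case
    by (simp only: J_mult[OF a(2,1), symmetric] braid_mat_hexagon)
next
  case (24 X) show ?case by (rule J_structure_closed)
next
  case (25 X) show ?case by (rule J_structure_closed)
next
  case (26 X)
  have a: "mat_prod (copy_mat X) (1\<^sub>m X) \<in> carrier_mat (X + X + X) (X + X)"
    "mat_prod (1\<^sub>m X) (copy_mat X) \<in> carrier_mat (X + X + X) (X + X)"
    by (auto intro!: carrier_matI)
  have "tens (J (copy_mat X)) (J (1\<^sub>m X)) = J (mat_prod (copy_mat X) (1\<^sub>m X))"
    "tens (J (1\<^sub>m X)) (J (copy_mat X)) = J (mat_prod (1\<^sub>m X) (copy_mat X))"
    by (auto intro!: J_mat_prod[symmetric])
  then show ?case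
    using J_mult[OF structure_mat_carrier(2) a(1)] J_mult[OF structure_mat_carrier(2) a(2)]
    by (simp add: cmp_one_left[OF J_closed[OF a(1)]] copy_mat_coassoc)
next
  case (27 X)
  have a: "mat_prod (del_mat X) (1\<^sub>m X) \<in> carrier_mat X (X + X)"
    by (auto intro!: carrier_matI)
  have "tens (J (del_mat X)) (J (1\<^sub>m X)) = J (mat_prod (del_mat X) (1\<^sub>m X))"
    by (auto intro!: J_mat_prod[symmetric])
  then show ?case
    by (simp only: cmp_one_left[OF J_closed[OF a]] J_mult[OF structure_mat_carrier(2) a, symmetric] copy_mat_counit)
next
  case (28 X)
  have a: "mat_prod (1\<^sub>m X) (del_mat X) \<in> carrier_mat X (X + X)"
    by (auto intro!: carrier_matI)
  have "tens (J (1\<^sub>m X)) (J (del_mat X)) = J (mat_prod (1\<^sub>m X) (del_mat X))"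
    by (auto intro!: J_mat_prod[symmetric])
  then show ?case
    by (simp only: cmp_one_left[OF J_closed[OF a]] J_mult[OF structure_mat_carrier(2) a, symmetric] copy_mat_counit)
next
  case (29 X)
  show ?case
    using J_mult[OF structure_mat_carrier(2) structure_mat_carrier(1)] by (simp add: braid_copy_mat)
next
  case (30 X Y)
  have a: "mat_prod (copy_mat X) (copy_mat Y) \<in> carrier_mat (X + X + (Y + Y)) (X + Y)"
    "mat_prod (1\<^sub>m X) (mat_prod (braid_mat X Y) (1\<^sub>m Y)) \<in> carrier_mat (X + Y + (X + Y)) (X + X + (Y + Y))"
    by (auto intro!: carrier_matI)
  have "tens (J (copy_mat X)) (J (copy_mat Y)) = J (mat_prod (copy_mat X) (copy_mat Y))"
    by (auto intro!: J_mat_prod[symmetric])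
  then show ?case
    unfolding middle_swap_eq using J_mult[OF a] by (simp add: copy_mat_tensor)
next
  case (31 X Y)
  have "tens (J (del_mat X)) (J (del_mat Y)) = J (del_mat (X + Y))"
    unfolding del_mat_tensor by (auto intro!: J_mat_prod[symmetric])
  then show ?case by (simp add: cmp_one_left[OF J_structure_closed(3)])
next
  case 32 show ?case by (simp add: copy_mat_0 cmp_one_left[OF J_one_closed])
next
  case 33 show ?case by (simp add: del_mat_0)
next
  case (34 X Y f) then show ?case using del_natural by blast
qed

end

text \<open>A strict functor: the comparison maps are identities, so each monoidal condition reduces
  to \<open>F\<close> carrying \<open>J\<close> to \<open>J'\<close>.\<close>

lemma linear_markov_functor:
  assumes C: "linear_markov H cmp tens J" and D: "linear_markov H' cmp' tens' J'"
    and F_closed: "\<And>m n f. f \<in> H m n \<Longrightarrow> F f \<in> H' m n"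
    and F_cmp: "\<And>m n k f g. f \<in> H m n \<Longrightarrow> g \<in> H n k \<Longrightarrow> F (cmp g f) = cmp' (F g) (F f)"
    and F_tens: "\<And>m n m' n' f f'. f \<in> H m n \<Longrightarrow> f' \<in> H m' n' \<Longrightarrow> F (tens f f') = tens' (F f) (F f')"
    and F_J: "\<And>m n M. M \<in> carrier_mat n m \<Longrightarrow> F (J M) = J' M"
  defines "D \<equiv> linear_markov_struct H' cmp' tens' J'"
  shows "markov_functor (linear_markov_struct H cmp tens J) D
    id F (\<lambda>m n. Ident D (m + n)) (Ident D 0)"
proof -
  interpret C: linear_markov H cmp tens J by fact
  interpret D: linear_markov H' cmp' tens' J' by fact
  interpret CC: markov_category "linear_markov_struct H cmp tens J" by (rule C.markov_category)
  interpret DD: markov_category "linear_markov_struct H' cmp' tens' J'" by (rule D.markov_category)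
  note one = F_J[OF one_carrier_mat]
  note cmp_one = D.cmp_one_left[OF D.J_one_closed]
  show ?thesis
    unfolding D_def
  proof (unfold_locales, unfold linear_markov_struct_simps id_apply, goal_cases)
    case (1 X) show ?case by simp
  next
    case (2 X Y f) then show ?case using F_closed by blast
  next
    case (3 X) show ?case by (rule one)
  next
    case (4 X Y Z f g) then show ?case using F_cmp by blast
  next
    case (5 X Y) show ?case by (rule D.iso_arrow_one)
  next
    case (6 X Y X' Y' f g)
    then show ?case
      by (simp add: F_tens D.cmp_one_left[OF D.tens_closed[OF F_closed F_closed]]
        D.cmp_one_right[OF D.tens_closed[OF F_closed F_closed]])
  next
    case 7 show ?case by (rule D.iso_arrow_one)
  next
    case (8 X Y Z) show ?case by (simp add: one D.tens_one cmp_one add.assoc)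
  next
    case (9 X) show ?case by (simp add: one D.tens_one cmp_one)
  next
    case (10 X) show ?case by (simp add: one D.tens_one cmp_one)
  next
    case (11 X Y)
    have "J' (braid_mat X Y) \<in> H' (X + Y) (Y + X)" by (rule D.J_structure_closed)
    then show ?case
      by (simp add: F_J[OF structure_mat_carrier(1)] D.cmp_one_left D.cmp_one_right)
  next
    case (12 X) show ?case
      by (simp add: F_J[OF structure_mat_carrier(2)] D.cmp_one_left[OF D.J_structure_closed(2)])
  next
    case (13 X) show ?case
      by (simp add: F_J[OF structure_mat_carrier(3)] D.cmp_one_left[OF D.J_structure_closed(3)])
  qed
qed

text \<open>To prove an equation in the source, apply \<open>F\<close>, push it inward through the
  operations, use the corresponding law of the target, and cancel \<open>F\<close>.\<close>

lemma linear_markov_pullback: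
  assumes D: "linear_markov H' cmp' tens' J'"
    and inj: "\<And>m n. inj_on F (H m n)"
    and F_closed: "\<And>m n f. f \<in> H m n \<Longrightarrow> F f \<in> H' m n"
    and F_cmp: "\<And>m n k f g. f \<in> H m n \<Longrightarrow> g \<in> H n k \<Longrightarrow> F (cmp g f) = cmp' (F g) (F f)"
    and F_tens: "\<And>m n m' n' f f'. f \<in> H m n \<Longrightarrow> f' \<in> H m' n' \<Longrightarrow> F (tens f f') = tens' (F f) (F f')"
    and F_J: "\<And>m n M. M \<in> carrier_mat n m \<Longrightarrow> F (J M) = J' M"
    and cmp_closed: "\<And>m n k f g. f \<in> H m n \<Longrightarrow> g \<in> H n k \<Longrightarrow> cmp g f \<in> H m k"
    and tens_closed: "\<And>m n m' n' f f'. f \<in> H m n \<Longrightarrow> f' \<in> H m' n' \<Longrightarrow> tens f f' \<in> H (m + m') (n + n')"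
    and J_closed: "\<And>m n M. M \<in> carrier_mat n m \<Longrightarrow> J M \<in> H m n"
  shows "linear_markov H cmp tens J"
proof -
  interpret D: linear_markov H' cmp' tens' J' by fact
  \<comment> \<open>Injectivity is available on one hom-set at a time, so every use comes with
    closure facts placing both sides in the same \<open>H m n\<close>.\<close>
  have eqI: "f = g" if "F f = F g" "f \<in> H m n" "g \<in> H m n" for f g m n
    using that inj by (auto dest: inj_onD)
  have J1: "J (1\<^sub>m n) \<in> H n n" for n by (rule J_closed) simp
  have FJ1: "F (J (1\<^sub>m n)) = J' (1\<^sub>m n)" for n by (rule F_J[OF one_carrier_mat])
  have JB: "J (braid_mat m n) \<in> H (m + n) (n + m)" for m n by (rule J_closed) simp
  have FJB: "F (J (braid_mat m n)) = J' (braid_mat m n)" for m n by (rule F_J[OF structure_mat_carrier(1)])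
  have JD: "J (del_mat n) \<in> H n 0" for n by (rule J_closed) simp
  have FJD: "F (J (del_mat n)) = J' (del_mat n)" for n by (rule F_J[OF structure_mat_carrier(3)])
  show ?thesis
  proof (unfold_locales, goal_cases)
    case (1 f m n m' n') then show ?case using D.disjoint F_closed by blast
  next
    case (2 f m n g k) then show ?case by (rule cmp_closed)
  next
    case (3 f m n f' m' n') then show ?case by (rule tens_closed)
  next
    case (4 M n m) then show ?case by (rule J_closed)
  next
    case (5 f m n) then show ?case
      by (intro eqI[of _ _ m n] cmp_closed[OF J1]) (simp_all add: F_cmp[OF J1] FJ1 D.cmp_one_right[OF F_closed])
  next
    case (6 f m n) then show ?case
      by (intro eqI[of _ _ m n] cmp_closed[OF _ J1]) (simp_all add: F_cmp[OF _ J1] FJ1 D.cmp_one_left[OF F_closed])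
  next
    case (7 f m n g k h l)
    have "F (cmp (cmp h g) f) = cmp' (cmp' (F h) (F g)) (F f)"
      using F_cmp[OF 7(1) cmp_closed[OF 7(2,3)]] F_cmp[OF 7(2,3)] by simp
    also have "\<dots> = F (cmp h (cmp g f))"
      using F_cmp[OF cmp_closed[OF 7(1,2)] 7(3)] F_cmp[OF 7(1,2)] D.cmp_assoc[OF 7[THEN F_closed]] by simp
    finally show ?case
      by (rule eqI[OF _ cmp_closed[OF 7(1) cmp_closed[OF 7(2,3)]] cmp_closed[OF cmp_closed[OF 7(1,2)] 7(3)]])
  next
    case (8 M n m N k)
    show ?case
      by (rule eqI[OF _ J_closed[OF mult_carrier_mat[OF 8(2,1)]] cmp_closed[OF 8[THEN J_closed]]])
        (simp add: F_J[OF mult_carrier_mat[OF 8(2,1)]] F_cmp[OF 8[THEN J_closed]] 8[THEN F_J] D.J_mult[OF 8])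
  next
    case (9 M n m N n' m')
    show ?case
      by (rule eqI[OF _ J_closed[OF mat_prod_carrier[OF 9]] tens_closed[OF 9[THEN J_closed]]])
        (simp add: F_J[OF mat_prod_carrier[OF 9]] F_tens[OF 9[THEN J_closed]] 9[THEN F_J] D.J_mat_prod[OF 9])
  next
    case (10 f m n g k f' m' n' g' k')
    show ?case
      by (rule eqI[OF _ tens_closed[OF cmp_closed[OF 10(1,2)] cmp_closed[OF 10(3,4)]]
            cmp_closed[OF tens_closed[OF 10(1,3)] tens_closed[OF 10(2,4)]]])
        (simp add: F_tens[OF cmp_closed[OF 10(1,2)] cmp_closed[OF 10(3,4)]] F_cmp[OF 10(1,2)] F_cmp[OF 10(3,4)]
          F_cmp[OF tens_closed[OF 10(1,3)] tens_closed[OF 10(2,4)]] F_tens[OF 10(1,3)] F_tens[OF 10(2,4)]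
          D.interchange[OF 10[THEN F_closed]])
  next
    case (11 f m n f' m' n' f'' m'' n'')
    \<comment> \<open>The right-hand bracketing lands in a hom-set with other brackets, which must
      be rewritten before \<open>eqI\<close> applies.\<close>
    have r: "tens f (tens f' f'') \<in> H (m + m' + m'') (n + n' + n'')"
      using tens_closed[OF 11(1) tens_closed[OF 11(2,3)]] by (simp add: add.assoc)
    show ?case
      by (rule eqI[OF _ tens_closed[OF tens_closed[OF 11(1,2)] 11(3)] r])
        (simp add: F_tens[OF tens_closed[OF 11(1,2)] 11(3)] F_tens[OF 11(1,2)]
          F_tens[OF 11(1) tens_closed[OF 11(2,3)]] F_tens[OF 11(2,3)] D.tens_assoc[OF 11[THEN F_closed]])
  next
    case (12 f m n)
    show ?case
      using tens_closed[OF J1 12, of 0] 12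
      by (intro eqI[of _ _ m n]) (simp_all add: F_tens[OF J1 12] FJ1 D.tens_unit_left[OF F_closed[OF 12]])
  next
    case (13 f m n)
    show ?case
      using tens_closed[OF 13 J1, of 0] 13
      by (intro eqI[of _ _ m n]) (simp_all add: F_tens[OF 13 J1] FJ1 D.tens_unit_right[OF F_closed[OF 13]])
  next
    case (14 f m m' g n n')
    show ?case
      by (rule eqI[OF _ cmp_closed[OF tens_closed[OF 14(1,2)] JB] cmp_closed[OF JB tens_closed[OF 14(2,1)]]])
        (simp add: F_cmp[OF tens_closed[OF 14(1,2)] JB] F_cmp[OF JB tens_closed[OF 14(2,1)]] FJB
          F_tens[OF 14(1,2)] F_tens[OF 14(2,1)] D.braid_natural[OF 14[THEN F_closed]])
  next
    case (15 f m n)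
    show ?case
      by (rule eqI[OF _ cmp_closed[OF 15 JD] JD])
        (simp add: F_cmp[OF 15 JD] FJD D.del_natural[OF F_closed[OF 15]])
  qed
qed

section \<open>Distributions on real coordinate spaces\<close>

lemma space_vec_borel [simp]: "space (vec_borel n) = carrier_vec n"
  by (simp add: vec_borel_def)

lemma measurable_vec_borelI:
  assumes "\<And>x. x \<in> space N \<Longrightarrow> f x \<in> carrier_vec n"
    and "\<And>i. i < n \<Longrightarrow> (\<lambda>x. f x $ i) \<in> borel_measurable N"
  shows "f \<in> measurable N (vec_borel n)"
  unfolding vec_borel_def
  by (rule measurable_vimage_algebra2) (use assms in \<open>auto intro!: measurable_restrict\<close>)

lemma measurable_vec_index:
  assumes i: "i < n" shows "(\<lambda>x. x $ i) \<in> borel_measurable (vec_borel n)"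
proof -
  have 1: "(\<lambda>x. \<lambda>i\<in>{..<n}. x $ i) \<in> measurable (vec_borel n) (\<Pi>\<^sub>M i\<in>{..<n}. (borel :: real measure))"
    unfolding vec_borel_def by (rule measurable_vimage_algebra1) (auto simp: space_PiM)
  have 2: "(\<lambda>f. f i) \<in> measurable (\<Pi>\<^sub>M i\<in>{..<n}. (borel :: real measure)) borel"
    using i by (intro measurable_component_singleton) auto
  show ?thesis using measurable_compose[OF 1 2] i by simp
qed

lemma measurable_vec_index_comp:
  assumes "f \<in> measurable N (vec_borel n)" "i < n"
  shows "(\<lambda>x. f x $ i) \<in> borel_measurable N"
  using measurable_compose[OF assms(1) measurable_vec_index[OF assms(2)]] .

lemma measurable_vec_carrier:
  "f \<in> measurable N (vec_borel n) \<Longrightarrow> x \<in> space N \<Longrightarrow> f x \<in> carrier_vec n"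
  using measurable_space[of f N "vec_borel n" x] by simp

lemma measurable_append_vec [measurable (raw)]:
  assumes f: "f \<in> measurable N (vec_borel m)" and g: "g \<in> measurable N (vec_borel n)"
  shows "(\<lambda>x. f x @\<^sub>v g x) \<in> measurable N (vec_borel (m + n))"
proof (rule measurable_vec_borelI)
  show "f x @\<^sub>v g x \<in> carrier_vec (m + n)" if "x \<in> space N" for x
    using that f g by (intro append_carrier_vec measurable_vec_carrier)
  fix i assume i: "i < m + n"
  have "(\<lambda>x. if i < m then f x $ i else g x $ (i - m)) \<in> borel_measurable N"
    using i f g by (cases "i < m") (auto intro!: measurable_vec_index_comp)
  moreover have "(f x @\<^sub>v g x) $ i = (if i < m then f x $ i else g x $ (i - m))" if "x \<in> space N" for x
    using measurable_vec_carrier[OF f that] measurable_vec_carrier[OF g that] i by simp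
  ultimately show "(\<lambda>x. (f x @\<^sub>v g x) $ i) \<in> borel_measurable N"
    by (simp cong: measurable_cong)
qed

lemma measurable_add_vec [measurable (raw)]:
  assumes f: "f \<in> measurable N (vec_borel n)" and g: "g \<in> measurable N (vec_borel n)"
  shows "(\<lambda>x. f x + g x) \<in> measurable N (vec_borel n)"
proof (rule measurable_vec_borelI)
  show "f x + g x \<in> carrier_vec n" if "x \<in> space N" for x
    using that f g by (intro add_carrier_vec measurable_vec_carrier)
  fix i assume i: "i < n"
  have "(\<lambda>x. f x $ i + g x $ i) \<in> borel_measurable N"
    using i f g by (intro borel_measurable_add measurable_vec_index_comp)
  moreover have "(f x + g x) $ i = f x $ i + g x $ i" if "x \<in> space N" for x
    using measurable_vec_carrier[OF g that] i by simp
  ultimately show "(\<lambda>x. (f x + g x) $ i) \<in> borel_measurable N"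
    by (simp cong: measurable_cong)
qed

lemma measurable_scalar_prod [measurable (raw)]:
  assumes f: "f \<in> measurable N (vec_borel n)"
  shows "(\<lambda>x. t \<bullet> f x) \<in> borel_measurable N"
proof -
  have "(\<lambda>x. \<Sum>i = 0..<n. t $ i * f x $ i) \<in> borel_measurable N"
    using f by (intro borel_measurable_sum borel_measurable_times borel_measurable_const measurable_vec_index_comp) auto
  moreover have "t \<bullet> f x = (\<Sum>i = 0..<n. t $ i * f x $ i)" if "x \<in> space N" for x
    using measurable_vec_carrier[OF f that] by (simp add: scalar_prod_def)
  ultimately show ?thesis
    by (simp cong: measurable_cong)
qed

lemma measurable_mult_mat_vec [measurable (raw)]:
  assumes M: "M \<in> carrier_mat m n" and f: "f \<in> measurable N (vec_borel n)"
  shows "(\<lambda>x. M *\<^sub>v f x) \<in> measurable N (vec_borel m)"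
proof (rule measurable_vec_borelI)
  show "M *\<^sub>v f x \<in> carrier_vec m" if "x \<in> space N" for x
    using M measurable_vec_carrier[OF f that] by auto
  fix i assume i: "i < m"
  then show "(\<lambda>x. (M *\<^sub>v f x) $ i) \<in> borel_measurable N"
    using measurable_scalar_prod[OF f, of "Matrix.row M i"] M by simp
qed

section \<open>Integration against pushforwards, products and convolutions\<close>

text \<open>Arbitrary probability laws on the coordinate space. All identities between distributions
  are proved at this level, where no closedness of the Gaussian family has to be carried
  along.\<close>

definition vec_dist :: "nat \<Rightarrow> real Matrix.vec measure \<Rightarrow> bool" where
  "vec_dist n \<psi> \<longleftrightarrow> prob_space \<psi> \<and> sets \<psi> = sets (vec_borel n)"

lemma vec_dist_sets: "vec_dist n \<psi> \<Longrightarrow> sets \<psi> = sets (vec_borel n)"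
  and vec_dist_prob_space: "vec_dist n \<psi> \<Longrightarrow> prob_space \<psi>"
  by (auto simp: vec_dist_def)

lemma vec_dist_space: "vec_dist n \<psi> \<Longrightarrow> space \<psi> = carrier_vec n"
  using sets_eq_imp_space_eq[OF vec_dist_sets, of n \<psi>] by simp

text \<open>Indicators already separate measures; allowing every measurable test function matches
  the form of the integral formulas that follow.\<close>

lemma vec_dist_eqI:
  assumes \<psi>: "vec_dist n \<psi>" and \<chi>: "vec_dist n \<chi>"
    and eq: "\<And>f. f \<in> borel_measurable (vec_borel n) \<Longrightarrow> (\<integral>\<^sup>+x. f x \<partial>\<psi>) = (\<integral>\<^sup>+x. f x \<partial>\<chi>)"
  shows "\<psi> = \<chi>"
proof (rule measure_eqI)
  show "sets \<psi> = sets \<chi>" using assms by (simp add: vec_dist_sets)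
  fix A assume A: "A \<in> sets \<psi>"
  then have "A \<in> sets \<chi>" "A \<in> sets (vec_borel n)" using assms by (auto simp: vec_dist_sets)
  then show "emeasure \<psi> A = emeasure \<chi> A"
    using eq[of "indicator A"] A by simp
qed

lemma vec_dist_push:
  assumes "vec_dist n \<psi>" "M \<in> carrier_mat m n"
  shows "vec_dist m (push M \<psi>)"
proof -
  note [measurable_cong] = vec_dist_sets[OF assms(1)]
  have "(\<lambda>x. M *\<^sub>v x) \<in> measurable \<psi> (vec_borel m)"
    using assms(2) by measurable
  then show ?thesis
    using assms by (auto simp: vec_dist_def push_def intro!: prob_space.prob_space_distr)
qed

lemma nn_integral_push:
  assumes "vec_dist n \<psi>" "M \<in> carrier_mat m n" "f \<in> borel_measurable (vec_borel m)"
  shows "(\<integral>\<^sup>+x. f x \<partial>(push M \<psi>)) = (\<integral>\<^sup>+x. f (M *\<^sub>v x) \<partial>\<psi>)"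
proof -
  note [measurable_cong] = vec_dist_sets[OF assms(1)]
  have "(\<lambda>x. M *\<^sub>v x) \<in> measurable \<psi> (vec_borel m)"
    using assms(2) by measurable
  then show ?thesis
    using assms by (auto simp: push_def nn_integral_distr)
qed

lemma pair_prob_space_vec_dist:
  "vec_dist m \<psi> \<Longrightarrow> vec_dist n \<chi> \<Longrightarrow> pair_prob_space \<psi> \<chi>"
  by (simp add: pair_prob_space_def pair_sigma_finite_def prob_space_imp_sigma_finite vec_dist_prob_space)

lemma vec_dist_prod:
  assumes "vec_dist m \<psi>" "vec_dist n \<chi>"
  shows "vec_dist (m + n) (prod_dist m n \<psi> \<chi>)"
proof -
  note [measurable_cong] = assms[THEN vec_dist_sets]
  have "(\<lambda>(x, y). x @\<^sub>v y) \<in> measurable (\<psi> \<Otimes>\<^sub>M \<chi>) (vec_borel (m + n))"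
    by measurable
  then show ?thesis
    using assms by (auto simp: vec_dist_def prod_dist_def intro!: prob_space.prob_space_distr prob_space_pair)
qed

text \<open>Change of variables along concatenation followed by Tonelli, with the second factor
  integrated first.\<close>

lemma nn_integral_prod_dist:
  assumes "vec_dist m \<psi>" "vec_dist n \<chi>" and [measurable]: "f \<in> borel_measurable (vec_borel (m + n))"
  shows "(\<integral>\<^sup>+x. f x \<partial>(prod_dist m n \<psi> \<chi>)) = (\<integral>\<^sup>+x. \<integral>\<^sup>+y. f (x @\<^sub>v y) \<partial>\<chi> \<partial>\<psi>)"
proof -
  note [measurable_cong] = assms(1,2)[THEN vec_dist_sets]
  interpret pair_prob_space \<psi> \<chi> using assms by (intro pair_prob_space_vec_dist)
  have [measurable]: "(\<lambda>(x, y). x @\<^sub>v y) \<in> measurable (\<psi> \<Otimes>\<^sub>M \<chi>) (vec_borel (m + n))"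
    by measurable
  have "(\<integral>\<^sup>+x. f x \<partial>(prod_dist m n \<psi> \<chi>)) = (\<integral>\<^sup>+z. f (fst z @\<^sub>v snd z) \<partial>(\<psi> \<Otimes>\<^sub>M \<chi>))"
    unfolding prod_dist_def by (subst nn_integral_distr) (auto simp: case_prod_beta)
  also have "\<dots> = (\<integral>\<^sup>+x. \<integral>\<^sup>+y. f (x @\<^sub>v y) \<partial>\<chi> \<partial>\<psi>)"
    by (subst M2.nn_integral_fst[symmetric]) auto
  finally show ?thesis .
qed

lemma vec_dist_conv:
  assumes "vec_dist n \<psi>" "vec_dist n \<chi>"
  shows "vec_dist n (conv_dist n \<psi> \<chi>)"
proof -
  note [measurable_cong] = assms[THEN vec_dist_sets]
  have "(\<lambda>(x, y). x + y) \<in> measurable (\<psi> \<Otimes>\<^sub>M \<chi>) (vec_borel n)"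
    by measurable
  then show ?thesis
    using assms by (auto simp: vec_dist_def conv_dist_def intro!: prob_space.prob_space_distr prob_space_pair)
qed

lemma nn_integral_conv_dist:
  assumes "vec_dist n \<psi>" "vec_dist n \<chi>" and [measurable]: "f \<in> borel_measurable (vec_borel n)"
  shows "(\<integral>\<^sup>+x. f x \<partial>(conv_dist n \<psi> \<chi>)) = (\<integral>\<^sup>+x. \<integral>\<^sup>+y. f (x + y) \<partial>\<chi> \<partial>\<psi>)"
proof -
  note [measurable_cong] = assms(1,2)[THEN vec_dist_sets]
  interpret pair_prob_space \<psi> \<chi> using assms by (intro pair_prob_space_vec_dist)
  have [measurable]: "(\<lambda>(x, y). x + y) \<in> measurable (\<psi> \<Otimes>\<^sub>M \<chi>) (vec_borel n)"
    by measurable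
  have "(\<integral>\<^sup>+x. f x \<partial>(conv_dist n \<psi> \<chi>)) = (\<integral>\<^sup>+z. f (fst z + snd z) \<partial>(\<psi> \<Otimes>\<^sub>M \<chi>))"
    unfolding conv_dist_def by (subst nn_integral_distr) (auto simp: case_prod_beta)
  also have "\<dots> = (\<integral>\<^sup>+x. \<integral>\<^sup>+y. f (x + y) \<partial>\<chi> \<partial>\<psi>)"
    by (subst M2.nn_integral_fst[symmetric]) auto
  finally show ?thesis .
qed

lemma vec_dist_dirac0: "vec_dist n (dirac0 n)"
  by (auto simp: vec_dist_def dirac0_def intro!: prob_space_return)

lemma nn_integral_dirac0:
  "f \<in> borel_measurable (vec_borel n) \<Longrightarrow> (\<integral>\<^sup>+x. f x \<partial>(dirac0 n)) = f (0\<^sub>v n)"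
  by (simp add: dirac0_def nn_integral_return)

lemma nn_integral_swap_vec_dist:
  assumes "vec_dist m \<psi>" "vec_dist n \<chi>"
    and [measurable]: "(\<lambda>(x, y). f x y) \<in> borel_measurable (vec_borel m \<Otimes>\<^sub>M vec_borel n)"
  shows "(\<integral>\<^sup>+x. \<integral>\<^sup>+y. f x y \<partial>\<chi> \<partial>\<psi>) = (\<integral>\<^sup>+y. \<integral>\<^sup>+x. f x y \<partial>\<psi> \<partial>\<chi>)"
proof -
  note [measurable_cong] = assms(1,2)[THEN vec_dist_sets]
  interpret pair_prob_space \<psi> \<chi> using assms by (intro pair_prob_space_vec_dist)
  show ?thesis by (rule Fubini'[symmetric]) measurable
qed

section \<open>Algebraic laws of pushforward, product and convolution\<close>

lemma push_mult:
  assumes \<psi>: "vec_dist n \<psi>" and M: "M \<in> carrier_mat k m" and N: "N \<in> carrier_mat m n"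
  shows "push (M * N) \<psi> = push M (push N \<psi>)"
proof (rule vec_dist_eqI)
  show "vec_dist k (push (M * N) \<psi>)" using assms by (intro vec_dist_push[of n]) auto
  show "vec_dist k (push M (push N \<psi>))" using assms by (intro vec_dist_push[of m] vec_dist_push[of n])
  fix f :: "real Matrix.vec \<Rightarrow> ennreal" assume [measurable]: "f \<in> borel_measurable (vec_borel k)"
  have "(\<integral>\<^sup>+x. f x \<partial>push M (push N \<psi>)) = (\<integral>\<^sup>+x. f (M *\<^sub>v x) \<partial>push N \<psi>)"
    by (rule nn_integral_push[OF vec_dist_push[OF \<psi> N] M]) measurable
  also have "\<dots> = (\<integral>\<^sup>+x. f (M *\<^sub>v (N *\<^sub>v x)) \<partial>\<psi>)"
    using M by (intro nn_integral_push[OF \<psi> N]) measurable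
  also have "\<dots> = (\<integral>\<^sup>+x. f (M * N *\<^sub>v x) \<partial>\<psi>)"
    using M N by (intro nn_integral_cong) (simp add: vec_dist_space[OF \<psi>])
  also have "\<dots> = (\<integral>\<^sup>+x. f x \<partial>push (M * N) \<psi>)"
    using M N by (intro nn_integral_push[OF \<psi>, symmetric]) auto
  finally show "(\<integral>\<^sup>+x. f x \<partial>push (M * N) \<psi>) = (\<integral>\<^sup>+x. f x \<partial>push M (push N \<psi>))" by simp
qed

lemma push_one:
  assumes \<psi>: "vec_dist n \<psi>" shows "push (1\<^sub>m n) \<psi> = \<psi>"
proof (rule vec_dist_eqI[OF vec_dist_push[OF \<psi> one_carrier_mat] \<psi>])
  fix f :: "real Matrix.vec \<Rightarrow> ennreal" assume f: "f \<in> borel_measurable (vec_borel n)"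
  show "(\<integral>\<^sup>+x. f x \<partial>push (1\<^sub>m n) \<psi>) = (\<integral>\<^sup>+x. f x \<partial>\<psi>)"
    unfolding nn_integral_push[OF \<psi> one_carrier_mat f]
    by (intro nn_integral_cong) (simp add: vec_dist_space[OF \<psi>])
qed

lemma push_dirac0:
  assumes M: "M \<in> carrier_mat m n" shows "push M (dirac0 n) = dirac0 m"
proof (rule vec_dist_eqI[OF vec_dist_push[OF vec_dist_dirac0 M] vec_dist_dirac0])
  fix f :: "real Matrix.vec \<Rightarrow> ennreal" assume f[measurable]: "f \<in> borel_measurable (vec_borel m)"
  have "(\<integral>\<^sup>+x. f x \<partial>push M (dirac0 n)) = (\<integral>\<^sup>+x. f (M *\<^sub>v x) \<partial>dirac0 n)"
    by (rule nn_integral_push[OF vec_dist_dirac0 M f])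
  also have "\<dots> = f (M *\<^sub>v 0\<^sub>v n)" using M by (intro nn_integral_dirac0) measurable
  also have "M *\<^sub>v 0\<^sub>v n = 0\<^sub>v m" using M by auto
  finally show "(\<integral>\<^sup>+x. f x \<partial>push M (dirac0 n)) = (\<integral>\<^sup>+x. f x \<partial>dirac0 m)"
    by (simp add: nn_integral_dirac0[OF f])
qed

text \<open>Change of variables in each of the iterated integrals. This is the compatibility by
  which changes of apex in two factors act on a product decoration.\<close>

lemma prod_push:
  assumes \<psi>: "vec_dist m \<psi>" and \<chi>: "vec_dist n \<chi>"
    and M: "M \<in> carrier_mat m' m" and N: "N \<in> carrier_mat n' n"
  shows "prod_dist m' n' (push M \<psi>) (push N \<chi>) = push (mat_prod M N) (prod_dist m n \<psi> \<chi>)"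
proof (rule vec_dist_eqI)
  note M\<psi> = vec_dist_push[OF \<psi> M] and N\<chi> = vec_dist_push[OF \<chi> N]
  show "vec_dist (m' + n') (prod_dist m' n' (push M \<psi>) (push N \<chi>))"
    using M\<psi> N\<chi> by (rule vec_dist_prod)
  show "vec_dist (m' + n') (push (mat_prod M N) (prod_dist m n \<psi> \<chi>))"
    using vec_dist_push[OF vec_dist_prod[OF \<psi> \<chi>] mat_prod_carrier[OF M N]] .
  note [measurable_cong] = \<psi>[THEN vec_dist_sets] \<chi>[THEN vec_dist_sets] N\<chi>[THEN vec_dist_sets]
  interpret N\<chi>: prob_space "push N \<chi>" by (rule vec_dist_prob_space[OF N\<chi>])
  fix f :: "real Matrix.vec \<Rightarrow> ennreal" assume f[measurable]: "f \<in> borel_measurable (vec_borel (m' + n'))"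
  have "(\<integral>\<^sup>+x. f x \<partial>prod_dist m' n' (push M \<psi>) (push N \<chi>))
      = (\<integral>\<^sup>+x. \<integral>\<^sup>+y. f (x @\<^sub>v y) \<partial>push N \<chi> \<partial>push M \<psi>)"
    by (rule nn_integral_prod_dist[OF M\<psi> N\<chi> f])
  also have "\<dots> = (\<integral>\<^sup>+x. \<integral>\<^sup>+y. f ((M *\<^sub>v x) @\<^sub>v y) \<partial>push N \<chi> \<partial>\<psi>)"
    by (rule nn_integral_push[OF \<psi> M]) measurable
  also have "\<dots> = (\<integral>\<^sup>+x. \<integral>\<^sup>+y. f ((M *\<^sub>v x) @\<^sub>v (N *\<^sub>v y)) \<partial>\<chi> \<partial>\<psi>)"
  proof (intro nn_integral_cong nn_integral_push[OF \<chi> N])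
    \<comment> \<open>For the inner integral \<open>x\<close> is fixed; knowing that
      \<open>M *\<^sub>v x\<close> lies in the space of \<open>vec_borel m'\<close> makes this
      section of \<open>f\<close> measurable.\<close>
    fix x assume "x \<in> space \<psi>"
    then have "M *\<^sub>v x \<in> space (vec_borel m')" using M by (auto simp: vec_dist_space[OF \<psi>])
    then show "(\<lambda>y. f ((M *\<^sub>v x) @\<^sub>v y)) \<in> borel_measurable (vec_borel n')" by measurable
  qed
  also have "\<dots> = (\<integral>\<^sup>+x. \<integral>\<^sup>+y. f (mat_prod M N *\<^sub>v (x @\<^sub>v y)) \<partial>\<chi> \<partial>\<psi>)"
    by (intro nn_integral_cong) (simp add: vec_dist_space[OF \<psi>] vec_dist_space[OF \<chi>] mat_prod_mult_vec[OF M N])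
  also have "\<dots> = (\<integral>\<^sup>+z. f (mat_prod M N *\<^sub>v z) \<partial>prod_dist m n \<psi> \<chi>)"
    by (rule nn_integral_prod_dist[OF \<psi> \<chi>, symmetric]) (use mat_prod_carrier[OF M N] in measurable)
  also have "\<dots> = (\<integral>\<^sup>+z. f z \<partial>push (mat_prod M N) (prod_dist m n \<psi> \<chi>))"
    by (rule nn_integral_push[OF vec_dist_prod[OF \<psi> \<chi>] mat_prod_carrier[OF M N] f, symmetric])
  finally show "(\<integral>\<^sup>+x. f x \<partial>prod_dist m' n' (push M \<psi>) (push N \<chi>))
      = (\<integral>\<^sup>+z. f z \<partial>push (mat_prod M N) (prod_dist m n \<psi> \<chi>))" .
qed

text \<open>Linearity of \<open>M\<close> under the double integral. For an isomorphism of apexes it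
  says that the decoration of a composite does not depend on the chosen pushout.\<close>

lemma conv_push:
  assumes \<psi>: "vec_dist m \<psi>" and \<chi>: "vec_dist m \<chi>" and M: "M \<in> carrier_mat n m"
  shows "conv_dist n (push M \<psi>) (push M \<chi>) = push M (conv_dist m \<psi> \<chi>)"
proof (rule vec_dist_eqI)
  note M\<psi> = vec_dist_push[OF \<psi> M] and M\<chi> = vec_dist_push[OF \<chi> M]
  show "vec_dist n (conv_dist n (push M \<psi>) (push M \<chi>))"
    using M\<psi> M\<chi> by (rule vec_dist_conv)
  show "vec_dist n (push M (conv_dist m \<psi> \<chi>))"
    using vec_dist_push[OF vec_dist_conv[OF \<psi> \<chi>] M] .
  note [measurable_cong] = \<psi>[THEN vec_dist_sets] \<chi>[THEN vec_dist_sets] M\<chi>[THEN vec_dist_sets]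
  interpret M\<chi>: prob_space "push M \<chi>" by (rule vec_dist_prob_space[OF M\<chi>])
  fix f :: "real Matrix.vec \<Rightarrow> ennreal" assume f[measurable]: "f \<in> borel_measurable (vec_borel n)"
  have "(\<integral>\<^sup>+x. f x \<partial>conv_dist n (push M \<psi>) (push M \<chi>))
      = (\<integral>\<^sup>+x. \<integral>\<^sup>+y. f (x + y) \<partial>push M \<chi> \<partial>push M \<psi>)"
    by (rule nn_integral_conv_dist[OF M\<psi> M\<chi> f])
  also have "\<dots> = (\<integral>\<^sup>+x. \<integral>\<^sup>+y. f ((M *\<^sub>v x) + y) \<partial>push M \<chi> \<partial>\<psi>)"
    by (rule nn_integral_push[OF \<psi> M]) measurable
  also have "\<dots> = (\<integral>\<^sup>+x. \<integral>\<^sup>+y. f ((M *\<^sub>v x) + (M *\<^sub>v y)) \<partial>\<chi> \<partial>\<psi>)"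
  proof (intro nn_integral_cong nn_integral_push[OF \<chi> M])
    fix x assume "x \<in> space \<psi>"
    then have "M *\<^sub>v x \<in> space (vec_borel n)" using M by (auto simp: vec_dist_space[OF \<psi>])
    then show "(\<lambda>y. f ((M *\<^sub>v x) + y)) \<in> borel_measurable (vec_borel n)" by measurable
  qed
  also have "\<dots> = (\<integral>\<^sup>+x. \<integral>\<^sup>+y. f (M *\<^sub>v (x + y)) \<partial>\<chi> \<partial>\<psi>)"
    by (intro nn_integral_cong) (simp add: vec_dist_space[OF \<psi>] vec_dist_space[OF \<chi>] mult_add_distrib_mat_vec[OF M])
  also have "\<dots> = (\<integral>\<^sup>+z. f (M *\<^sub>v z) \<partial>conv_dist m \<psi> \<chi>)"
    by (rule nn_integral_conv_dist[OF \<psi> \<chi>, symmetric]) (use M in measurable)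
  also have "\<dots> = (\<integral>\<^sup>+z. f z \<partial>push M (conv_dist m \<psi> \<chi>))"
    by (rule nn_integral_push[OF vec_dist_conv[OF \<psi> \<chi>] M f, symmetric])
  finally show "(\<integral>\<^sup>+x. f x \<partial>conv_dist n (push M \<psi>) (push M \<chi>))
      = (\<integral>\<^sup>+z. f z \<partial>push M (conv_dist m \<psi> \<chi>))" .
qed

lemma conv_comm:
  assumes \<psi>: "vec_dist n \<psi>" and \<chi>: "vec_dist n \<chi>"
  shows "conv_dist n \<psi> \<chi> = conv_dist n \<chi> \<psi>"
proof (rule vec_dist_eqI[OF vec_dist_conv[OF \<psi> \<chi>] vec_dist_conv[OF \<chi> \<psi>]])
  fix f :: "real Matrix.vec \<Rightarrow> ennreal" assume f[measurable]: "f \<in> borel_measurable (vec_borel n)"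
  have "(\<integral>\<^sup>+x. f x \<partial>conv_dist n \<psi> \<chi>) = (\<integral>\<^sup>+y. \<integral>\<^sup>+x. f (x + y) \<partial>\<psi> \<partial>\<chi>)"
    unfolding nn_integral_conv_dist[OF \<psi> \<chi> f] by (rule nn_integral_swap_vec_dist[OF \<psi> \<chi>]) measurable
  also have "\<dots> = (\<integral>\<^sup>+y. \<integral>\<^sup>+x. f (y + x) \<partial>\<psi> \<partial>\<chi>)"
    by (intro nn_integral_cong arg_cong[where f=f] comm_add_vec)
      (auto simp: vec_dist_space[OF \<psi>] vec_dist_space[OF \<chi>])
  finally show "(\<integral>\<^sup>+x. f x \<partial>conv_dist n \<psi> \<chi>) = (\<integral>\<^sup>+x. f x \<partial>conv_dist n \<chi> \<psi>)"
    by (simp add: nn_integral_conv_dist[OF \<chi> \<psi> f])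
qed

lemma conv_dirac0:
  assumes \<psi>: "vec_dist n \<psi>"
  shows "conv_dist n \<psi> (dirac0 n) = \<psi>" "conv_dist n (dirac0 n) \<psi> = \<psi>"
proof -
  show *: "conv_dist n \<psi> (dirac0 n) = \<psi>"
  proof (rule vec_dist_eqI[OF vec_dist_conv[OF \<psi> vec_dist_dirac0] \<psi>])
    fix f :: "real Matrix.vec \<Rightarrow> ennreal" assume f[measurable]: "f \<in> borel_measurable (vec_borel n)"
    show "(\<integral>\<^sup>+x. f x \<partial>conv_dist n \<psi> (dirac0 n)) = (\<integral>\<^sup>+x. f x \<partial>\<psi>)"
      unfolding nn_integral_conv_dist[OF \<psi> vec_dist_dirac0 f]
    proof (intro nn_integral_cong)
      fix x assume x: "x \<in> space \<psi>"
      then have "x \<in> space (vec_borel n)" by (simp add: vec_dist_space[OF \<psi>])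
      then have "(\<lambda>y. f (x + y)) \<in> borel_measurable (vec_borel n)" by measurable
      then show "(\<integral>\<^sup>+y. f (x + y) \<partial>dirac0 n) = f x"
        using x by (simp add: nn_integral_dirac0 vec_dist_space[OF \<psi>])
    qed
  qed
  show "conv_dist n (dirac0 n) \<psi> = \<psi>"
    using * conv_comm[OF \<psi> vec_dist_dirac0] by simp
qed

lemma conv_assoc:
  assumes \<psi>: "vec_dist n \<psi>" and \<chi>: "vec_dist n \<chi>" and \<xi>: "vec_dist n \<xi>"
  shows "conv_dist n (conv_dist n \<psi> \<chi>) \<xi> = conv_dist n \<psi> (conv_dist n \<chi> \<xi>)"
proof (rule vec_dist_eqI)
  note a = vec_dist_conv[OF \<psi> \<chi>] and b = vec_dist_conv[OF \<chi> \<xi>]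
  show "vec_dist n (conv_dist n (conv_dist n \<psi> \<chi>) \<xi>)" using a \<xi> by (rule vec_dist_conv)
  show "vec_dist n (conv_dist n \<psi> (conv_dist n \<chi> \<xi>))" using \<psi> b by (rule vec_dist_conv)
  note [measurable_cong] = \<psi>[THEN vec_dist_sets] \<chi>[THEN vec_dist_sets] \<xi>[THEN vec_dist_sets]
  interpret \<xi>: prob_space \<xi> by (rule vec_dist_prob_space[OF \<xi>])
  fix f :: "real Matrix.vec \<Rightarrow> ennreal" assume f[measurable]: "f \<in> borel_measurable (vec_borel n)"
  have "(\<integral>\<^sup>+x. f x \<partial>conv_dist n (conv_dist n \<psi> \<chi>) \<xi>)
      = (\<integral>\<^sup>+x. \<integral>\<^sup>+z. f (x + z) \<partial>\<xi> \<partial>conv_dist n \<psi> \<chi>)"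
    by (rule nn_integral_conv_dist[OF a \<xi> f])
  also have "\<dots> = (\<integral>\<^sup>+x. \<integral>\<^sup>+y. \<integral>\<^sup>+z. f (x + y + z) \<partial>\<xi> \<partial>\<chi> \<partial>\<psi>)"
    by (rule nn_integral_conv_dist[OF \<psi> \<chi>]) measurable
  also have "\<dots> = (\<integral>\<^sup>+x. \<integral>\<^sup>+y. \<integral>\<^sup>+z. f (x + (y + z)) \<partial>\<xi> \<partial>\<chi> \<partial>\<psi>)"
    by (intro nn_integral_cong arg_cong[where f=f] assoc_add_vec)
      (auto simp: vec_dist_space[OF \<psi>] vec_dist_space[OF \<chi>] vec_dist_space[OF \<xi>])
  also have "\<dots> = (\<integral>\<^sup>+x. \<integral>\<^sup>+y. f (x + y) \<partial>conv_dist n \<chi> \<xi> \<partial>\<psi>)"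
  proof (intro nn_integral_cong nn_integral_conv_dist[OF \<chi> \<xi>, symmetric])
    fix x assume "x \<in> space \<psi>"
    then have "x \<in> space (vec_borel n)" by (simp add: vec_dist_space[OF \<psi>])
    then show "(\<lambda>y. f (x + y)) \<in> borel_measurable (vec_borel n)" by measurable
  qed
  also have "\<dots> = (\<integral>\<^sup>+x. f x \<partial>conv_dist n \<psi> (conv_dist n \<chi> \<xi>))"
    by (rule nn_integral_conv_dist[OF \<psi> b f, symmetric])
  finally show "(\<integral>\<^sup>+x. f x \<partial>conv_dist n (conv_dist n \<psi> \<chi>) \<xi>)
      = (\<integral>\<^sup>+x. f x \<partial>conv_dist n \<psi> (conv_dist n \<chi> \<xi>))" .
qed

lemma prod_dist_assoc:
  assumes \<psi>: "vec_dist m \<psi>" and \<chi>: "vec_dist n \<chi>" and \<xi>: "vec_dist k \<xi>"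
  shows "prod_dist (m + n) k (prod_dist m n \<psi> \<chi>) \<xi> = prod_dist m (n + k) \<psi> (prod_dist n k \<chi> \<xi>)"
proof (rule vec_dist_eqI)
  note a = vec_dist_prod[OF \<psi> \<chi>] and b = vec_dist_prod[OF \<chi> \<xi>]
  show "vec_dist (m + n + k) (prod_dist (m + n) k (prod_dist m n \<psi> \<chi>) \<xi>)" using a \<xi> by (rule vec_dist_prod)
  show "vec_dist (m + n + k) (prod_dist m (n + k) \<psi> (prod_dist n k \<chi> \<xi>))"
    using vec_dist_prod[OF \<psi> b] by (simp add: add.assoc)
  note [measurable_cong] = \<psi>[THEN vec_dist_sets] \<chi>[THEN vec_dist_sets] \<xi>[THEN vec_dist_sets]
  interpret \<xi>: prob_space \<xi> by (rule vec_dist_prob_space[OF \<xi>])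
  fix f :: "real Matrix.vec \<Rightarrow> ennreal" assume f[measurable]: "f \<in> borel_measurable (vec_borel (m + n + k))"
  \<comment> \<open>The same test function, typed for the other bracketing of the dimension, so that
    both integral formulas apply to it.\<close>
  then have f'[measurable]: "f \<in> borel_measurable (vec_borel (m + (n + k)))" by (simp add: add.assoc)
  have "(\<integral>\<^sup>+x. f x \<partial>prod_dist (m + n) k (prod_dist m n \<psi> \<chi>) \<xi>)
      = (\<integral>\<^sup>+x. \<integral>\<^sup>+z. f (x @\<^sub>v z) \<partial>\<xi> \<partial>prod_dist m n \<psi> \<chi>)"
    by (rule nn_integral_prod_dist[OF a \<xi> f])
  also have "\<dots> = (\<integral>\<^sup>+x. \<integral>\<^sup>+y. \<integral>\<^sup>+z. f ((x @\<^sub>v y) @\<^sub>v z) \<partial>\<xi> \<partial>\<chi> \<partial>\<psi>)"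
    by (rule nn_integral_prod_dist[OF \<psi> \<chi>]) measurable
  also have "\<dots> = (\<integral>\<^sup>+x. \<integral>\<^sup>+y. \<integral>\<^sup>+z. f (x @\<^sub>v (y @\<^sub>v z)) \<partial>\<xi> \<partial>\<chi> \<partial>\<psi>)"
    by (simp only: append_vec_assoc)
  also have "\<dots> = (\<integral>\<^sup>+x. \<integral>\<^sup>+y. f (x @\<^sub>v y) \<partial>prod_dist n k \<chi> \<xi> \<partial>\<psi>)"
  proof (intro nn_integral_cong nn_integral_prod_dist[OF \<chi> \<xi>, symmetric])
    fix x assume "x \<in> space \<psi>"
    then have "x \<in> space (vec_borel m)" by (simp add: vec_dist_space[OF \<psi>])
    then have "(\<lambda>y. x @\<^sub>v y) \<in> measurable (vec_borel (n + k)) (vec_borel (m + (n + k)))" by measurable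
    then show "(\<lambda>y. f (x @\<^sub>v y)) \<in> borel_measurable (vec_borel (n + k))"
      using f' by (rule measurable_compose)
  qed
  also have "\<dots> = (\<integral>\<^sup>+x. f x \<partial>prod_dist m (n + k) \<psi> (prod_dist n k \<chi> \<xi>))"
    by (rule nn_integral_prod_dist[OF \<psi> b f', symmetric])
  finally show "(\<integral>\<^sup>+x. f x \<partial>prod_dist (m + n) k (prod_dist m n \<psi> \<chi>) \<xi>)
      = (\<integral>\<^sup>+x. f x \<partial>prod_dist m (n + k) \<psi> (prod_dist n k \<chi> \<xi>))" .
qed

text \<open>Exchanging the two blocks of the vector is exchanging the two integrals.\<close>

lemma push_braid_prod:
  assumes \<psi>: "vec_dist m \<psi>" and \<chi>: "vec_dist n \<chi>"
  shows "push (braid_mat m n) (prod_dist m n \<psi> \<chi>) = prod_dist n m \<chi> \<psi>"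
proof (rule vec_dist_eqI)
  note a = vec_dist_prod[OF \<psi> \<chi>] and B = structure_mat_carrier(1)[of m n]
  show "vec_dist (n + m) (push (braid_mat m n) (prod_dist m n \<psi> \<chi>))" using a B by (rule vec_dist_push)
  show "vec_dist (n + m) (prod_dist n m \<chi> \<psi>)" using \<chi> \<psi> by (rule vec_dist_prod)
  fix f :: "real Matrix.vec \<Rightarrow> ennreal" assume f[measurable]: "f \<in> borel_measurable (vec_borel (n + m))"
  have "(\<integral>\<^sup>+x. f x \<partial>push (braid_mat m n) (prod_dist m n \<psi> \<chi>))
      = (\<integral>\<^sup>+x. f (braid_mat m n *\<^sub>v x) \<partial>prod_dist m n \<psi> \<chi>)"
    by (rule nn_integral_push[OF a B f])
  also have "\<dots> = (\<integral>\<^sup>+x. \<integral>\<^sup>+y. f (braid_mat m n *\<^sub>v (x @\<^sub>v y)) \<partial>\<chi> \<partial>\<psi>)"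
    by (rule nn_integral_prod_dist[OF \<psi> \<chi>]) (use B in measurable)
  also have "\<dots> = (\<integral>\<^sup>+x. \<integral>\<^sup>+y. f (y @\<^sub>v x) \<partial>\<chi> \<partial>\<psi>)"
    by (intro nn_integral_cong) (simp add: vec_dist_space[OF \<psi>] vec_dist_space[OF \<chi>] braid_mat_mult_vec)
  also have "\<dots> = (\<integral>\<^sup>+y. \<integral>\<^sup>+x. f (y @\<^sub>v x) \<partial>\<psi> \<partial>\<chi>)"
    by (rule nn_integral_swap_vec_dist[OF \<psi> \<chi>]) measurable
  also have "\<dots> = (\<integral>\<^sup>+x. f x \<partial>prod_dist n m \<chi> \<psi>)"
    by (rule nn_integral_prod_dist[OF \<chi> \<psi> f, symmetric])
  finally show "(\<integral>\<^sup>+x. f x \<partial>push (braid_mat m n) (prod_dist m n \<psi> \<chi>)) = (\<integral>\<^sup>+x. f x \<partial>prod_dist n m \<chi> \<psi>)" .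
qed

text \<open>The measure-theoretic content of the interchange law: drawing four independent vectors,
  adding and concatenating commute.\<close>

lemma prod_conv:
  assumes \<psi>: "vec_dist m \<psi>" and \<psi>': "vec_dist m \<psi>'" and \<chi>: "vec_dist n \<chi>" and \<chi>': "vec_dist n \<chi>'"
  shows "prod_dist m n (conv_dist m \<psi> \<psi>') (conv_dist n \<chi> \<chi>')
    = conv_dist (m + n) (prod_dist m n \<psi> \<chi>) (prod_dist m n \<psi>' \<chi>')"
proof (rule vec_dist_eqI)
  note a = vec_dist_conv[OF \<psi> \<psi>'] and b = vec_dist_conv[OF \<chi> \<chi>']
    and c = vec_dist_prod[OF \<psi> \<chi>] and d = vec_dist_prod[OF \<psi>' \<chi>']
  show "vec_dist (m + n) (prod_dist m n (conv_dist m \<psi> \<psi>') (conv_dist n \<chi> \<chi>'))"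
    using a b by (rule vec_dist_prod)
  show "vec_dist (m + n) (conv_dist (m + n) (prod_dist m n \<psi> \<chi>) (prod_dist m n \<psi>' \<chi>'))"
    using c d by (rule vec_dist_conv)
  note [measurable_cong] = \<psi>[THEN vec_dist_sets] \<chi>[THEN vec_dist_sets] \<psi>'[THEN vec_dist_sets]
    \<chi>'[THEN vec_dist_sets] b[THEN vec_dist_sets] d[THEN vec_dist_sets]
  note spaces = vec_dist_space[OF \<psi>] vec_dist_space[OF \<psi>'] vec_dist_space[OF \<chi>] vec_dist_space[OF \<chi>']
  interpret b: prob_space "conv_dist n \<chi> \<chi>'" by (rule vec_dist_prob_space[OF b])
  interpret d: prob_space "prod_dist m n \<psi>' \<chi>'" by (rule vec_dist_prob_space[OF d])
  interpret \<chi>': prob_space \<chi>' by (rule vec_dist_prob_space[OF \<chi>'])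
  fix f :: "real Matrix.vec \<Rightarrow> ennreal" assume f[measurable]: "f \<in> borel_measurable (vec_borel (m + n))"
  have "(\<integral>\<^sup>+x. f x \<partial>prod_dist m n (conv_dist m \<psi> \<psi>') (conv_dist n \<chi> \<chi>'))
      = (\<integral>\<^sup>+x. \<integral>\<^sup>+y. f (x @\<^sub>v y) \<partial>conv_dist n \<chi> \<chi>' \<partial>conv_dist m \<psi> \<psi>')"
    by (rule nn_integral_prod_dist[OF a b f])
  also have "\<dots> = (\<integral>\<^sup>+x. \<integral>\<^sup>+x'. \<integral>\<^sup>+y. f ((x + x') @\<^sub>v y) \<partial>conv_dist n \<chi> \<chi>' \<partial>\<psi>' \<partial>\<psi>)"
    by (rule nn_integral_conv_dist[OF \<psi> \<psi>']) measurable
  also have "\<dots> = (\<integral>\<^sup>+x. \<integral>\<^sup>+x'. \<integral>\<^sup>+y. \<integral>\<^sup>+y'. f ((x + x') @\<^sub>v (y + y')) \<partial>\<chi>' \<partial>\<chi> \<partial>\<psi>' \<partial>\<psi>)"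
  proof (intro nn_integral_cong nn_integral_conv_dist[OF \<chi> \<chi>'])
    fix x x' assume "x \<in> space \<psi>" "x' \<in> space \<psi>'"
    then have "x \<in> space (vec_borel m)" "x' \<in> space (vec_borel m)" by (simp_all add: spaces)
    then show "(\<lambda>y. f ((x + x') @\<^sub>v y)) \<in> borel_measurable (vec_borel n)" by measurable
  qed
  \<comment> \<open>Only the two middle integrals, over \<open>\<psi>'\<close> and
    \<open>\<chi>\<close>, are exchanged; the innermost one stays inside as a function of both
    variables.\<close>
  also have "\<dots> = (\<integral>\<^sup>+x. \<integral>\<^sup>+y. \<integral>\<^sup>+x'. \<integral>\<^sup>+y'. f ((x + x') @\<^sub>v (y + y')) \<partial>\<chi>' \<partial>\<psi>' \<partial>\<chi> \<partial>\<psi>)"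
  proof (intro nn_integral_cong nn_integral_swap_vec_dist[OF \<psi>' \<chi>])
    fix x assume "x \<in> space \<psi>"
    then have "x \<in> space (vec_borel m)" by (simp_all add: spaces)
    then show "(\<lambda>(x', y). \<integral>\<^sup>+y'. f ((x + x') @\<^sub>v (y + y')) \<partial>\<chi>')
        \<in> borel_measurable (vec_borel m \<Otimes>\<^sub>M vec_borel n)" by measurable
  qed
  also have "\<dots> = (\<integral>\<^sup>+x. \<integral>\<^sup>+y. \<integral>\<^sup>+x'. \<integral>\<^sup>+y'. f ((x @\<^sub>v y) + (x' @\<^sub>v y')) \<partial>\<chi>' \<partial>\<psi>' \<partial>\<chi> \<partial>\<psi>)"
    by (intro nn_integral_cong arg_cong[where f=f] append_vec_add[symmetric, of _ m _ _ n]) (simp_all add: spaces)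
  also have "\<dots> = (\<integral>\<^sup>+x. \<integral>\<^sup>+y. \<integral>\<^sup>+w. f ((x @\<^sub>v y) + w) \<partial>prod_dist m n \<psi>' \<chi>' \<partial>\<chi> \<partial>\<psi>)"
  proof (intro nn_integral_cong nn_integral_prod_dist[OF \<psi>' \<chi>', symmetric])
    fix x y assume "x \<in> space \<psi>" "y \<in> space \<chi>"
    then have "x @\<^sub>v y \<in> space (vec_borel (m + n))" by (simp add: spaces)
    then show "(\<lambda>w. f ((x @\<^sub>v y) + w)) \<in> borel_measurable (vec_borel (m + n))" by measurable
  qed
  also have "\<dots> = (\<integral>\<^sup>+z. \<integral>\<^sup>+w. f (z + w) \<partial>prod_dist m n \<psi>' \<chi>' \<partial>prod_dist m n \<psi> \<chi>)"
    by (rule nn_integral_prod_dist[OF \<psi> \<chi>, symmetric]) measurable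
  also have "\<dots> = (\<integral>\<^sup>+x. f x \<partial>conv_dist (m + n) (prod_dist m n \<psi> \<chi>) (prod_dist m n \<psi>' \<chi>'))"
    by (rule nn_integral_conv_dist[OF c d f, symmetric])
  finally show "(\<integral>\<^sup>+x. f x \<partial>prod_dist m n (conv_dist m \<psi> \<psi>') (conv_dist n \<chi> \<chi>'))
      = (\<integral>\<^sup>+x. f x \<partial>conv_dist (m + n) (prod_dist m n \<psi> \<chi>) (prod_dist m n \<psi>' \<chi>'))" .
qed

text \<open>The space has a single point, so every integrand is constant and total mass 1 decides
  the integral.\<close>

lemma vec_dist_0_unique:
  assumes \<psi>: "vec_dist 0 \<psi>" and \<chi>: "vec_dist 0 \<chi>" shows "\<psi> = \<chi>"
proof (rule vec_dist_eqI[OF \<psi> \<chi>])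
  fix f :: "real Matrix.vec \<Rightarrow> ennreal"
  have "(\<integral>\<^sup>+x. f x \<partial>\<phi>) = f (0\<^sub>v 0)" if \<phi>: "vec_dist 0 \<phi>" for \<phi>
  proof -
    have "(\<integral>\<^sup>+x. f x \<partial>\<phi>) = (\<integral>\<^sup>+x. f (0\<^sub>v 0) \<partial>\<phi>)"
      by (intro nn_integral_cong arg_cong[where f=f]) (auto simp: vec_dist_space[OF \<phi>])
    then show ?thesis using prob_space.emeasure_space_1[OF vec_dist_prob_space[OF \<phi>]] by simp
  qed
  then show "(\<integral>\<^sup>+x. f x \<partial>\<psi>) = (\<integral>\<^sup>+x. f x \<partial>\<chi>)" using \<psi> \<chi> by simp
qed

lemma prod_dirac0_left:
  assumes \<psi>: "vec_dist n \<psi>"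
  shows "prod_dist 0 n (dirac0 0) \<psi> = \<psi>"
proof (rule vec_dist_eqI[OF _ \<psi>])
  show "vec_dist n (prod_dist 0 n (dirac0 0) \<psi>)" using vec_dist_prod[OF vec_dist_dirac0 \<psi>, of 0] by simp
  note [measurable_cong] = \<psi>[THEN vec_dist_sets]
  interpret \<psi>: prob_space \<psi> by (rule vec_dist_prob_space[OF \<psi>])
  fix f :: "real Matrix.vec \<Rightarrow> ennreal" assume f: "f \<in> borel_measurable (vec_borel n)"
  then have f'[measurable]: "f \<in> borel_measurable (vec_borel (0 + n))" by simp
  have "(\<integral>\<^sup>+x. f x \<partial>prod_dist 0 n (dirac0 0) \<psi>) = (\<integral>\<^sup>+x. \<integral>\<^sup>+y. f (x @\<^sub>v y) \<partial>\<psi> \<partial>dirac0 0)"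
    by (rule nn_integral_prod_dist[OF vec_dist_dirac0 \<psi> f'])
  also have "\<dots> = (\<integral>\<^sup>+y. f (0\<^sub>v 0 @\<^sub>v y) \<partial>\<psi>)" by (rule nn_integral_dirac0) measurable
  finally show "(\<integral>\<^sup>+x. f x \<partial>prod_dist 0 n (dirac0 0) \<psi>) = (\<integral>\<^sup>+x. f x \<partial>\<psi>)"
    by (simp add: append_vec_0_left)
qed

lemma prod_dirac0_right:
  assumes \<psi>: "vec_dist n \<psi>"
  shows "prod_dist n 0 \<psi> (dirac0 0) = \<psi>"
proof -
  \<comment> \<open>Swapping with an empty block does nothing, so the right unit law is the left one
    transported along the braiding.\<close>
  have "braid_mat 0 n = 1\<^sub>m n"
  proof (rule mat_eqI_append[of _ n 0 n])
    fix x y :: "real Matrix.vec" assume "x \<in> carrier_vec 0" "y \<in> carrier_vec n"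
    then show "braid_mat 0 n *\<^sub>v (x @\<^sub>v y) = 1\<^sub>m n *\<^sub>v (x @\<^sub>v y)"
      using braid_mat_mult_vec[of x 0 y n] by (simp add: append_vec_0_left append_vec_0_right)
  qed (use structure_mat_carrier(1)[of 0 n] in simp_all)
  then show ?thesis
    using push_braid_prod[OF vec_dist_dirac0 \<psi>, of 0] by (simp add: prod_dirac0_left[OF \<psi>] push_one[OF \<psi>])
qed

lemma prod_dirac0: "prod_dist m n (dirac0 m) (dirac0 n) = dirac0 (m + n)"
proof (rule vec_dist_eqI[OF vec_dist_prod[OF vec_dist_dirac0 vec_dist_dirac0] vec_dist_dirac0])
  fix f :: "real Matrix.vec \<Rightarrow> ennreal" assume f[measurable]: "f \<in> borel_measurable (vec_borel (m + n))"
  note [measurable_cong] = vec_dist_sets[OF vec_dist_dirac0]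
  interpret prob_space "dirac0 n" by (rule vec_dist_prob_space[OF vec_dist_dirac0])
  have 0: "0\<^sub>v m \<in> space (vec_borel m)" by simp
  have "(\<integral>\<^sup>+x. f x \<partial>prod_dist m n (dirac0 m) (dirac0 n)) = (\<integral>\<^sup>+x. \<integral>\<^sup>+y. f (x @\<^sub>v y) \<partial>dirac0 n \<partial>dirac0 m)"
    by (rule nn_integral_prod_dist[OF vec_dist_dirac0 vec_dist_dirac0 f])
  also have "\<dots> = (\<integral>\<^sup>+y. f (0\<^sub>v m @\<^sub>v y) \<partial>dirac0 n)" by (rule nn_integral_dirac0) measurable
  also have "\<dots> = f (0\<^sub>v m @\<^sub>v 0\<^sub>v n)" by (rule nn_integral_dirac0) (use 0 in measurable)
  finally show "(\<integral>\<^sup>+x. f x \<partial>prod_dist m n (dirac0 m) (dirac0 n)) = (\<integral>\<^sup>+x. f x \<partial>dirac0 (m + n))"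
    by (simp add: zero_append_zero nn_integral_dirac0[OF f])
qed

section \<open>Closure properties of Gaussian distributions\<close>

lemma is_normal_vec_dist: "is_normal n \<mu> S \<psi> \<Longrightarrow> vec_dist n \<psi>"
  by (simp add: is_normal_def vec_dist_def)

lemma gaussian_vec_dist: "gaussian n \<psi> \<Longrightarrow> vec_dist n \<psi>"
  by (auto simp: gaussian_def is_normal_vec_dist)

lemma is_normalD:
  "is_normal n \<mu> S \<psi> \<Longrightarrow> t \<in> carrier_vec n \<Longrightarrow>
    (LINT x|\<psi>. iexp (t \<bullet> x)) = exp (\<i> * complex_of_real (t \<bullet> \<mu>) - complex_of_real (t \<bullet> (S *\<^sub>v t)) / 2)"
  by (simp add: is_normal_def)

lemma measurable_iexp_scalar_prod:
  "(\<lambda>x. iexp (t \<bullet> x)) \<in> borel_measurable (vec_borel n)"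
  by measurable

text \<open>\<open>M * S * transpose_mat M\<close> is the covariance of a pushforward. Its quadratic
  form at \<open>t\<close> is that of \<open>S\<close> at
  \<open>transpose_mat M *\<^sub>v t\<close>, which gives nonnegativity.\<close>

lemma psd_push:
  assumes S: "psd n S" and M: "M \<in> carrier_mat m n"
  shows "psd m (M * S * transpose_mat M)"
    and "t \<in> carrier_vec m \<Longrightarrow>
      t \<bullet> ((M * S * transpose_mat M) *\<^sub>v t) = (transpose_mat M *\<^sub>v t) \<bullet> (S *\<^sub>v (transpose_mat M *\<^sub>v t))"
proof -
  have c: "S \<in> carrier_mat n n" "transpose_mat S = S" using S by (auto simp: psd_def)
  have eq: "t \<bullet> ((M * S * transpose_mat M) *\<^sub>v t) = (transpose_mat M *\<^sub>v t) \<bullet> (S *\<^sub>v (transpose_mat M *\<^sub>v t))"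
    if t: "t \<in> carrier_vec m" for t
  proof -
    let ?u = "transpose_mat M *\<^sub>v t"
    have u: "?u \<in> carrier_vec n" using M t by auto
    have "(M * S * transpose_mat M) *\<^sub>v t = M * S *\<^sub>v ?u"
      using M c t by (intro assoc_mult_mat_vec[where ?n\<^sub>1=m and ?n\<^sub>2=n and ?n\<^sub>3=m]) auto
    also have "\<dots> = M *\<^sub>v (S *\<^sub>v ?u)" using M c u by (intro assoc_mult_mat_vec) auto
    finally show ?thesis
      using transpose_vec_mult_scalar[OF M _ t, of "S *\<^sub>v ?u"] c u by simp
  qed
  then show "t \<in> carrier_vec m \<Longrightarrow>
      t \<bullet> ((M * S * transpose_mat M) *\<^sub>v t) = (transpose_mat M *\<^sub>v t) \<bullet> (S *\<^sub>v (transpose_mat M *\<^sub>v t))" .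
  have "transpose_mat (M * S * transpose_mat M) = M * (S * transpose_mat M)"
    using transpose_mult[of "M * S" m n "transpose_mat M" m] transpose_mult[OF M c(1)] M c by simp
  also have "\<dots> = M * S * transpose_mat M"
    using M c by (intro assoc_mult_mat[symmetric]) auto
  finally show "psd m (M * S * transpose_mat M)"
    unfolding psd_def using eq S M c by (auto simp: psd_def)
qed

text \<open>Moving \<open>M\<close> across the scalar product evaluates the characteristic function
  of \<open>\<psi>\<close> at \<open>transpose_mat M *\<^sub>v t\<close>.\<close>

lemma gaussian_push:
  assumes g: "gaussian n \<psi>" and M: "M \<in> carrier_mat m n"
  shows "gaussian m (push M \<psi>)"
proof -
  obtain \<mu> S where \<mu>: "\<mu> \<in> carrier_vec n" and S: "psd n S" and N: "is_normal n \<mu> S \<psi>"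
    using g by (auto simp: gaussian_def)
  note \<psi> = gaussian_vec_dist[OF g]
  note [measurable_cong] = vec_dist_sets[OF \<psi>]
  have "is_normal m (M *\<^sub>v \<mu>) (M * S * transpose_mat M) (push M \<psi>)"
    unfolding is_normal_def
  proof (intro conjI ballI)
    show "prob_space (push M \<psi>)" "sets (push M \<psi>) = sets (vec_borel m)"
      using vec_dist_push[OF \<psi> M] by (auto simp: vec_dist_def)
    fix t :: "real Matrix.vec" assume t: "t \<in> carrier_vec m"
    let ?u = "transpose_mat M *\<^sub>v t"
    have u: "?u \<in> carrier_vec n" using M t by auto
    have [measurable]: "(\<lambda>x. M *\<^sub>v x) \<in> measurable \<psi> (vec_borel (dim_row M))"
      using M by (simp, measurable)
    have tr: "t \<bullet> (M *\<^sub>v x) = ?u \<bullet> x" if "x \<in> carrier_vec n" for x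
      using transpose_vec_mult_scalar[OF M that t] by simp
    have "(LINT x|push M \<psi>. iexp (t \<bullet> x)) = (LINT x|\<psi>. iexp (t \<bullet> (M *\<^sub>v x)))"
      unfolding push_def by (rule integral_distr) (auto intro!: measurable_iexp_scalar_prod)
    also have "\<dots> = (LINT x|\<psi>. iexp (?u \<bullet> x))"
      by (intro Bochner_Integration.integral_cong) (simp_all add: vec_dist_space[OF \<psi>] tr)
    also have "\<dots> = exp (\<i> * complex_of_real (?u \<bullet> \<mu>) - complex_of_real (?u \<bullet> (S *\<^sub>v ?u)) / 2)"
      by (rule is_normalD[OF N u])
    finally show "(LINT x|push M \<psi>. iexp (t \<bullet> x)) = exp (\<i> * complex_of_real (t \<bullet> (M *\<^sub>v \<mu>))
        - complex_of_real (t \<bullet> ((M * S * transpose_mat M) *\<^sub>v t)) / 2)"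
      by (simp only: psd_push(2)[OF S M t] tr[OF \<mu>])
  qed
  with psd_push(1)[OF S M] show ?thesis
    unfolding gaussian_def by (intro bexI[OF _ mult_mat_vec_carrier[OF M \<mu>]] exI conjI)
qed

text \<open>Independence for characteristic functions. Fubini applies because the integrand has
  modulus 1 on a probability space.\<close>

lemma integral_iexp_pair:
  assumes \<psi>: "vec_dist m \<psi>" and \<chi>: "vec_dist n \<chi>"
  shows "(LINT z|(\<psi> \<Otimes>\<^sub>M \<chi>). iexp (s \<bullet> fst z) * iexp (t \<bullet> snd z))
    = (LINT x|\<psi>. iexp (s \<bullet> x)) * (LINT y|\<chi>. iexp (t \<bullet> y))"
proof -
  note [measurable_cong] = \<psi>[THEN vec_dist_sets] \<chi>[THEN vec_dist_sets]
  interpret pair_prob_space \<psi> \<chi> by (rule pair_prob_space_vec_dist[OF \<psi> \<chi>])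
  have "(\<lambda>z. iexp (s \<bullet> fst z) * iexp (t \<bullet> snd z)) \<in> borel_measurable (\<psi> \<Otimes>\<^sub>M \<chi>)"
    by measurable
  then have "integrable (\<psi> \<Otimes>\<^sub>M \<chi>) (\<lambda>z. iexp (s \<bullet> fst z) * iexp (t \<bullet> snd z))"
    by (intro P.integrable_const_bound[where B=1] AE_I2) (simp_all only: norm_mult norm_exp_i_times mult_1 order_refl)
  then have "(LINT z|(\<psi> \<Otimes>\<^sub>M \<chi>). iexp (s \<bullet> fst z) * iexp (t \<bullet> snd z))
      = (LINT x|\<psi>. LINT y|\<chi>. iexp (s \<bullet> x) * iexp (t \<bullet> y))"
    using integral_fst'[of "\<lambda>z. iexp (s \<bullet> fst z) * iexp (t \<bullet> snd z)"] by (simp only: fst_conv snd_conv)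
  also have "\<dots> = (LINT x|\<psi>. iexp (s \<bullet> x) * (LINT y|\<chi>. iexp (t \<bullet> y)))"
    by (simp only: integral_mult_right_zero)
  also have "\<dots> = (LINT x|\<psi>. iexp (s \<bullet> x)) * (LINT y|\<chi>. iexp (t \<bullet> y))"
    by (simp only: integral_mult_left_zero)
  finally show ?thesis .
qed

text \<open>The characteristic function factors over the two blocks, so means are concatenated and
  the covariance is block diagonal.\<close>

lemma gaussian_prod:
  assumes g: "gaussian m \<psi>" and h: "gaussian n \<chi>"
  shows "gaussian (m + n) (prod_dist m n \<psi> \<chi>)"
proof -
  obtain \<mu> S where \<mu>: "\<mu> \<in> carrier_vec m" and S: "psd m S" and N: "is_normal m \<mu> S \<psi>"
    using g by (auto simp: gaussian_def)
  obtain \<nu> T where \<nu>: "\<nu> \<in> carrier_vec n" and T: "psd n T" and N': "is_normal n \<nu> T \<chi>"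
    using h by (auto simp: gaussian_def)
  note \<psi> = gaussian_vec_dist[OF g] and \<chi> = gaussian_vec_dist[OF h]
  note [measurable_cong] = \<psi>[THEN vec_dist_sets] \<chi>[THEN vec_dist_sets]
  have c: "S \<in> carrier_mat m m" "T \<in> carrier_mat n n" "transpose_mat S = S" "transpose_mat T = T"
    using S T by (auto simp: psd_def)
  have quad: "(s @\<^sub>v t) \<bullet> (mat_prod S T *\<^sub>v (s @\<^sub>v t)) = s \<bullet> (S *\<^sub>v s) + t \<bullet> (T *\<^sub>v t)"
    if "s \<in> carrier_vec m" "t \<in> carrier_vec n" for s t
    using that c by (simp add: mat_prod_mult_vec[OF c(1,2) that] scalar_prod_append[of _ m _ n])
  have "transpose_mat (mat_prod S T) = mat_prod S T"
    unfolding mat_prod_def using c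
    by (subst transpose_four_block_mat[of _ m m _ n _ n]) auto
  then have P: "psd (m + n) (mat_prod S T)"
    unfolding psd_def using c S T by (auto simp: psd_def quad elim!: carrier_vec_appendE)
  have "is_normal (m + n) (\<mu> @\<^sub>v \<nu>) (mat_prod S T) (prod_dist m n \<psi> \<chi>)"
    unfolding is_normal_def
  proof (intro conjI ballI)
    show "prob_space (prod_dist m n \<psi> \<chi>)" "sets (prod_dist m n \<psi> \<chi>) = sets (vec_borel (m + n))"
      using vec_dist_prod[OF \<psi> \<chi>] by (auto simp: vec_dist_def)
    fix r :: "real Matrix.vec" assume "r \<in> carrier_vec (m + n)"
    then obtain s t where st: "s \<in> carrier_vec m" "t \<in> carrier_vec n" "r = s @\<^sub>v t"
      by (elim carrier_vec_appendE)
    have "(\<lambda>(x, y). x @\<^sub>v y) \<in> measurable (\<psi> \<Otimes>\<^sub>M \<chi>) (vec_borel (m + n))" by measurable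
    then have "(LINT z|prod_dist m n \<psi> \<chi>. iexp (r \<bullet> z))
        = (LINT z|(\<psi> \<Otimes>\<^sub>M \<chi>). iexp (r \<bullet> (case z of (x, y) \<Rightarrow> x @\<^sub>v y)))"
      unfolding prod_dist_def by (rule integral_distr) (rule measurable_iexp_scalar_prod)
    also have "\<dots> = (LINT z|(\<psi> \<Otimes>\<^sub>M \<chi>). iexp (s \<bullet> fst z) * iexp (t \<bullet> snd z))"
      using st by (intro Bochner_Integration.integral_cong)
        (auto simp: space_pair_measure vec_dist_space[OF \<psi>] vec_dist_space[OF \<chi>]
          scalar_prod_append[of _ m _ n] exp_add[symmetric] algebra_simps)
    also have "\<dots> = exp (\<i> * complex_of_real (s \<bullet> \<mu>) - complex_of_real (s \<bullet> (S *\<^sub>v s)) / 2)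
        * exp (\<i> * complex_of_real (t \<bullet> \<nu>) - complex_of_real (t \<bullet> (T *\<^sub>v t)) / 2)"
      by (simp only: integral_iexp_pair[OF \<psi> \<chi>] is_normalD[OF N st(1)] is_normalD[OF N' st(2)])
    also have "\<dots> = exp (\<i> * complex_of_real (r \<bullet> (\<mu> @\<^sub>v \<nu>)) - complex_of_real (r \<bullet> (mat_prod S T *\<^sub>v r)) / 2)"
      using st \<mu> \<nu>
      by (simp add: quad scalar_prod_append[of _ m _ n] exp_add[symmetric] algebra_simps add_divide_distrib)
    finally show "(LINT z|prod_dist m n \<psi> \<chi>. iexp (r \<bullet> z))
        = exp (\<i> * complex_of_real (r \<bullet> (\<mu> @\<^sub>v \<nu>)) - complex_of_real (r \<bullet> (mat_prod S T *\<^sub>v r)) / 2)" .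
  qed
  then show ?thesis
    unfolding gaussian_def using P \<mu> \<nu> by (auto intro!: bexI[of _ "\<mu> @\<^sub>v \<nu>"])
qed

text \<open>Evaluating both characteristic functions at the same \<open>t\<close> and multiplying
  adds the exponents; hence means and covariances add.\<close>

lemma gaussian_conv:
  assumes g: "gaussian n \<psi>" and h: "gaussian n \<chi>"
  shows "gaussian n (conv_dist n \<psi> \<chi>)"
proof -
  obtain \<mu> S where \<mu>: "\<mu> \<in> carrier_vec n" and S: "psd n S" and N: "is_normal n \<mu> S \<psi>"
    using g by (auto simp: gaussian_def)
  obtain \<nu> T where \<nu>: "\<nu> \<in> carrier_vec n" and T: "psd n T" and N': "is_normal n \<nu> T \<chi>"
    using h by (auto simp: gaussian_def)
  note \<psi> = gaussian_vec_dist[OF g] and \<chi> = gaussian_vec_dist[OF h]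
  note [measurable_cong] = \<psi>[THEN vec_dist_sets] \<chi>[THEN vec_dist_sets]
  have c: "S \<in> carrier_mat n n" "T \<in> carrier_mat n n" "transpose_mat S = S" "transpose_mat T = T"
    using S T by (auto simp: psd_def)
  have quad: "t \<bullet> ((S + T) *\<^sub>v t) = t \<bullet> (S *\<^sub>v t) + t \<bullet> (T *\<^sub>v t)"
    if "t \<in> carrier_vec n" for t
    using that c by (simp add: add_mult_distrib_mat_vec[OF c(1,2) that] scalar_prod_add_distrib[of _ n])
  have P: "psd n (S + T)"
    unfolding psd_def using c S T by (auto simp: psd_def quad transpose_add[OF c(1,2)])
  have "is_normal n (\<mu> + \<nu>) (S + T) (conv_dist n \<psi> \<chi>)"
    unfolding is_normal_def
  proof (intro conjI ballI)
    show "prob_space (conv_dist n \<psi> \<chi>)" "sets (conv_dist n \<psi> \<chi>) = sets (vec_borel n)"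
      using vec_dist_conv[OF \<psi> \<chi>] by (auto simp: vec_dist_def)
    fix t :: "real Matrix.vec" assume t: "t \<in> carrier_vec n"
    have "(\<lambda>(x, y). x + y) \<in> measurable (\<psi> \<Otimes>\<^sub>M \<chi>) (vec_borel n)" by measurable
    then have "(LINT z|conv_dist n \<psi> \<chi>. iexp (t \<bullet> z))
        = (LINT z|(\<psi> \<Otimes>\<^sub>M \<chi>). iexp (t \<bullet> (case z of (x, y) \<Rightarrow> x + y)))"
      unfolding conv_dist_def by (rule integral_distr) (rule measurable_iexp_scalar_prod)
    also have "\<dots> = (LINT z|(\<psi> \<Otimes>\<^sub>M \<chi>). iexp (t \<bullet> fst z) * iexp (t \<bullet> snd z))"
      using t by (intro Bochner_Integration.integral_cong)
        (auto simp: space_pair_measure vec_dist_space[OF \<psi>] vec_dist_space[OF \<chi>]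
          scalar_prod_add_distrib[of _ n] exp_add[symmetric] algebra_simps)
    also have "\<dots> = exp (\<i> * complex_of_real (t \<bullet> \<mu>) - complex_of_real (t \<bullet> (S *\<^sub>v t)) / 2)
        * exp (\<i> * complex_of_real (t \<bullet> \<nu>) - complex_of_real (t \<bullet> (T *\<^sub>v t)) / 2)"
      by (simp only: integral_iexp_pair[OF \<psi> \<chi>] is_normalD[OF N t] is_normalD[OF N' t])
    also have "\<dots> = exp (\<i> * complex_of_real (t \<bullet> (\<mu> + \<nu>)) - complex_of_real (t \<bullet> ((S + T) *\<^sub>v t)) / 2)"
      using t \<mu> \<nu>
      by (simp add: quad scalar_prod_add_distrib[of _ n] exp_add[symmetric] algebra_simps add_divide_distrib)
    finally show "(LINT z|conv_dist n \<psi> \<chi>. iexp (t \<bullet> z))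
        = exp (\<i> * complex_of_real (t \<bullet> (\<mu> + \<nu>)) - complex_of_real (t \<bullet> ((S + T) *\<^sub>v t)) / 2)" .
  qed
  then show ?thesis
    unfolding gaussian_def using P \<mu> \<nu> by (auto intro!: bexI[of _ "\<mu> + \<nu>"])
qed

text \<open>The degenerate case of zero covariance, with constant characteristic function 1.\<close>

lemma gaussian_dirac0: "gaussian n (dirac0 n)"
proof -
  have zero: "0\<^sub>m n n *\<^sub>v t = 0\<^sub>v n" if "t \<in> carrier_vec n" for t :: "real Matrix.vec"
    using that by auto
  have "is_normal n (0\<^sub>v n) (0\<^sub>m n n) (dirac0 n)"
    unfolding is_normal_def
  proof (intro conjI ballI)
    show "prob_space (dirac0 n)" "sets (dirac0 n) = sets (vec_borel n)"
      using vec_dist_dirac0[of n] by (auto simp: vec_dist_def)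
    fix t :: "real Matrix.vec" assume t: "t \<in> carrier_vec n"
    have "(LINT x|dirac0 n. iexp (t \<bullet> x)) = iexp (t \<bullet> 0\<^sub>v n)"
      unfolding dirac0_def by (rule integral_return) (auto intro!: measurable_iexp_scalar_prod)
    then show "(LINT x|dirac0 n. iexp (t \<bullet> x)) = exp (\<i> * complex_of_real (t \<bullet> 0\<^sub>v n)
        - complex_of_real (t \<bullet> (0\<^sub>m n n *\<^sub>v t)) / 2)"
      using t zero by simp
  qed
  moreover have "psd n (0\<^sub>m n n)"
    by (auto simp: psd_def zero)
  ultimately show ?thesis unfolding gaussian_def by (auto intro!: bexI[of _ "0\<^sub>v n"])
qed

section \<open>Decorated copartial maps\<close>

lemma decorated_copartialI:
  "f \<in> carrier_mat k m \<Longrightarrow> p \<in> carrier_mat k n \<Longrightarrow> surj_mat p \<Longrightarrow> gaussian k \<psi> \<Longrightarrow>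
    (f, \<psi>, p) \<in> decorated_copartial m n"
  by (auto simp: decorated_copartial_def copartial_map_def)

lemma decorated_copartialE:
  assumes "(f, \<psi>, p) \<in> decorated_copartial m n"
  obtains k where "f \<in> carrier_mat k m" "p \<in> carrier_mat k n" "surj_mat p" "gaussian k \<psi>"
  using assms by (auto simp: decorated_copartial_def copartial_map_def)

lemma surj_mat_invertible_mult:
  assumes \<tau>: "\<tau> \<in> carrier_mat k k" "invertible_mat \<tau>" and p: "p \<in> carrier_mat k n" "surj_mat p"
  shows "surj_mat (\<tau> * p)"
  using surj_mat_mult[OF surj_mat_invertible[OF \<tau>(2,1)] p(2) \<tau>(1) p(1)] .

lemma decorated_copartial_act:
  assumes "f \<in> carrier_mat k m" "p \<in> carrier_mat k n" "surj_mat p" "gaussian k \<psi>"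
    and "\<tau> \<in> carrier_mat k k" "invertible_mat \<tau>"
  shows "(\<tau> * f, push \<tau> \<psi>, \<tau> * p) \<in> decorated_copartial m n"
  using assms by (intro decorated_copartialI[of _ k] surj_mat_invertible_mult[of _ k _ n] gaussian_push) auto

lemma decorated_eq_iff:
  assumes "f \<in> carrier_mat k m" "p \<in> carrier_mat k n" "surj_mat p" "gaussian k \<psi>"
  shows "((f, \<psi>, p), d) \<in> decorated_eq m n \<longleftrightarrow>
    (\<exists>\<tau>. \<tau> \<in> carrier_mat k k \<and> invertible_mat \<tau> \<and> d = (\<tau> * f, push \<tau> \<psi>, \<tau> * p))"
  using assms decorated_copartialI[OF assms] by (auto simp: decorated_eq_def)

text \<open>Invertible matrices act on the apex, and \<open>decorated_eq\<close> is the orbit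
  relation: identity, inverse and product give the three properties, with \<open>push_one\<close>
  and \<open>push_mult\<close> for the decoration.\<close>

lemma equiv_decorated_eq: "equiv (decorated_copartial m n) (decorated_eq m n)"
proof (rule equivI)
  show "decorated_eq m n \<subseteq> decorated_copartial m n \<times> decorated_copartial m n"
    by (auto simp: decorated_eq_def elim!: decorated_copartialE intro: decorated_copartialI decorated_copartial_act)
  show "refl_on (decorated_copartial m n) (decorated_eq m n)"
    unfolding refl_on_def
  proof safe
    fix f \<psi> p assume "(f, \<psi>, p) \<in> decorated_copartial m n"
    then obtain k where k: "f \<in> carrier_mat k m" "p \<in> carrier_mat k n" "surj_mat p" "gaussian k \<psi>"
      by (rule decorated_copartialE)
    then have "(f, \<psi>, p) = (1\<^sub>m k * f, push (1\<^sub>m k) \<psi>, 1\<^sub>m k * p)"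
      by (simp add: push_one[OF gaussian_vec_dist])
    moreover have "invertible_mat (1\<^sub>m k :: real Matrix.mat)"
      by (rule invertible_matI[of _ k "1\<^sub>m k"]) auto
    ultimately show "((f, \<psi>, p), (f, \<psi>, p)) \<in> decorated_eq m n"
      unfolding decorated_eq_iff[OF k] by (intro exI[of _ "1\<^sub>m k"]) simp
  qed
  show "sym (decorated_eq m n)"
  proof (rule symI, clarify)
    fix f \<psi> p f' \<psi>' p' assume a: "((f, \<psi>, p), (f', \<psi>', p')) \<in> decorated_eq m n"
    then have "(f, \<psi>, p) \<in> decorated_copartial m n" by (auto simp: decorated_eq_def)
    then obtain k where k: "f \<in> carrier_mat k m" "p \<in> carrier_mat k n" "surj_mat p" "gaussian k \<psi>"
      by (rule decorated_copartialE)
    obtain \<tau> where \<tau>: "\<tau> \<in> carrier_mat k k" "invertible_mat \<tau>"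
      and eq: "f' = \<tau> * f" "\<psi>' = push \<tau> \<psi>" "p' = \<tau> * p"
      using a unfolding decorated_eq_iff[OF k] by auto
    obtain \<sigma> where \<sigma>: "\<sigma> \<in> carrier_mat k k" "\<tau> * \<sigma> = 1\<^sub>m k" "\<sigma> * \<tau> = 1\<^sub>m k"
      using \<tau> by (metis invertible_matE)
    have "invertible_mat \<sigma>" using \<sigma> \<tau> by (intro invertible_matI[of _ k \<tau>])
    have "\<sigma> * (\<tau> * f) = f" "\<sigma> * (\<tau> * p) = p"
      using assoc_mult_mat[OF \<sigma>(1) \<tau>(1) k(1)] assoc_mult_mat[OF \<sigma>(1) \<tau>(1) k(2)] \<sigma>(3) k by simp_all
    moreover have "push \<sigma> (push \<tau> \<psi>) = \<psi>"
      using push_mult[OF gaussian_vec_dist[OF k(4)] \<sigma>(1) \<tau>(1)] \<sigma>(3) push_one[OF gaussian_vec_dist[OF k(4)]]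
      by simp
    moreover have k': "f' \<in> carrier_mat k m" "p' \<in> carrier_mat k n" "surj_mat p'" "gaussian k \<psi>'"
      unfolding eq using k \<tau> by (auto intro!: surj_mat_invertible_mult[of _ k _ n] gaussian_push)
    ultimately show "((f', \<psi>', p'), (f, \<psi>, p)) \<in> decorated_eq m n"
      unfolding decorated_eq_iff[OF k'] using \<sigma> \<open>invertible_mat \<sigma>\<close> eq by auto
  qed
  show "trans (decorated_eq m n)"
  proof (rule transI, clarify)
    fix f \<psi> p f' \<psi>' p' f'' \<psi>'' p''
    assume a: "((f, \<psi>, p), (f', \<psi>', p')) \<in> decorated_eq m n"
      and b: "((f', \<psi>', p'), (f'', \<psi>'', p'')) \<in> decorated_eq m n"
    then have "(f, \<psi>, p) \<in> decorated_copartial m n" by (auto simp: decorated_eq_def)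
    then obtain k where k: "f \<in> carrier_mat k m" "p \<in> carrier_mat k n" "surj_mat p" "gaussian k \<psi>"
      by (rule decorated_copartialE)
    obtain \<tau> where \<tau>: "\<tau> \<in> carrier_mat k k" "invertible_mat \<tau>"
      and eq: "f' = \<tau> * f" "\<psi>' = push \<tau> \<psi>" "p' = \<tau> * p"
      using a unfolding decorated_eq_iff[OF k] by auto
    have k': "f' \<in> carrier_mat k m" "p' \<in> carrier_mat k n" "surj_mat p'" "gaussian k \<psi>'"
      unfolding eq using k \<tau> by (auto intro!: surj_mat_invertible_mult[of _ k _ n] gaussian_push)
    obtain \<sigma> where \<sigma>: "\<sigma> \<in> carrier_mat k k" "invertible_mat \<sigma>"
      and eq': "f'' = \<sigma> * f'" "\<psi>'' = push \<sigma> \<psi>'" "p'' = \<sigma> * p'"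
      using b unfolding decorated_eq_iff[OF k'] by auto
    have "f'' = \<sigma> * \<tau> * f" "p'' = \<sigma> * \<tau> * p" "\<psi>'' = push (\<sigma> * \<tau>) \<psi>"
      using assoc_mult_mat[OF \<sigma>(1) \<tau>(1) k(1)] assoc_mult_mat[OF \<sigma>(1) \<tau>(1) k(2)]
        push_mult[OF gaussian_vec_dist[OF k(4)] \<sigma>(1) \<tau>(1)] eq eq' by simp_all
    moreover have "\<sigma> * \<tau> \<in> carrier_mat k k" "invertible_mat (\<sigma> * \<tau>)"
      using \<sigma> \<tau> by (auto intro: invertible_mat_mult)
    ultimately show "((f, \<psi>, p), (f'', \<psi>'', p'')) \<in> decorated_eq m n"
      unfolding decorated_eq_iff[OF k] by auto
  qed
qed

lemma gaussex_class_mem_iff: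
  assumes "f \<in> carrier_mat k m" "p \<in> carrier_mat k n" "surj_mat p" "gaussian k \<psi>"
  shows "d \<in> gaussex_class (f, \<psi>, p) \<longleftrightarrow>
    (\<exists>\<tau>. \<tau> \<in> carrier_mat k k \<and> invertible_mat \<tau> \<and> d = (\<tau> * f, push \<tau> \<psi>, \<tau> * p))"
  using decorated_eq_iff[OF assms] assms by (simp add: gaussex_class_def)

lemma gaussex_class_self:
  assumes "f \<in> carrier_mat k m" "p \<in> carrier_mat k n" "surj_mat p" "gaussian k \<psi>"
  shows "(f, \<psi>, p) \<in> gaussex_class (f, \<psi>, p)"
  using equiv_class_self[OF equiv_decorated_eq decorated_copartialI[OF assms]] assms
  by (simp add: gaussex_class_def)

text \<open>The means of identifying classes given by different representatives: exhibit the
  isomorphism of apexes.\<close>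

lemma gaussex_class_act:
  assumes k: "f \<in> carrier_mat k m" "p \<in> carrier_mat k n" "surj_mat p" "gaussian k \<psi>"
    and \<tau>: "\<tau> \<in> carrier_mat k k" "invertible_mat \<tau>"
  shows "gaussex_class (\<tau> * f, push \<tau> \<psi>, \<tau> * p) = gaussex_class (f, \<psi>, p)"
proof -
  have "((f, \<psi>, p), (\<tau> * f, push \<tau> \<psi>, \<tau> * p)) \<in> decorated_eq m n"
    unfolding decorated_eq_iff[OF k] using \<tau> by blast
  from equiv_class_eq[OF equiv_decorated_eq this] show ?thesis
    using k \<tau> by (simp add: gaussex_class_def)
qed

lemma gaussex_hom_iff:
  "X \<in> gaussex_hom m n \<longleftrightarrow> (\<exists>k f \<psi> p. f \<in> carrier_mat k m \<and> p \<in> carrier_mat k n \<and> surj_mat p \<and>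
    gaussian k \<psi> \<and> X = gaussex_class (f, \<psi>, p))"
proof
  assume "X \<in> gaussex_hom m n"
  then obtain d where d: "d \<in> decorated_copartial m n" "X = decorated_eq m n `` {d}"
    by (auto simp: gaussex_hom_def elim: quotientE)
  obtain f \<psi> p where fp: "d = (f, \<psi>, p)" by (cases d)
  from d(1) obtain k where k: "f \<in> carrier_mat k m" "p \<in> carrier_mat k n" "surj_mat p" "gaussian k \<psi>"
    unfolding fp by (rule decorated_copartialE)
  then have "X = gaussex_class (f, \<psi>, p)" by (simp add: gaussex_class_def d(2) fp)
  with k show "\<exists>k f \<psi> p. f \<in> carrier_mat k m \<and> p \<in> carrier_mat k n \<and> surj_mat p \<and>
    gaussian k \<psi> \<and> X = gaussex_class (f, \<psi>, p)" by blast
next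
  assume "\<exists>k f \<psi> p. f \<in> carrier_mat k m \<and> p \<in> carrier_mat k n \<and> surj_mat p \<and>
    gaussian k \<psi> \<and> X = gaussex_class (f, \<psi>, p)"
  then obtain k f \<psi> p where k: "f \<in> carrier_mat k m" "p \<in> carrier_mat k n" "surj_mat p" "gaussian k \<psi>"
    and X: "X = gaussex_class (f, \<psi>, p)" by blast
  have "X = decorated_eq m n `` {(f, \<psi>, p)}"
    using k by (simp add: X gaussex_class_def)
  then show "X \<in> gaussex_hom m n"
    unfolding gaussex_hom_def using quotientI[OF decorated_copartialI[OF k]] by simp
qed

lemma gaussex_homI:
  "f \<in> carrier_mat k m \<Longrightarrow> p \<in> carrier_mat k n \<Longrightarrow> surj_mat p \<Longrightarrow> gaussian k \<psi> \<Longrightarrow>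
    gaussex_class (f, \<psi>, p) \<in> gaussex_hom m n"
  by (auto simp: gaussex_hom_iff)

lemma gaussex_homE:
  assumes "X \<in> gaussex_hom m n"
  obtains k f \<psi> p where "f \<in> carrier_mat k m" "p \<in> carrier_mat k n" "surj_mat p" "gaussian k \<psi>"
    "X = gaussex_class (f, \<psi>, p)"
  using assms by (auto simp: gaussex_hom_iff)

section \<open>Composition and tensor computed on representatives\<close>

text \<open>The union defining the composite has to be a single class. A pushout for changed
  representatives becomes one for the given representatives once the changes of apex are absorbed
  into its legs, and uniqueness of pushouts supplies the isomorphism between the resulting
  triples.\<close>

lemma gaussex_comp_class:
  assumes k: "f \<in> carrier_mat k m" "p \<in> carrier_mat k n" "surj_mat p" "gaussian k \<psi>"
    and l: "g \<in> carrier_mat l n" "q \<in> carrier_mat l r" "surj_mat q" "gaussian l \<chi>"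
    and i: "is_pushout p g i1 i2" "i1 \<in> carrier_mat w k" "i2 \<in> carrier_mat w l"
  shows "gaussex_comp (gaussex_class (g, \<chi>, q)) (gaussex_class (f, \<psi>, p))
      = gaussex_class (i1 * f, conv_dist w (push i1 \<psi>) (push i2 \<chi>), i2 * q)" (is "?L = ?R")
    and "i1 * f \<in> carrier_mat w m" "i2 * q \<in> carrier_mat w r" "surj_mat (i2 * q)"
    and "gaussian w (conv_dist w (push i1 \<psi>) (push i2 \<chi>))"
proof -
  note \<psi> = gaussian_vec_dist[OF k(4)] and \<chi> = gaussian_vec_dist[OF l(4)]
  have si2: "surj_mat i2"
    using i pushout_iff_exact[OF k(2,3) l(1) i(2,3)] by simp
  show c: "i1 * f \<in> carrier_mat w m" "i2 * q \<in> carrier_mat w r" "surj_mat (i2 * q)"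
    using k l i si2 by (auto intro: surj_mat_mult)
  show gc: "gaussian w (conv_dist w (push i1 \<psi>) (push i2 \<chi>))"
    using k l i by (intro gaussian_conv gaussian_push)
  have eq: "gaussex_class (j1 * f', conv_dist (dim_row j1) (push j1 \<psi>') (push j2 \<chi>'), j2 * q') = ?R"
    if A: "(f', \<psi>', p') \<in> gaussex_class (f, \<psi>, p)" and B: "(g', \<chi>', q') \<in> gaussex_class (g, \<chi>, q)"
      and j: "is_pushout p' g' j1 j2" for f' \<psi>' p' g' \<chi>' q' j1 j2
  proof -
    obtain \<tau> where \<tau>: "\<tau> \<in> carrier_mat k k" "invertible_mat \<tau>"
      and eq: "f' = \<tau> * f" "\<psi>' = push \<tau> \<psi>" "p' = \<tau> * p"
      using A unfolding gaussex_class_mem_iff[OF k] by auto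
    obtain \<sigma> where \<sigma>: "\<sigma> \<in> carrier_mat l l" "invertible_mat \<sigma>"
      and eq': "g' = \<sigma> * g" "\<chi>' = push \<sigma> \<chi>" "q' = \<sigma> * q"
      using B unfolding gaussex_class_mem_iff[OF l] by auto
    define v where "v = dim_row j1"
    have cp: "p' \<in> carrier_mat k n" "surj_mat p'" "g' \<in> carrier_mat l n"
      unfolding eq eq' using \<tau> \<sigma> k l by (auto intro!: surj_mat_invertible_mult[of _ k _ n])
    have cj: "j1 \<in> carrier_mat v k" "j2 \<in> carrier_mat v l"
      using j cp by (auto simp: is_pushout_def v_def)
    note J = j[unfolded pushout_iff_exact[OF cp cj]]
    obtain \<tau>' where \<tau>': "\<tau>' \<in> carrier_mat k k" "\<tau>' * \<tau> = 1\<^sub>m k" using \<tau> by (metis invertible_matE)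
    obtain \<sigma>' where \<sigma>': "\<sigma>' \<in> carrier_mat l l" "\<sigma>' * \<sigma> = 1\<^sub>m l" using \<sigma> by (metis invertible_matE)
    have cancel\<tau>: "\<tau>' *\<^sub>v (\<tau> *\<^sub>v x) = x" if "x \<in> carrier_vec k" for x
      using assoc_mult_mat_vec[OF \<tau>'(1) \<tau>(1) that] \<tau>'(2) that by simp
    have cancel\<sigma>: "\<sigma>' *\<^sub>v (\<sigma> *\<^sub>v x) = x" if "x \<in> carrier_vec l" for x
      using assoc_mult_mat_vec[OF \<sigma>'(1) \<sigma>(1) that] \<sigma>'(2) that by simp
    have cj': "j1 * \<tau> \<in> carrier_mat v k" "j2 * \<sigma> \<in> carrier_mat v l" using cj \<tau> \<sigma> by auto
    \<comment> \<open>Since \<open>p' = \<tau> * p\<close> and \<open>g' = \<sigma> * g\<close>,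
      commutativity is a matter of bracketing. For exactness, the kernel element is found in the
      primed square and \<open>\<tau>\<close>, \<open>\<sigma>\<close> are cancelled by their
      inverses.\<close>
    have "is_pushout p g (j1 * \<tau>) (j2 * \<sigma>)"
    proof (subst pushout_iff_exact[OF k(2,3) l(1) cj'], intro conjI ballI impI)
      show "surj_mat (j2 * \<sigma>)"
        using surj_mat_mult[OF _ surj_mat_invertible[OF \<sigma>(2,1)] cj(2) \<sigma>(1)] J by blast
      show "j1 * \<tau> * p = j2 * \<sigma> * g"
        using assoc_mult_mat[OF cj(1) \<tau>(1) k(2)] assoc_mult_mat[OF cj(2) \<sigma>(1) l(1)] J
        by (simp only: eq eq')
      fix b :: "real Matrix.vec" assume b: "b \<in> carrier_vec l" "j2 * \<sigma> *\<^sub>v b = 0\<^sub>v v"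
      then have "j2 *\<^sub>v (\<sigma> *\<^sub>v b) = 0\<^sub>v v" "\<sigma> *\<^sub>v b \<in> carrier_vec l"
        using assoc_mult_mat_vec[OF cj(2) \<sigma>(1) b(1)] \<sigma> b by auto
      then obtain y where y: "y \<in> carrier_vec n" "p' *\<^sub>v y = 0\<^sub>v k" "g' *\<^sub>v y = \<sigma> *\<^sub>v b"
        using J by blast
      have "p *\<^sub>v y = \<tau>' *\<^sub>v (\<tau> *\<^sub>v (p *\<^sub>v y))" using k y by (intro cancel\<tau>[symmetric]) auto
      also have "\<tau> *\<^sub>v (p *\<^sub>v y) = 0\<^sub>v k" using assoc_mult_mat_vec[OF \<tau>(1) k(2) y(1)] y(2) eq by simp
      also have "\<tau>' *\<^sub>v 0\<^sub>v k = 0\<^sub>v k" using \<tau>' by auto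
      finally have py: "p *\<^sub>v y = 0\<^sub>v k" .
      have "g *\<^sub>v y = \<sigma>' *\<^sub>v (\<sigma> *\<^sub>v (g *\<^sub>v y))" using l y by (intro cancel\<sigma>[symmetric]) auto
      also have "\<sigma> *\<^sub>v (g *\<^sub>v y) = \<sigma> *\<^sub>v b" using assoc_mult_mat_vec[OF \<sigma>(1) l(1) y(1)] y(3) eq' by simp
      also have "\<sigma>' *\<^sub>v (\<sigma> *\<^sub>v b) = b" by (rule cancel\<sigma>[OF b(1)])
      finally show "\<exists>y \<in> carrier_vec n. p *\<^sub>v y = 0\<^sub>v k \<and> g *\<^sub>v y = b" using y py by blast
    qed
    note unique = pushout_unique[OF k(2) l(1) i(1) this]
    have dims: "dim_row i1 = w" "dim_row (j1 * \<tau>) = v" using i(2) cj(1) by auto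
    obtain u where u: "u \<in> carrier_mat w w" "invertible_mat u"
      "u * i1 = j1 * \<tau>" "u * i2 = j2 * \<sigma>" "v = w"
      using unique[unfolded dims] by blast
    note cj = cj[unfolded u(5)] and cj' = cj'[unfolded u(5)]
    have 1: "j1 * f' = u * (i1 * f)"
      using assoc_mult_mat[OF cj(1) \<tau>(1) k(1)] assoc_mult_mat[OF u(1) i(2) k(1)]
      unfolding eq(1) u(3) by simp
    have 2: "j2 * q' = u * (i2 * q)"
      using assoc_mult_mat[OF cj(2) \<sigma>(1) l(2)] assoc_mult_mat[OF u(1) i(3) l(2)]
      unfolding eq'(3) u(4) by simp
    have "push j1 \<psi>' = push u (push i1 \<psi>)"
      unfolding eq(2) push_mult[OF \<psi> cj(1) \<tau>(1), symmetric] push_mult[OF \<psi> u(1) i(2), symmetric] u(3) ..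
    moreover have "push j2 \<chi>' = push u (push i2 \<chi>)"
      unfolding eq'(2) push_mult[OF \<chi> cj(2) \<sigma>(1), symmetric] push_mult[OF \<chi> u(1) i(3), symmetric] u(4) ..
    ultimately have 3: "conv_dist (dim_row j1) (push j1 \<psi>') (push j2 \<chi>')
        = push u (conv_dist w (push i1 \<psi>) (push i2 \<chi>))"
      using conv_push[OF vec_dist_push[OF \<psi> i(2)] vec_dist_push[OF \<chi> i(3)] u(1)] cj(1) by simp
    show ?thesis
      unfolding 1 2 3 by (rule gaussex_class_act[OF c gc u(1,2)])
  qed
  show "?L = ?R"
  proof
    show "?L \<subseteq> ?R"
    proof
      fix d assume "d \<in> ?L"
      then obtain f' \<psi>' p' g' \<chi>' q' j1 j2 where "(f', \<psi>', p') \<in> gaussex_class (f, \<psi>, p)"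
        "(g', \<chi>', q') \<in> gaussex_class (g, \<chi>, q)" "is_pushout p' g' j1 j2"
        "d \<in> gaussex_class (j1 * f', conv_dist (dim_row j1) (push j1 \<psi>') (push j2 \<chi>'), j2 * q')"
        unfolding gaussex_comp_def by blast
      then show "d \<in> ?R" using eq by blast
    qed
    show "?R \<subseteq> ?L"
    proof
      fix d assume "d \<in> ?R"
      then have "d \<in> gaussex_class (i1 * f, conv_dist (dim_row i1) (push i1 \<psi>) (push i2 \<chi>), i2 * q)"
        using i by simp
      then show "d \<in> ?L"
        unfolding gaussex_comp_def using gaussex_class_self[OF k] gaussex_class_self[OF l] i(1) by blast
    qed
  qed
qed

text \<open>Changes of representatives \<open>\<tau>\<close> and \<open>\<sigma>\<close> in the
  factors combine into the change \<open>mat_prod \<tau> \<sigma>\<close> of the tensor.\<close>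

lemma gaussex_tensor_class:
  assumes k: "f \<in> carrier_mat k m" "p \<in> carrier_mat k n" "surj_mat p" "gaussian k \<psi>"
    and k': "f' \<in> carrier_mat k' m'" "p' \<in> carrier_mat k' n'" "surj_mat p'" "gaussian k' \<psi>'"
  shows "gaussex_tensor (gaussex_class (f, \<psi>, p)) (gaussex_class (f', \<psi>', p'))
      = gaussex_class (mat_prod f f', prod_dist k k' \<psi> \<psi>', mat_prod p p')" (is "?L = ?R")
    and "mat_prod f f' \<in> carrier_mat (k + k') (m + m')" "mat_prod p p' \<in> carrier_mat (k + k') (n + n')"
    and "surj_mat (mat_prod p p')" "gaussian (k + k') (prod_dist k k' \<psi> \<psi>')"
proof -
  note \<psi> = gaussian_vec_dist[OF k(4)] and \<psi>' = gaussian_vec_dist[OF k'(4)]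
  show c: "mat_prod f f' \<in> carrier_mat (k + k') (m + m')" "mat_prod p p' \<in> carrier_mat (k + k') (n + n')"
    "surj_mat (mat_prod p p')" "gaussian (k + k') (prod_dist k k' \<psi> \<psi>')"
    using k k' by (auto intro: surj_mat_prod gaussian_prod)
  have eq: "gaussex_class (mat_prod h h', prod_dist (dim_row q) (dim_row q') \<chi> \<chi>', mat_prod q q') = ?R"
    if A: "(h, \<chi>, q) \<in> gaussex_class (f, \<psi>, p)" and B: "(h', \<chi>', q') \<in> gaussex_class (f', \<psi>', p')"
    for h \<chi> q h' \<chi>' q'
  proof -
    obtain \<tau> where \<tau>: "\<tau> \<in> carrier_mat k k" "invertible_mat \<tau>"
      and eq: "h = \<tau> * f" "\<chi> = push \<tau> \<psi>" "q = \<tau> * p"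
      using A unfolding gaussex_class_mem_iff[OF k] by auto
    obtain \<sigma> where \<sigma>: "\<sigma> \<in> carrier_mat k' k'" "invertible_mat \<sigma>"
      and eq': "h' = \<sigma> * f'" "\<chi>' = push \<sigma> \<psi>'" "q' = \<sigma> * p'"
      using B unfolding gaussex_class_mem_iff[OF k'] by auto
    have "dim_row q = k" "dim_row q' = k'" using \<tau> \<sigma> eq eq' by auto
    then show ?thesis
      unfolding eq eq' mat_prod_comp[OF \<tau>(1) k(1) \<sigma>(1) k'(1)] mat_prod_comp[OF \<tau>(1) k(2) \<sigma>(1) k'(2)]
      using gaussex_class_act[OF c mat_prod_carrier[OF \<tau>(1) \<sigma>(1)] invertible_mat_prod[OF \<tau>(2) \<sigma>(2) \<tau>(1) \<sigma>(1)]]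
        prod_push[OF \<psi> \<psi>' \<tau>(1) \<sigma>(1)] by simp
  qed
  show "?L = ?R"
  proof
    show "?L \<subseteq> ?R"
    proof
      fix d assume "d \<in> ?L"
      then obtain h \<chi> q h' \<chi>' q' where "(h, \<chi>, q) \<in> gaussex_class (f, \<psi>, p)"
        "(h', \<chi>', q') \<in> gaussex_class (f', \<psi>', p')"
        "d \<in> gaussex_class (mat_prod h h', prod_dist (dim_row q) (dim_row q') \<chi> \<chi>', mat_prod q q')"
        unfolding gaussex_tensor_def by blast
      then show "d \<in> ?R" using eq by blast
    qed
    show "?R \<subseteq> ?L"
    proof
      fix d assume "d \<in> ?R"
      then have "d \<in> gaussex_class (mat_prod f f', prod_dist (dim_row p) (dim_row p') \<psi> \<psi>', mat_prod p p')"
        using k k' by simp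
      then show "d \<in> ?L"
        unfolding gaussex_tensor_def using gaussex_class_self[OF k] gaussex_class_self[OF k'] by blast
    qed
  qed
qed

definition gaussex_linear :: "real Matrix.mat \<Rightarrow> decorated set" where
  "gaussex_linear h = gaussex_class (h, dirac0 (dim_row h), 1\<^sub>m (dim_row h))"

lemma gaussex_linear_class:
  "h \<in> carrier_mat n m \<Longrightarrow> gaussex_linear h = gaussex_class (h, dirac0 n, 1\<^sub>m n)"
  by (simp add: gaussex_linear_def)

text \<open>The first map has identity right leg and no noise, so pushing out alters only the left
  leg.\<close>

lemma gaussex_comp_linear_right:
  assumes h: "h \<in> carrier_mat n m"
    and l: "g \<in> carrier_mat l n" "q \<in> carrier_mat l r" "surj_mat q" "gaussian l \<chi>"
  shows "gaussex_comp (gaussex_class (g, \<chi>, q)) (gaussex_linear h) = gaussex_class (g * h, \<chi>, q)"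
  unfolding gaussex_linear_class[OF h]
  using l by (subst gaussex_comp_class(1)[OF h one_carrier_mat surj_mat_one gaussian_dirac0 l
        pushout_one_left[OF l(1)] l(1) one_carrier_mat])
    (simp add: push_dirac0[OF l(1)] push_one[OF gaussian_vec_dist] conv_dirac0[OF gaussian_vec_dist])

text \<open>After a copartial map a linear map meets its right leg, and in general the apex changes.
  For an isomorphism the apex can be kept and the inverse absorbed into that leg.\<close>

lemma gaussex_comp_linear_left_iso:
  assumes k: "f \<in> carrier_mat k m" "p \<in> carrier_mat k n" "surj_mat p" "gaussian k \<psi>"
    and h: "h \<in> carrier_mat n n" "h' \<in> carrier_mat n n" "h * h' = 1\<^sub>m n" "h' * h = 1\<^sub>m n"
  shows "gaussex_comp (gaussex_linear h) (gaussex_class (f, \<psi>, p)) = gaussex_class (f, \<psi>, p * h')"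
proof -
  have ph: "p * h' \<in> carrier_mat k n" using k h by auto
  show ?thesis
    unfolding gaussex_linear_class[OF h(1)]
    using k right_mult_one_mat[OF ph] by (subst gaussex_comp_class(1)[OF k h(1) one_carrier_mat surj_mat_one gaussian_dirac0
          pushout_inverse[OF k(2,3) h] one_carrier_mat ph])
      (simp add: push_dirac0[OF ph] push_one[OF gaussian_vec_dist] conv_dirac0[OF gaussian_vec_dist])
qed

lemma linear_markov_gaussex: "linear_markov gaussex_hom gaussex_comp gaussex_tensor gaussex_linear"
proof (unfold_locales, goal_cases)
  case (1 X m n m' n')
  \<comment> \<open>An isomorphism of apexes changes neither source nor target, so any member of a
    class reveals both as column counts.\<close>
  have dims: "dim_col f = a \<and> dim_col p = b" if "X \<in> gaussex_hom a b" "(f, \<psi>, p) \<in> X" for a b f \<psi> p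
    using that(1)
  proof (rule gaussex_homE)
    fix k f' \<psi>' p' assume k: "f' \<in> carrier_mat k a" "p' \<in> carrier_mat k b" "surj_mat p'" "gaussian k \<psi>'"
      "X = gaussex_class (f', \<psi>', p')"
    then show ?thesis using that(2) gaussex_class_mem_iff[OF k(1-4)] by auto
  qed
  obtain d where d: "d \<in> X"
    using 1(1) by (rule gaussex_homE) (use gaussex_class_self in blast)
  obtain f \<psi> p where "d = (f, \<psi>, p)" by (cases d)
  then show ?case using dims[OF 1(1)] dims[OF 1(2)] d by metis
next
  case (2 X m n Y r)
  obtain k f \<psi> p where k: "f \<in> carrier_mat k m" "p \<in> carrier_mat k n" "surj_mat p" "gaussian k \<psi>"
    and X: "X = gaussex_class (f, \<psi>, p)" using 2(1) by (rule gaussex_homE)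
  obtain l g \<chi> q where l: "g \<in> carrier_mat l n" "q \<in> carrier_mat l r" "surj_mat q" "gaussian l \<chi>"
    and Y: "Y = gaussex_class (g, \<chi>, q)" using 2(2) by (rule gaussex_homE)
  obtain w i1 i2 where i: "is_pushout p g i1 i2" "i1 \<in> carrier_mat w k" "i2 \<in> carrier_mat w l"
    using pushout_exists[OF k(2,3) l(1)] by metis
  note comp = gaussex_comp_class[OF k l i]
  show ?case
    unfolding X Y comp(1) by (rule gaussex_homI[OF comp(2-5)])
next
  case (3 X m n X' m' n')
  obtain k f \<psi> p where k: "f \<in> carrier_mat k m" "p \<in> carrier_mat k n" "surj_mat p" "gaussian k \<psi>"
    and X: "X = gaussex_class (f, \<psi>, p)" using 3(1) by (rule gaussex_homE)
  obtain l g \<chi> q where l: "g \<in> carrier_mat l m'" "q \<in> carrier_mat l n'" "surj_mat q" "gaussian l \<chi>"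
    and X': "X' = gaussex_class (g, \<chi>, q)" using 3(2) by (rule gaussex_homE)
  note tens = gaussex_tensor_class[OF k l]
  show ?case
    unfolding X X' tens(1) by (rule gaussex_homI[OF tens(2-5)])
next
  case (4 M n m)
  show ?case
    unfolding gaussex_linear_class[OF 4]
    by (rule gaussex_homI[OF 4 one_carrier_mat surj_mat_one gaussian_dirac0])
next
  case (5 X m n)
  then show ?case
    by (rule gaussex_homE) (simp add: gaussex_comp_linear_right[OF one_carrier_mat])
next
  case (6 X m n)
  then show ?case
  proof (rule gaussex_homE)
    fix k f \<psi> p assume k: "f \<in> carrier_mat k m" "p \<in> carrier_mat k n" "surj_mat p" "gaussian k \<psi>"
      and X: "X = gaussex_class (f, \<psi>, p)"
    show ?thesis
      using k by (simp add: X gaussex_comp_linear_left_iso[OF k one_carrier_mat one_carrier_mat])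
  qed
next
  case (7 X m n Y r Z s)
  obtain k f \<psi> p where k: "f \<in> carrier_mat k m" "p \<in> carrier_mat k n" "surj_mat p" "gaussian k \<psi>"
    and X: "X = gaussex_class (f, \<psi>, p)" using 7(1) by (rule gaussex_homE)
  obtain l g \<chi> q where l: "g \<in> carrier_mat l n" "q \<in> carrier_mat l r" "surj_mat q" "gaussian l \<chi>"
    and Y: "Y = gaussex_class (g, \<chi>, q)" using 7(2) by (rule gaussex_homE)
  obtain t h \<xi> e where t: "h \<in> carrier_mat t r" "e \<in> carrier_mat t s" "surj_mat e" "gaussian t \<xi>"
    and Z: "Z = gaussex_class (h, \<xi>, e)" using 7(3) by (rule gaussex_homE)
  note \<psi> = gaussian_vec_dist[OF k(4)] and \<chi> = gaussian_vec_dist[OF l(4)] and \<xi> = gaussian_vec_dist[OF t(4)]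
  obtain w i1 i2 where i: "is_pushout p g i1 i2" "i1 \<in> carrier_mat w k" "i2 \<in> carrier_mat w l" "surj_mat i2"
    using pushout_exists[OF k(2,3) l(1)] by metis
  obtain v j1 j2 where j: "is_pushout q h j1 j2" "j1 \<in> carrier_mat v l" "j2 \<in> carrier_mat v t"
    using pushout_exists[OF l(2,3) t(1)] by metis
  obtain u e1 e2 where e: "is_pushout i2 j1 e1 e2" "e1 \<in> carrier_mat u w" "e2 \<in> carrier_mat u v"
    using pushout_exists[OF i(3,4) j(2)] by metis
  \<comment> \<open>One apex \<open>u\<close> now serves both bracketings; what remains is to
    compare the decorations and the legs on it.\<close>
  note paste = pushout_paste[OF k(2,3) l(1) l(2,3) t(1) i(2,3,1) j(2,3,1) e(2,3,1)]
  note XY = gaussex_comp_class[OF k l i(1-3)] and YZ = gaussex_comp_class[OF l t j]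
  have c: "e2 * j2 \<in> carrier_mat u t" "e1 * i1 \<in> carrier_mat u k" using e i j by auto
  \<comment> \<open>The middle noise \<open>\<chi>\<close> reaches the apex through
    \<open>i2\<close> in one bracketing and through \<open>j1\<close> in the other; commutativity of
    the inner square identifies the two routes.\<close>
  have ej: "e1 * i2 = e2 * j1" using e(1) by (simp add: is_pushout_def)
  have "gaussex_comp (gaussex_comp Z Y) X = gaussex_class (e1 * i1 * f,
      conv_dist u (push (e1 * i1) \<psi>) (push e2 (conv_dist v (push j1 \<chi>) (push j2 \<xi>))), e2 * (j2 * e))"
    unfolding X Y Z YZ(1) by (rule gaussex_comp_class(1)[OF k YZ(2-5) paste(2) c(2) e(3)])
  also have "push e2 (conv_dist v (push j1 \<chi>) (push j2 \<xi>))
      = conv_dist u (push (e2 * j1) \<chi>) (push (e2 * j2) \<xi>)"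
    by (simp add: conv_push[OF vec_dist_push[OF \<chi> j(2)] vec_dist_push[OF \<xi> j(3)] e(3), symmetric]
        push_mult[OF \<chi> e(3) j(2)] push_mult[OF \<xi> e(3) j(3)])
  also have "conv_dist u (push (e1 * i1) \<psi>) (conv_dist u (push (e2 * j1) \<chi>) (push (e2 * j2) \<xi>))
      = conv_dist u (conv_dist u (push (e1 * i1) \<psi>) (push (e1 * i2) \<chi>)) (push (e2 * j2) \<xi>)"
    unfolding ej using e j
    by (intro conv_assoc[symmetric] vec_dist_push[OF \<psi> c(2)] vec_dist_push[OF \<xi> c(1)] vec_dist_push[OF \<chi>]) auto
  also have "conv_dist u (push (e1 * i1) \<psi>) (push (e1 * i2) \<chi>)
      = push e1 (conv_dist w (push i1 \<psi>) (push i2 \<chi>))"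
    by (simp add: conv_push[OF vec_dist_push[OF \<psi> i(2)] vec_dist_push[OF \<chi> i(3)] e(2), symmetric]
        push_mult[OF \<psi> e(2) i(2)] push_mult[OF \<chi> e(2) i(3)])
  also have "e1 * i1 * f = e1 * (i1 * f)" by (rule assoc_mult_mat[OF e(2) i(2) k(1)])
  also have "e2 * (j2 * e) = e2 * j2 * e" by (rule assoc_mult_mat[OF e(3) j(3) t(2), symmetric])
  also have "gaussex_class (e1 * (i1 * f), conv_dist u (push e1 (conv_dist w (push i1 \<psi>) (push i2 \<chi>)))
      (push (e2 * j2) \<xi>), e2 * j2 * e) = gaussex_comp Z (gaussex_comp Y X)"
    unfolding X Y Z XY(1) by (rule gaussex_comp_class(1)[OF XY(2-5) t paste(1) e(2) c(1), symmetric])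
  finally show ?case .
next
  case (8 M n m N k)
  have "gaussex_comp (gaussex_linear N) (gaussex_linear M) = gaussex_class (N * M, dirac0 k, 1\<^sub>m k)"
    unfolding gaussex_linear_class[OF 8(2)]
    by (rule gaussex_comp_linear_right[OF 8 one_carrier_mat surj_mat_one gaussian_dirac0])
  then show ?case using gaussex_linear_class[OF mult_carrier_mat[OF 8(2,1)]] by simp
next
  case (9 M n m N n' m')
  show ?case
    unfolding gaussex_linear_class[OF 9(1)] gaussex_linear_class[OF 9(2)]
      gaussex_linear_class[OF mat_prod_carrier[OF 9]]
      gaussex_tensor_class(1)[OF 9(1) one_carrier_mat surj_mat_one gaussian_dirac0 9(2) one_carrier_mat
        surj_mat_one gaussian_dirac0]
    by (simp add: prod_dirac0 mat_prod_one)
next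
  case (10 X m n Y r X' m' n' Y' r')
  obtain k f \<psi> p where k: "f \<in> carrier_mat k m" "p \<in> carrier_mat k n" "surj_mat p" "gaussian k \<psi>"
    and X: "X = gaussex_class (f, \<psi>, p)" using 10(1) by (rule gaussex_homE)
  obtain l g \<chi> q where l: "g \<in> carrier_mat l n" "q \<in> carrier_mat l r" "surj_mat q" "gaussian l \<chi>"
    and Y: "Y = gaussex_class (g, \<chi>, q)" using 10(2) by (rule gaussex_homE)
  obtain k' f' \<psi>' p' where k': "f' \<in> carrier_mat k' m'" "p' \<in> carrier_mat k' n'" "surj_mat p'" "gaussian k' \<psi>'"
    and X': "X' = gaussex_class (f', \<psi>', p')" using 10(3) by (rule gaussex_homE)
  obtain l' g' \<chi>' q' where l': "g' \<in> carrier_mat l' n'" "q' \<in> carrier_mat l' r'" "surj_mat q'" "gaussian l' \<chi>'"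
    and Y': "Y' = gaussex_class (g', \<chi>', q')" using 10(4) by (rule gaussex_homE)
  note \<psi> = gaussian_vec_dist[OF k(4)] and \<chi> = gaussian_vec_dist[OF l(4)]
    and \<psi>' = gaussian_vec_dist[OF k'(4)] and \<chi>' = gaussian_vec_dist[OF l'(4)]
  obtain w i1 i2 where i: "is_pushout p g i1 i2" "i1 \<in> carrier_mat w k" "i2 \<in> carrier_mat w l"
    using pushout_exists[OF k(2,3) l(1)] by metis
  obtain w' i1' i2' where i': "is_pushout p' g' i1' i2'" "i1' \<in> carrier_mat w' k'" "i2' \<in> carrier_mat w' l'"
    using pushout_exists[OF k'(2,3) l'(1)] by metis
  \<comment> \<open>The composite of the tensors may be computed with the product of the two
    pushouts, so both sides of the interchange law get the apex \<open>w + w'\<close>.\<close>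
  note po = pushout_mat_prod[OF k(2,3) l(1) i(2,3,1) k'(2,3) l'(1) i'(2,3,1)]
  note XY = gaussex_comp_class[OF k l i] and XY' = gaussex_comp_class[OF k' l' i']
  note TX = gaussex_tensor_class[OF k k'] and TY = gaussex_tensor_class[OF l l']
  have "gaussex_comp (gaussex_tensor Y Y') (gaussex_tensor X X') = gaussex_class (mat_prod i1 i1' * mat_prod f f',
      conv_dist (w + w') (push (mat_prod i1 i1') (prod_dist k k' \<psi> \<psi>')) (push (mat_prod i2 i2') (prod_dist l l' \<chi> \<chi>')),
      mat_prod i2 i2' * mat_prod q q')"
    unfolding X X' Y Y' TX(1) TY(1)
    by (rule gaussex_comp_class(1)[OF TX(2-5) TY(2-5) po mat_prod_carrier[OF i(2) i'(2)] mat_prod_carrier[OF i(3) i'(3)]])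
  also have "push (mat_prod i1 i1') (prod_dist k k' \<psi> \<psi>') = prod_dist w w' (push i1 \<psi>) (push i1' \<psi>')"
    by (rule prod_push[OF \<psi> \<psi>' i(2) i'(2), symmetric])
  also have "push (mat_prod i2 i2') (prod_dist l l' \<chi> \<chi>') = prod_dist w w' (push i2 \<chi>) (push i2' \<chi>')"
    by (rule prod_push[OF \<chi> \<chi>' i(3) i'(3), symmetric])
  also have "conv_dist (w + w') (prod_dist w w' (push i1 \<psi>) (push i1' \<psi>')) (prod_dist w w' (push i2 \<chi>) (push i2' \<chi>'))
      = prod_dist w w' (conv_dist w (push i1 \<psi>) (push i2 \<chi>)) (conv_dist w' (push i1' \<psi>') (push i2' \<chi>'))"
    by (rule prod_conv[symmetric, OF vec_dist_push[OF \<psi> i(2)] vec_dist_push[OF \<chi> i(3)]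
          vec_dist_push[OF \<psi>' i'(2)] vec_dist_push[OF \<chi>' i'(3)]])
  also have "mat_prod i1 i1' * mat_prod f f' = mat_prod (i1 * f) (i1' * f')"
    by (rule mat_prod_comp[OF i(2) k(1) i'(2) k'(1), symmetric])
  also have "mat_prod i2 i2' * mat_prod q q' = mat_prod (i2 * q) (i2' * q')"
    by (rule mat_prod_comp[OF i(3) l(2) i'(3) l'(2), symmetric])
  also have "gaussex_class (mat_prod (i1 * f) (i1' * f'), prod_dist w w' (conv_dist w (push i1 \<psi>) (push i2 \<chi>))
      (conv_dist w' (push i1' \<psi>') (push i2' \<chi>')), mat_prod (i2 * q) (i2' * q'))
      = gaussex_tensor (gaussex_comp Y X) (gaussex_comp Y' X')"
    unfolding X X' Y Y' XY(1) XY'(1) by (rule gaussex_tensor_class(1)[OF XY(2-5) XY'(2-5), symmetric])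
  finally show ?case by simp
next
  case (11 X m n X' m' n' X'' m'' n'')
  obtain k f \<psi> p where k: "f \<in> carrier_mat k m" "p \<in> carrier_mat k n" "surj_mat p" "gaussian k \<psi>"
    and X: "X = gaussex_class (f, \<psi>, p)" using 11(1) by (rule gaussex_homE)
  obtain k' f' \<psi>' p' where k': "f' \<in> carrier_mat k' m'" "p' \<in> carrier_mat k' n'" "surj_mat p'" "gaussian k' \<psi>'"
    and X': "X' = gaussex_class (f', \<psi>', p')" using 11(2) by (rule gaussex_homE)
  obtain k'' f'' \<psi>'' p'' where k'': "f'' \<in> carrier_mat k'' m''" "p'' \<in> carrier_mat k'' n''" "surj_mat p''"
    "gaussian k'' \<psi>''" and X'': "X'' = gaussex_class (f'', \<psi>'', p'')" using 11(3) by (rule gaussex_homE)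
  note XX' = gaussex_tensor_class[OF k k'] and XX'' = gaussex_tensor_class[OF k' k'']
  show ?case
    unfolding X X' X'' XX'(1) XX''(1) gaussex_tensor_class(1)[OF XX'(2-5) k''] gaussex_tensor_class(1)[OF k XX''(2-5)]
    by (simp only: mat_prod_assoc
        prod_dist_assoc[OF gaussian_vec_dist[OF k(4)] gaussian_vec_dist[OF k'(4)] gaussian_vec_dist[OF k''(4)]])
next
  case (12 X m n)
  then obtain k f \<psi> p where k: "f \<in> carrier_mat k m" "p \<in> carrier_mat k n" "surj_mat p" "gaussian k \<psi>"
    and X: "X = gaussex_class (f, \<psi>, p)" by (rule gaussex_homE)
  show ?case
    unfolding X gaussex_linear_class[OF one_carrier_mat]
      gaussex_tensor_class(1)[OF one_carrier_mat one_carrier_mat surj_mat_one gaussian_dirac0 k]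
    by (simp only: mat_prod_one_left prod_dirac0_left[OF gaussian_vec_dist[OF k(4)]])
next
  case (13 X m n)
  then obtain k f \<psi> p where k: "f \<in> carrier_mat k m" "p \<in> carrier_mat k n" "surj_mat p" "gaussian k \<psi>"
    and X: "X = gaussex_class (f, \<psi>, p)" by (rule gaussex_homE)
  show ?case
    unfolding X gaussex_linear_class[OF one_carrier_mat]
      gaussex_tensor_class(1)[OF k one_carrier_mat one_carrier_mat surj_mat_one gaussian_dirac0]
    by (simp only: mat_prod_one_right prod_dirac0_right[OF gaussian_vec_dist[OF k(4)]])
next
  case (14 X m m' Y n n')
  obtain k f \<psi> p where k: "f \<in> carrier_mat k m" "p \<in> carrier_mat k m'" "surj_mat p" "gaussian k \<psi>"
    and X: "X = gaussex_class (f, \<psi>, p)" using 14(1) by (rule gaussex_homE)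
  obtain l g \<chi> q where l: "g \<in> carrier_mat l n" "q \<in> carrier_mat l n'" "surj_mat q" "gaussian l \<chi>"
    and Y: "Y = gaussex_class (g, \<chi>, q)" using 14(2) by (rule gaussex_homE)
  note XY = gaussex_tensor_class[OF k l] and YX = gaussex_tensor_class[OF l k]
  \<comment> \<open>The braiding goes from \<open>a + b\<close> to \<open>b + a\<close>; reading
    these as the same number makes it a square matrix to which invertibility applies.\<close>
  have inv: "braid_mat a b \<in> carrier_mat (a + b) (a + b)" for a b
    using structure_mat_carrier(1)[of a b] by (simp add: add.commute)
  have comm: "a + b = b + a" for a b :: nat by simp
  \<comment> \<open>The two sides of naturality have apexes with their blocks in opposite order, so
    the isomorphism identifying them is the braiding of the apexes.\<close>
  let ?\<tau> = "braid_mat k l"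
  have b: "braid_mat n' m' \<in> carrier_mat (m' + n') (m' + n')" "braid_mat k l \<in> carrier_mat (k + l) (k + l)"
    using inv[of n' m'] inv[of k l] by (simp_all add: add.commute)
  have s: "braid_mat m' n' * braid_mat n' m' = 1\<^sub>m (m' + n')" "braid_mat n' m' * braid_mat m' n' = 1\<^sub>m (m' + n')"
    using braid_mat_symmetric[of m' n'] braid_mat_symmetric[of n' m'] by (simp_all add: add.commute)
  have t: "invertible_mat ?\<tau>"
    using braid_mat_symmetric[of l k] braid_mat_symmetric[of k l] inv[of l k] inv[of k l]
    by (intro invertible_matI[of _ "k + l" "braid_mat l k"]) (simp_all add: add.commute)
  have L: "gaussex_comp (gaussex_linear (braid_mat m' n')) (gaussex_tensor X Y)
      = gaussex_class (mat_prod f g, prod_dist k l \<psi> \<chi>, mat_prod p q * braid_mat n' m')"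
    unfolding X Y XY(1) by (rule gaussex_comp_linear_left_iso[OF XY(2-5) inv b(1) s])
  have c: "mat_prod p q * braid_mat n' m' \<in> carrier_mat (k + l) (m' + n')"
    using XY(3) b(1) by (rule mult_carrier_mat)
  have sc: "surj_mat (mat_prod p q * braid_mat n' m')"
    using surj_mat_mult[OF XY(4) surj_mat_invertible[OF invertible_matI[OF b(1) inv s(2,1)] b(1)] XY(3) b(1)] .
  \<comment> \<open>On the right leg, the braiding of the apex and the inverse braiding of the
    target cancel by naturality of the matrix braiding.\<close>
  have "?\<tau> * (mat_prod p q * braid_mat n' m') = ?\<tau> * mat_prod p q * braid_mat n' m'"
    by (rule assoc_mult_mat[OF b(2) XY(3) b(1), symmetric])
  also have "\<dots> = mat_prod q p * braid_mat m' n' * braid_mat n' m'"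
    by (simp only: braid_mat_natural[OF k(2) l(2)])
  also have "\<dots> = mat_prod q p * (braid_mat m' n' * braid_mat n' m')"
    by (rule assoc_mult_mat[of _ "l + k" "m' + n'" _ "m' + n'" _ "m' + n'"]) (use YX(3) inv b(1) in \<open>simp_all add: add.commute\<close>)
  also have "\<dots> = mat_prod q p"
    unfolding s using right_mult_one_mat[OF YX(3)] by (simp add: add.commute)
  finally have 1: "?\<tau> * (mat_prod p q * braid_mat n' m') = mat_prod q p" .
  have "gaussex_class (mat_prod f g, prod_dist k l \<psi> \<chi>, mat_prod p q * braid_mat n' m')
      = gaussex_class (mat_prod g f * braid_mat m n, prod_dist l k \<chi> \<psi>, mat_prod q p)"
    using gaussex_class_act[OF XY(2) c sc XY(5) b(2) t]
    unfolding 1 braid_mat_natural[OF k(1) l(1)] push_braid_prod[OF gaussian_vec_dist[OF k(4)] gaussian_vec_dist[OF l(4)]]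
    by simp
  also have "\<dots> = gaussex_comp (gaussex_tensor Y X) (gaussex_linear (braid_mat m n))"
    unfolding X Y YX(1) by (rule gaussex_comp_linear_right[OF structure_mat_carrier(1) YX(2-5), symmetric])
  finally show ?case unfolding L .
next
  case (15 X m n)
  then obtain k f \<psi> p where k: "f \<in> carrier_mat k m" "p \<in> carrier_mat k n" "surj_mat p" "gaussian k \<psi>"
    and X: "X = gaussex_class (f, \<psi>, p)" by (rule gaussex_homE)
  have D: "del_mat n \<in> carrier_mat 0 n" by simp
  note comp = gaussex_comp_class[OF k D one_carrier_mat surj_mat_one gaussian_dirac0 pushout_unit[OF k(2,3) D]
      zero_carrier_mat one_carrier_mat]
  \<comment> \<open>On the zero apex both the left leg and the decoration are forced, whatever
    \<open>X\<close> was.\<close>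
  have "0\<^sub>m 0 k * f = del_mat m"
    using k by (intro mat_0_rows_eq[of _ m]) auto
  moreover have "conv_dist 0 (push (0\<^sub>m 0 k) \<psi>) (push (1\<^sub>m 0) (dirac0 0)) = dirac0 0"
    by (rule vec_dist_0_unique[OF gaussian_vec_dist[OF comp(5)] vec_dist_dirac0])
  ultimately show ?case
    unfolding X gaussex_linear_class[OF D] comp(1) by (simp add: gaussex_linear_class[OF structure_mat_carrier(3)])
qed

section \<open>The embeddings of Gaussian maps and of total linear relations\<close>

lemma GaussEx_linear: "GaussEx = linear_markov_struct gaussex_hom gaussex_comp gaussex_tensor gaussex_linear"
  by (simp add: GaussEx_def gaussex_linear_def[abs_def])

section \<open>The functor on Gaussian maps\<close>

definition gauss_to_gaussex :: "gauss_map \<Rightarrow> decorated set" where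
  "gauss_to_gaussex = (\<lambda>(f, \<psi>). gaussex_class (f, \<psi>, 1\<^sub>m (dim_row f)))"

lemma gauss_to_gaussex_eq:
  "f \<in> carrier_mat n m \<Longrightarrow> gauss_to_gaussex (f, \<psi>) = gaussex_class (f, \<psi>, 1\<^sub>m n)"
  by (simp add: gauss_to_gaussex_def)

lemma gauss_homE:
  assumes "x \<in> gauss_hom m n"
  obtains f \<psi> where "x = (f, \<psi>)" "f \<in> carrier_mat n m" "gaussian n \<psi>"
  using assms by (auto simp: gauss_hom_def)

lemma gauss_to_gaussex_closed:
  assumes "x \<in> gauss_hom m n" shows "gauss_to_gaussex x \<in> gaussex_hom m n"
  using assms
  by (auto elim!: gauss_homE simp: gauss_to_gaussex_eq intro!: gaussex_homI surj_mat_one one_carrier_mat)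

lemma inj_gauss_to_gaussex: "inj_on gauss_to_gaussex (gauss_hom m n)"
proof (rule inj_onI)
  fix x y assume x: "x \<in> gauss_hom m n" and y: "y \<in> gauss_hom m n"
    and eq: "gauss_to_gaussex x = gauss_to_gaussex y"
  obtain f \<psi> where f: "x = (f, \<psi>)" "f \<in> carrier_mat n m" "gaussian n \<psi>" using x by (rule gauss_homE)
  obtain g \<chi> where g: "y = (g, \<chi>)" "g \<in> carrier_mat n m" "gaussian n \<chi>" using y by (rule gauss_homE)
  have "(g, \<chi>, 1\<^sub>m n) \<in> gaussex_class (f, \<psi>, 1\<^sub>m n)"
    using eq gaussex_class_self[OF g(2) one_carrier_mat surj_mat_one g(3)]
    by (simp add: f g gauss_to_gaussex_eq[OF f(2)] gauss_to_gaussex_eq[OF g(2)])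
  then obtain \<tau> where "\<tau> \<in> carrier_mat n n" "g = \<tau> * f" "\<chi> = push \<tau> \<psi>" "1\<^sub>m n = \<tau> * 1\<^sub>m n"
    unfolding gaussex_class_mem_iff[OF f(2) one_carrier_mat surj_mat_one f(3)] by auto
  moreover from this have "\<tau> = 1\<^sub>m n" by simp
  ultimately show "x = y"
    using f g by (simp add: push_one[OF gaussian_vec_dist[OF f(3)]])
qed

lemma gauss_to_gaussex_comp:
  assumes "x \<in> gauss_hom m n" "y \<in> gauss_hom n r"
  shows "gauss_to_gaussex (gauss_comp y x) = gaussex_comp (gauss_to_gaussex y) (gauss_to_gaussex x)"
    and "gauss_comp y x \<in> gauss_hom m r"
proof -
  obtain f \<psi> where f: "x = (f, \<psi>)" "f \<in> carrier_mat n m" "gaussian n \<psi>" using assms(1) by (rule gauss_homE)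
  obtain g \<chi> where g: "y = (g, \<chi>)" "g \<in> carrier_mat r n" "gaussian r \<chi>" using assms(2) by (rule gauss_homE)
  have yx: "gauss_comp y x = (g * f, conv_dist r \<chi> (push g \<psi>))"
    using g by (simp add: f gauss_comp_def)
  note comp = gaussex_comp_class[OF f(2) one_carrier_mat surj_mat_one f(3) g(2) one_carrier_mat surj_mat_one g(3)
      pushout_one_left[OF g(2)] g(2) one_carrier_mat]
  have "gaussex_comp (gauss_to_gaussex y) (gauss_to_gaussex x)
      = gaussex_class (g * f, conv_dist r (push g \<psi>) (push (1\<^sub>m r) \<chi>), 1\<^sub>m r * 1\<^sub>m r)"
    unfolding f(1) g(1) gauss_to_gaussex_eq[OF f(2)] gauss_to_gaussex_eq[OF g(2)] by (rule comp(1))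
  \<comment> \<open>\<open>gauss_comp\<close> lists the noise of the later map first,
    \<open>gaussex_comp\<close> that of the earlier map; commutativity of convolution reconciles
    them.\<close>
  also have "conv_dist r (push g \<psi>) (push (1\<^sub>m r) \<chi>) = conv_dist r \<chi> (push g \<psi>)"
    using conv_comm[OF vec_dist_push[OF gaussian_vec_dist[OF f(3)] g(2)] gaussian_vec_dist[OF g(3)]]
    by (simp add: push_one[OF gaussian_vec_dist[OF g(3)]])
  finally show "gauss_to_gaussex (gauss_comp y x) = gaussex_comp (gauss_to_gaussex y) (gauss_to_gaussex x)"
    unfolding yx by (simp add: gauss_to_gaussex_eq[OF comp(2)])
  show "gauss_comp y x \<in> gauss_hom m r"
    unfolding yx gauss_hom_def using comp(2) gaussian_conv[OF g(3) gaussian_push[OF f(3) g(2)]] by simp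
qed

lemma gauss_to_gaussex_tensor:
  assumes "x \<in> gauss_hom m n" "y \<in> gauss_hom m' n'"
  shows "gauss_to_gaussex (gauss_tensor x y) = gaussex_tensor (gauss_to_gaussex x) (gauss_to_gaussex y)"
    and "gauss_tensor x y \<in> gauss_hom (m + m') (n + n')"
proof -
  obtain f \<psi> where f: "x = (f, \<psi>)" "f \<in> carrier_mat n m" "gaussian n \<psi>" using assms(1) by (rule gauss_homE)
  obtain g \<chi> where g: "y = (g, \<chi>)" "g \<in> carrier_mat n' m'" "gaussian n' \<chi>" using assms(2) by (rule gauss_homE)
  have xy: "gauss_tensor x y = (mat_prod f g, prod_dist n n' \<psi> \<chi>)"
    using f g by (simp add: gauss_tensor_def)
  note tens = gaussex_tensor_class[OF f(2) one_carrier_mat surj_mat_one f(3) g(2) one_carrier_mat surj_mat_one g(3)]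
  show "gauss_to_gaussex (gauss_tensor x y) = gaussex_tensor (gauss_to_gaussex x) (gauss_to_gaussex y)"
    unfolding xy gauss_to_gaussex_eq[OF tens(2)]
    unfolding f(1) g(1) gauss_to_gaussex_eq[OF f(2)] gauss_to_gaussex_eq[OF g(2)] tens(1) mat_prod_one ..
  show "gauss_tensor x y \<in> gauss_hom (m + m') (n + n')"
    unfolding xy gauss_hom_def using tens(2,5) by simp
qed

lemma gauss_to_gaussex_linear: "gauss_to_gaussex (h, dirac0 (dim_row h)) = gaussex_linear h"
  by (simp add: gauss_to_gaussex_def gaussex_linear_def)

lemma linear_markov_gauss:
  "linear_markov gauss_hom gauss_comp gauss_tensor (\<lambda>h. (h, dirac0 (dim_row h)))"
proof (rule linear_markov_pullback[where F = gauss_to_gaussex and H = gauss_hom and cmp = gauss_comp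
      and tens = gauss_tensor and J = "\<lambda>h. (h, dirac0 (dim_row h))",
      OF linear_markov_gaussex inj_gauss_to_gaussex gauss_to_gaussex_closed
      gauss_to_gaussex_comp(1) gauss_to_gaussex_tensor(1) gauss_to_gaussex_linear
      gauss_to_gaussex_comp(2) gauss_to_gaussex_tensor(2)])
  show "(M, dirac0 (dim_row M)) \<in> gauss_hom m n" if "M \<in> carrier_mat n m" for M m n
    using that gaussian_dirac0 by (auto simp: gauss_hom_def)
qed

section \<open>Total linear relations and their copartial maps\<close>

lemma copartial_mapE:
  assumes "copartial_map m n l p"
  obtains k where "l \<in> carrier_mat k m" "p \<in> carrier_mat k n" "surj_mat p"
  using assms by (auto simp: copartial_map_def)

lemma copartial_rel_iff:
  assumes "l \<in> carrier_mat k m" "p \<in> carrier_mat k n"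
  shows "(x, y) \<in> copartial_rel l p \<longleftrightarrow> x \<in> carrier_vec m \<and> y \<in> carrier_vec n \<and> l *\<^sub>v x = p *\<^sub>v y"
  using assms by (auto simp: copartial_rel_def)

lemma copartial_rel_tlinrel:
  assumes l: "l \<in> carrier_mat k m" and p: "p \<in> carrier_mat k n" "surj_mat p"
  shows "copartial_rel l p \<in> tlinrel_hom m n"
  unfolding tlinrel_hom_def linear_relation_def mem_Collect_eq copartial_rel_iff[OF l p(1)]
proof (intro conjI allI impI ballI)
  show "copartial_rel l p \<subseteq> carrier_vec m \<times> carrier_vec n"
    using l p by (auto simp: copartial_rel_def)
  show "l *\<^sub>v 0\<^sub>v m = p *\<^sub>v 0\<^sub>v n" using l p by auto
  show "\<exists>y. x \<in> carrier_vec m \<and> y \<in> carrier_vec n \<and> l *\<^sub>v x = p *\<^sub>v y" if "x \<in> carrier_vec m" for x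
  proof -
    have "l *\<^sub>v x \<in> carrier_vec k" using l that by auto
    then show ?thesis using p that by (fastforce simp: surj_mat_def)
  qed
next
  fix x y x' y'
  assume "x \<in> carrier_vec m \<and> y \<in> carrier_vec n \<and> l *\<^sub>v x = p *\<^sub>v y"
    "x' \<in> carrier_vec m \<and> y' \<in> carrier_vec n \<and> l *\<^sub>v x' = p *\<^sub>v y'"
  then show "x + x' \<in> carrier_vec m" "y + y' \<in> carrier_vec n" "l *\<^sub>v (x + x') = p *\<^sub>v (y + y')"
    using mult_add_distrib_mat_vec[OF l, of x x'] mult_add_distrib_mat_vec[OF p(1), of y y'] by auto
next
  fix c x y
  assume "x \<in> carrier_vec m \<and> y \<in> carrier_vec n \<and> l *\<^sub>v x = p *\<^sub>v y"
  then show "c \<cdot>\<^sub>v x \<in> carrier_vec m" "c \<cdot>\<^sub>v y \<in> carrier_vec n" "l *\<^sub>v (c \<cdot>\<^sub>v x) = p *\<^sub>v (c \<cdot>\<^sub>v y)"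
    using mult_mat_vec[OF l, of x c] mult_mat_vec[OF p(1), of y c] by auto
qed (use l p in auto)

lemma tlinrel_homD:
  assumes "L \<in> tlinrel_hom m n"
  shows "(x, y) \<in> L \<Longrightarrow> x \<in> carrier_vec m \<and> y \<in> carrier_vec n" "(0\<^sub>v m, 0\<^sub>v n) \<in> L"
    "(x, y) \<in> L \<Longrightarrow> (x', y') \<in> L \<Longrightarrow> (x + x', y + y') \<in> L"
    "(x, y) \<in> L \<Longrightarrow> (c \<cdot>\<^sub>v x, c \<cdot>\<^sub>v y) \<in> L"
    "x \<in> carrier_vec m \<Longrightarrow> \<exists>y. (x, y) \<in> L"
  using assms by (auto simp: tlinrel_hom_def linear_relation_def)

text \<open>A copartial map for \<open>L\<close> is obtained by splitting the quotient map by \<open>L\<close>, a matrix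
  \<open>[A p]\<close> on \<open>\<real>\<close> to the power \<open>m + n\<close>, into its two blocks; totality of \<open>L\<close> makes \<open>p\<close> surjective.\<close>

lemma tlinrel_hom_copartial:
  assumes L: "L \<in> tlinrel_hom m n"
  obtains k l p where "l \<in> carrier_mat k m" "p \<in> carrier_mat k n" "surj_mat p" "L = copartial_rel l p"
proof -
  \<comment> \<open>The relation as a subspace of the space of concatenated vectors. No information
    is lost, since the length of the first component fixes where to cut.\<close>
  define S where "S = {x @\<^sub>v y | x y. (x, y) \<in> L}"
  have S: "x @\<^sub>v y \<in> S \<longleftrightarrow> (x, y) \<in> L" if "x \<in> carrier_vec m" for x y
  proof
    assume "x @\<^sub>v y \<in> S"
    then obtain x' y' where xy': "x @\<^sub>v y = x' @\<^sub>v y'" "(x', y') \<in> L" by (auto simp: S_def)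
    then have "x = x' \<and> y = y'" using append_vec_eq[OF that, of x' y y'] tlinrel_homD(1)[OF L] by blast
    then show "(x, y) \<in> L" using xy' by simp
  qed (auto simp: S_def)
  obtain k C where C: "C \<in> carrier_mat k (m + n)" "surj_mat C"
    "\<And>x. x \<in> carrier_vec (m + n) \<Longrightarrow> C *\<^sub>v x = 0\<^sub>v k \<longleftrightarrow> x \<in> S"
  proof (rule exists_quotient_matrix[of S "m + n"])
    show "S \<subseteq> carrier_vec (m + n)"
      unfolding S_def using tlinrel_homD(1)[OF L] by auto
    show "0\<^sub>v (m + n) \<in> S"
      unfolding zero_append_zero[symmetric] S_def using tlinrel_homD(2)[OF L] by blast
    show "a + b \<in> S" if ab: "a \<in> S" "b \<in> S" for a b
    proof -
      obtain x y x' y' where xy: "a = x @\<^sub>v y" "(x, y) \<in> L" "b = x' @\<^sub>v y'" "(x', y') \<in> L"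
        using ab by (auto simp: S_def)
      have "a + b = (x + x') @\<^sub>v (y + y')"
        unfolding xy using tlinrel_homD(1)[OF L] xy(2,4) by (intro append_vec_add[of _ m _ _ n]) auto
      then show ?thesis using tlinrel_homD(3)[OF L xy(2,4)] by (auto simp: S_def)
    qed
    show "c \<cdot>\<^sub>v a \<in> S" if a: "a \<in> S" for c a
      using a tlinrel_homD(4)[OF L] by (fastforce simp: S_def smult_append_vec)
  qed blast
  define A where "A = Matrix.mat k m (\<lambda>(i, j). C $$ (i, j))"
  define p where "p = Matrix.mat k n (\<lambda>(i, j). C $$ (i, m + j))"
  have A: "A \<in> carrier_mat k m" and p: "p \<in> carrier_mat k n" by (simp_all add: A_def p_def)
  have Cxy: "C *\<^sub>v (x @\<^sub>v y) = A *\<^sub>v x + p *\<^sub>v y" if "x \<in> carrier_vec m" "y \<in> carrier_vec n" for x y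
  proof (rule eq_vecI)
    fix i assume "i < dim_vec (A *\<^sub>v x + p *\<^sub>v y)"
    then have i: "i < k" using p by simp
    have "Matrix.row C i = Matrix.row A i @\<^sub>v Matrix.row p i"
      using i C(1) by (intro eq_vecI) (auto simp: A_def p_def)
    then show "(C *\<^sub>v (x @\<^sub>v y)) $ i = (A *\<^sub>v x + p *\<^sub>v y) $ i"
      using i C(1) A p that by (simp add: scalar_prod_append[of _ m _ n])
  qed (use C A p in auto)
  have in_L: "(x, y) \<in> L \<longleftrightarrow> A *\<^sub>v x + p *\<^sub>v y = 0\<^sub>v k" if "x \<in> carrier_vec m" "y \<in> carrier_vec n" for x y
    using C(3)[of "x @\<^sub>v y"] S[OF that(1), of y] Cxy[OF that] that by simp
  \<comment> \<open>The quotient map describes \<open>L\<close> by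
    \<open>A *\<^sub>v x + p *\<^sub>v y = 0\<^sub>v k\<close>, whereas a copartial map equates its
    two legs; hence the sign on the left leg.\<close>
  have uminus: "- A \<in> carrier_mat k m" using A by simp
  have eq_iff: "a + b = 0\<^sub>v k \<longleftrightarrow> - a = b" if "a \<in> carrier_vec k" "b \<in> carrier_vec k" for a b :: "real Matrix.vec"
  proof
    assume *: "a + b = 0\<^sub>v k"
    show "- a = b"
    proof (rule eq_vecI)
      fix i assume "i < dim_vec b"
      then show "(- a) $ i = b $ i" using arg_cong[OF *, of "\<lambda>v. v $ i"] that by simp
    qed (use that in simp)
  qed (use that in auto)
  show thesis
  proof (rule that[OF uminus p])
    show "surj_mat p"
      unfolding surj_mat_def
    proof
      fix z :: "real Matrix.vec" assume z: "z \<in> carrier_vec (dim_row p)"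
      then have "z \<in> carrier_vec (dim_row C)" using p C by simp
      then obtain w where w: "w \<in> carrier_vec (m + n)" "C *\<^sub>v w = z"
        using C by (auto simp: surj_mat_def)
      then obtain x y where xy: "x \<in> carrier_vec m" "y \<in> carrier_vec n" "w = x @\<^sub>v y"
        by (elim carrier_vec_appendE)
      \<comment> \<open>\<open>z\<close> is \<open>A *\<^sub>v x + p *\<^sub>v y\<close>. Totality
        supplies \<open>y'\<close> with \<open>A *\<^sub>v x = - (p *\<^sub>v y')\<close>, so
        \<open>y - y'\<close> is a preimage of \<open>z\<close> under \<open>p\<close>
        alone.\<close>
      obtain y' where "(x, y') \<in> L" using tlinrel_homD(5)[OF L xy(1)] by blast
      then have y': "y' \<in> carrier_vec n" "A *\<^sub>v x + p *\<^sub>v y' = 0\<^sub>v k"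
        using tlinrel_homD(1)[OF L] in_L by blast+
      have "p *\<^sub>v (y - y') = p *\<^sub>v y - p *\<^sub>v y'" using p xy y' by (intro mult_minus_distrib_mat_vec)
      also have "\<dots> = A *\<^sub>v x + p *\<^sub>v y"
      proof (rule eq_vecI)
        fix i assume "i < dim_vec (A *\<^sub>v x + p *\<^sub>v y)"
        then show "(p *\<^sub>v y - p *\<^sub>v y') $ i = (A *\<^sub>v x + p *\<^sub>v y) $ i"
          using arg_cong[OF y'(2), of "\<lambda>v. v $ i"] A p by simp
      qed (use p in simp)
      also have "\<dots> = z" using w xy Cxy by simp
      finally show "\<exists>y \<in> carrier_vec (dim_col p). p *\<^sub>v y = z"
        using xy y' p by (intro bexI[of _ "y - y'"]) auto
    qed
    have rel: "(x, y) \<in> copartial_rel (- A) p \<longleftrightarrow> x \<in> carrier_vec m \<and> y \<in> carrier_vec n \<and> A *\<^sub>v x + p *\<^sub>v y = 0\<^sub>v k"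
      for x y
    proof (cases "x \<in> carrier_vec m \<and> y \<in> carrier_vec n")
      case True
      then have c: "A *\<^sub>v x \<in> carrier_vec k" "p *\<^sub>v y \<in> carrier_vec k" using A p by auto
      have "- A *\<^sub>v x = - (A *\<^sub>v x)" using True A by (intro uminus_mult_mat_vec) simp
      then show ?thesis
        using True unfolding copartial_rel_iff[OF uminus p] eq_iff[OF c] by simp
    qed (auto simp: copartial_rel_iff[OF uminus p])
    show "L = copartial_rel (- A) p"
    proof (rule Set.set_eqI)
      fix z :: "real Matrix.vec \<times> real Matrix.vec"
      obtain x y where z: "z = (x, y)" by (cases z)
      show "z \<in> L \<longleftrightarrow> z \<in> copartial_rel (- A) p"
        unfolding z rel using in_L tlinrel_homD(1)[OF L] by blast
    qed
  qed
qed

text \<open>The map is \<open>p' * s\<close> for a section \<open>s\<close> of \<open>p\<close>. It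
  fits the left legs because \<open>x\<close> is related to
  \<open>s *\<^sub>v (l *\<^sub>v x)\<close>, and the right legs because the kernel of
  \<open>p\<close> consists of the vectors related to 0, which \<open>p'\<close> must kill as
  well.\<close>

lemma copartial_rel_factor:
  assumes l: "l \<in> carrier_mat k m" and p: "p \<in> carrier_mat k n" "surj_mat p"
    and l': "l' \<in> carrier_mat k' m" and p': "p' \<in> carrier_mat k' n"
    and eq: "copartial_rel l p = copartial_rel l' p'"
  obtains \<tau> where "\<tau> \<in> carrier_mat k' k" "\<tau> * l = l'" "\<tau> * p = p'"
proof -
  obtain s where s: "s \<in> carrier_mat n k" "p * s = 1\<^sub>m k"
    using p by (auto simp: surj_mat_iff_right_inverse)
  have rel: "l' *\<^sub>v x = p' *\<^sub>v y"
    if "x \<in> carrier_vec m" "y \<in> carrier_vec n" "l *\<^sub>v x = p *\<^sub>v y" for x y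
    using that eq copartial_rel_iff[OF l p(1)] copartial_rel_iff[OF l' p'] by blast
  have ps: "p *\<^sub>v (s *\<^sub>v z) = z" if "z \<in> carrier_vec k" for z
    using assoc_mult_mat_vec[OF p(1) s(1) that] s(2) that by simp
  have p's: "p' * s \<in> carrier_mat k' k" using p' s by simp
  show thesis
  proof (rule that[OF p's])
    show "p' * s * l = l'"
    proof (rule mat_eqI_vec[OF mult_carrier_mat[OF p's l] l'])
      fix x :: "real Matrix.vec" assume x: "x \<in> carrier_vec m"
      have lx: "l *\<^sub>v x \<in> carrier_vec k" using l x by auto
      have "p' * s * l *\<^sub>v x = p' *\<^sub>v (s *\<^sub>v (l *\<^sub>v x))"
        using assoc_mult_mat_vec[OF p's l x] assoc_mult_mat_vec[OF p' s(1) lx] by simp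
      also have "\<dots> = l' *\<^sub>v x"
        using rel[OF x, of "s *\<^sub>v (l *\<^sub>v x)"] ps[OF lx] s lx by auto
      finally show "p' * s * l *\<^sub>v x = l' *\<^sub>v x" .
    qed
    show "p' * s * p = p'"
    proof (rule mult_right_inverse_cancel[OF p(1) s p'])
      have "l *\<^sub>v 0\<^sub>v m = 0\<^sub>v k" "l' *\<^sub>v 0\<^sub>v m = 0\<^sub>v k'" using l l' by auto
      then show "p' *\<^sub>v y = 0\<^sub>v k'" if "y \<in> carrier_vec n" "p *\<^sub>v y = 0\<^sub>v k" for y
        using rel[of "0\<^sub>v m" y] that by simp
    qed
  qed
qed

text \<open>Factorizations exist in both directions and are mutually inverse because right legs are
  epi. The resulting isomorphism fixes the Dirac decoration, so the class depends on the relation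
  alone.\<close>

lemma copartial_rel_class_eq:
  assumes l: "l \<in> carrier_mat k m" and p: "p \<in> carrier_mat k n" "surj_mat p"
    and l': "l' \<in> carrier_mat k' m" and p': "p' \<in> carrier_mat k' n" "surj_mat p'"
    and eq: "copartial_rel l p = copartial_rel l' p'"
  shows "gaussex_class (l, dirac0 k, p) = gaussex_class (l', dirac0 k', p')"
proof -
  obtain \<tau> where \<tau>: "\<tau> \<in> carrier_mat k' k" "\<tau> * l = l'" "\<tau> * p = p'"
    using copartial_rel_factor[OF l p l' p'(1) eq] by metis
  obtain \<sigma> where \<sigma>: "\<sigma> \<in> carrier_mat k k'" "\<sigma> * l' = l" "\<sigma> * p' = p"
    using copartial_rel_factor[OF l' p' l p(1) eq[symmetric]] by metis
  have "\<sigma> * \<tau> * p = 1\<^sub>m k * p"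
    using assoc_mult_mat[OF \<sigma>(1) \<tau>(1) p(1)] \<tau> \<sigma> p by simp
  then have \<sigma>\<tau>: "\<sigma> * \<tau> = 1\<^sub>m k"
    using mat_mult_right_cancel_surj[OF p, of "\<sigma> * \<tau>" k "1\<^sub>m k"] \<tau> \<sigma> by simp
  have "\<tau> * \<sigma> * p' = 1\<^sub>m k' * p'"
    using assoc_mult_mat[OF \<tau>(1) \<sigma>(1) p'(1)] \<tau> \<sigma> p' by simp
  then have \<tau>\<sigma>: "\<tau> * \<sigma> = 1\<^sub>m k'"
    using mat_mult_right_cancel_surj[OF p', of "\<tau> * \<sigma>" k' "1\<^sub>m k'"] \<tau> \<sigma> by simp
  have k: "k' = k" by (rule dim_unique_of_inverse[OF \<tau>(1) \<sigma>(1) \<tau>\<sigma> \<sigma>\<tau>])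
  note \<tau>c = \<tau>(1)[unfolded k]
  have "invertible_mat \<tau>"
    by (rule invertible_matI[OF \<tau>c \<sigma>(1)[unfolded k] \<tau>\<sigma>[unfolded k] \<sigma>\<tau>])
  from gaussex_class_act[OF l p gaussian_dirac0 \<tau>c this] show ?thesis
    by (simp add: \<tau> k push_dirac0[OF \<tau>c])
qed

text \<open>A bare relation records neither its dimensions nor a copartial map, so all of these are
  existentially quantified under the choice; the next lemma shows that the chosen class is
  unique.\<close>

definition tlinrel_to_gaussex :: "vec_rel \<Rightarrow> decorated set" where
  "tlinrel_to_gaussex L = (SOME c. \<exists>m n l p. copartial_map m n l p \<and> L = copartial_rel l p \<and>
     c = gaussex_class (l, dirac0 (dim_row p), p))"

lemma tlinrel_to_gaussex_eq:
  assumes l: "l \<in> carrier_mat k m" and p: "p \<in> carrier_mat k n" "surj_mat p"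
  shows "tlinrel_to_gaussex (copartial_rel l p) = gaussex_class (l, dirac0 k, p)"
  unfolding tlinrel_to_gaussex_def
proof (rule some_equality)
  have "copartial_map m n l p" using assms by (auto simp: copartial_map_def)
  moreover have "dim_row p = k" using p by simp
  ultimately show "\<exists>m n l' p'. copartial_map m n l' p' \<and> copartial_rel l p = copartial_rel l' p' \<and>
     gaussex_class (l, dirac0 k, p) = gaussex_class (l', dirac0 (dim_row p'), p')" by blast
next
  fix c assume "\<exists>m n l' p'. copartial_map m n l' p' \<and> copartial_rel l p = copartial_rel l' p' \<and>
     c = gaussex_class (l', dirac0 (dim_row p'), p')"
  then obtain m' n' l' p' where *: "copartial_map m' n' l' p'" "copartial_rel l p = copartial_rel l' p'"
    "c = gaussex_class (l', dirac0 (dim_row p'), p')" by blast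
  from *(1) obtain k' where k': "l' \<in> carrier_mat k' m'" "p' \<in> carrier_mat k' n'" "surj_mat p'"
    by (rule copartial_mapE)
  \<comment> \<open>The pair of zero vectors belongs to the relation, and its lengths reveal the
    dimensions of any other presentation.\<close>
  have "(0\<^sub>v m, 0\<^sub>v n) \<in> copartial_rel l' p'"
    using tlinrel_homD(2)[OF copartial_rel_tlinrel[OF assms]] *(2) by simp
  then have "(0\<^sub>v m :: real Matrix.vec) \<in> carrier_vec m'" "(0\<^sub>v n :: real Matrix.vec) \<in> carrier_vec n'"
    using copartial_rel_iff[OF k'(1,2)] by auto
  then have "m' = m" "n' = n" by (auto dest!: carrier_vecD)
  then show "c = gaussex_class (l, dirac0 k, p)"
    using copartial_rel_class_eq[OF l p _ _ k'(3) *(2)] k' *(3) by simp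
qed

lemma tlinrel_to_gaussex_closed:
  assumes "L \<in> tlinrel_hom m n" shows "tlinrel_to_gaussex L \<in> gaussex_hom m n"
proof -
  obtain k l p where L: "l \<in> carrier_mat k m" "p \<in> carrier_mat k n" "surj_mat p" "L = copartial_rel l p"
    using assms by (rule tlinrel_hom_copartial)
  then show ?thesis
    using gaussex_homI[OF L(1-3) gaussian_dirac0] by (simp add: tlinrel_to_gaussex_eq[OF L(1-3)])
qed

text \<open>Equal classes have copartial maps that differ by an invertible \<open>\<tau>\<close>;
  applying it to both sides of \<open>l *\<^sub>v x = p *\<^sub>v y\<close> does not change the
  solutions.\<close>

lemma inj_tlinrel_to_gaussex: "inj_on tlinrel_to_gaussex (tlinrel_hom m n)"
proof (rule inj_onI)
  fix L L' assume "L \<in> tlinrel_hom m n" "L' \<in> tlinrel_hom m n"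
    and eq: "tlinrel_to_gaussex L = tlinrel_to_gaussex L'"
  then obtain k l p k' l' p' where L: "l \<in> carrier_mat k m" "p \<in> carrier_mat k n" "surj_mat p" "L = copartial_rel l p"
    and L': "l' \<in> carrier_mat k' m" "p' \<in> carrier_mat k' n" "surj_mat p'" "L' = copartial_rel l' p'"
    by (metis tlinrel_hom_copartial)
  have "(l', dirac0 k', p') \<in> gaussex_class (l, dirac0 k, p)"
    using eq gaussex_class_self[OF L'(1-3) gaussian_dirac0]
    by (simp add: L(4) L'(4) tlinrel_to_gaussex_eq[OF L(1-3)] tlinrel_to_gaussex_eq[OF L'(1-3)])
  then obtain \<tau> where \<tau>: "\<tau> \<in> carrier_mat k k" "invertible_mat \<tau>" "l' = \<tau> * l" "p' = \<tau> * p"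
    unfolding gaussex_class_mem_iff[OF L(1-3) gaussian_dirac0] by auto
  obtain \<sigma> where \<sigma>: "\<sigma> \<in> carrier_mat k k" "\<sigma> * \<tau> = 1\<^sub>m k" using \<tau> by (metis invertible_matE)
  have inj: "\<tau> *\<^sub>v a = \<tau> *\<^sub>v b \<longleftrightarrow> a = b" if "a \<in> carrier_vec k" "b \<in> carrier_vec k" for a b
    using assoc_mult_mat_vec[OF \<sigma>(1) \<tau>(1) that(1)] assoc_mult_mat_vec[OF \<sigma>(1) \<tau>(1) that(2)] \<sigma>(2) that
    by (metis one_mult_mat_vec)
  have k: "k' = k" using L'(1) \<tau> by auto
  show "L = L'"
  proof (rule Set.set_eqI)
    fix z :: "real Matrix.vec \<times> real Matrix.vec"
    obtain x y where z: "z = (x, y)" by (cases z)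
    show "z \<in> L \<longleftrightarrow> z \<in> L'"
    proof (cases "x \<in> carrier_vec m \<and> y \<in> carrier_vec n")
      case True
      then have x: "x \<in> carrier_vec m" and y: "y \<in> carrier_vec n" by auto
      have "l' *\<^sub>v x = \<tau> *\<^sub>v (l *\<^sub>v x)" "p' *\<^sub>v y = \<tau> *\<^sub>v (p *\<^sub>v y)"
        using assoc_mult_mat_vec[OF \<tau>(1) L(1) x] assoc_mult_mat_vec[OF \<tau>(1) L(2) y] \<tau> by simp_all
      then show ?thesis
        unfolding z L(4) L'(4) copartial_rel_iff[OF L(1,2)] copartial_rel_iff[OF L'(1,2)]
        using inj[OF mult_mat_vec_carrier[OF L(1) x] mult_mat_vec_carrier[OF L(2) y]] by simp
    qed (auto simp: z L(4) L'(4) copartial_rel_iff[OF L(1,2)] copartial_rel_iff[OF L'(1,2)])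
  qed
qed

text \<open>The pushout equation says that \<open>x\<close> and \<open>z\<close> agree in the apex;
  exactness is what produces an intermediate vector from this agreement.\<close>

lemma copartial_rel_comp:
  assumes l: "l \<in> carrier_mat k m" and p: "p \<in> carrier_mat k n" "surj_mat p"
    and g: "g \<in> carrier_mat j n" and q: "q \<in> carrier_mat j r"
    and i: "is_pushout p g i1 i2" "i1 \<in> carrier_mat w k" "i2 \<in> carrier_mat w j"
  shows "copartial_rel l p O copartial_rel g q = copartial_rel (i1 * l) (i2 * q)"
proof -
  note I = i(1)[unfolded pushout_iff_exact[OF p g i(2,3)]]
  have iff: "(\<exists>y. (x, y) \<in> copartial_rel l p \<and> (y, z) \<in> copartial_rel g q)
      \<longleftrightarrow> (x, z) \<in> copartial_rel (i1 * l) (i2 * q)" for x z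
    unfolding copartial_rel_iff[OF l p(1)] copartial_rel_iff[OF g q]
      copartial_rel_iff[OF mult_carrier_mat[OF i(2) l] mult_carrier_mat[OF i(3) q]]
  proof safe
    fix y assume x: "x \<in> carrier_vec m" and y: "y \<in> carrier_vec n" and z: "z \<in> carrier_vec r"
      and eq: "l *\<^sub>v x = p *\<^sub>v y" "g *\<^sub>v y = q *\<^sub>v z"
    have "i1 * l *\<^sub>v x = i1 * p *\<^sub>v y"
      using assoc_mult_mat_vec[OF i(2) l x] assoc_mult_mat_vec[OF i(2) p(1) y] eq by simp
    also have "\<dots> = i2 * q *\<^sub>v z"
      using assoc_mult_mat_vec[OF i(3) q z] assoc_mult_mat_vec[OF i(3) g y] eq I by simp
    finally show "i1 * l *\<^sub>v x = i2 * q *\<^sub>v z" .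
  next
    assume x: "x \<in> carrier_vec m" and z: "z \<in> carrier_vec r" and eq: "i1 * l *\<^sub>v x = i2 * q *\<^sub>v z"
    have lx: "l *\<^sub>v x \<in> carrier_vec k" and qz: "q *\<^sub>v z \<in> carrier_vec j" using l x q z by auto
    \<comment> \<open>A first candidate, matching \<open>x\<close> only. Its image under
      \<open>g\<close> differs from \<open>q *\<^sub>v z\<close> by an element of the kernel of
      \<open>i2\<close>, that is by \<open>g *\<^sub>v c\<close> with
      \<open>p *\<^sub>v c = 0\<^sub>v k\<close>; \<open>y - c\<close> then matches both
      sides.\<close>
    obtain y where y: "y \<in> carrier_vec n" "p *\<^sub>v y = l *\<^sub>v x"
      using p lx by (auto simp: surj_mat_def)
    have gy: "g *\<^sub>v y \<in> carrier_vec j" using g y by auto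
    have "i2 *\<^sub>v (g *\<^sub>v y) = i2 * g *\<^sub>v y" by (rule assoc_mult_mat_vec[OF i(3) g y(1), symmetric])
    also have "\<dots> = i1 *\<^sub>v (l *\<^sub>v x)"
      using assoc_mult_mat_vec[OF i(2) p(1) y(1)] I y by simp
    also have "\<dots> = i2 *\<^sub>v (q *\<^sub>v z)"
      using assoc_mult_mat_vec[OF i(2) l x] assoc_mult_mat_vec[OF i(3) q z] eq by simp
    finally have "i2 *\<^sub>v (g *\<^sub>v y - q *\<^sub>v z) = 0\<^sub>v w"
      using mult_minus_distrib_mat_vec[OF i(3) gy qz] i(3) mult_mat_vec_carrier[OF i(3) qz] by simp
    then obtain c where c: "c \<in> carrier_vec n" "p *\<^sub>v c = 0\<^sub>v k" "g *\<^sub>v c = g *\<^sub>v y - q *\<^sub>v z"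
      using I gy qz by (meson minus_carrier_vec)
    have "p *\<^sub>v (y - c) = l *\<^sub>v x"
      using mult_minus_distrib_mat_vec[OF p(1) y(1) c(1)] c y lx by auto
    moreover have "g *\<^sub>v (y - c) = q *\<^sub>v z"
    proof -
      have "g *\<^sub>v (y - c) = g *\<^sub>v y - (g *\<^sub>v y - q *\<^sub>v z)"
        using mult_minus_distrib_mat_vec[OF g y(1) c(1)] c by simp
      also have "\<dots> = q *\<^sub>v z" using gy qz by (intro eq_vecI) auto
      finally show ?thesis .
    qed
    ultimately show "\<exists>y. (x \<in> carrier_vec m \<and> y \<in> carrier_vec n \<and> l *\<^sub>v x = p *\<^sub>v y) \<and>
        y \<in> carrier_vec n \<and> z \<in> carrier_vec r \<and> g *\<^sub>v y = q *\<^sub>v z"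
      using x z y c by (intro exI[of _ "y - c"]) simp
  qed
  show ?thesis
  proof (rule Set.set_eqI)
    fix u :: "real Matrix.vec \<times> real Matrix.vec"
    obtain x z where u: "u = (x, z)" by (cases u)
    show "u \<in> copartial_rel l p O copartial_rel g q \<longleftrightarrow> u \<in> copartial_rel (i1 * l) (i2 * q)"
      unfolding u iff[symmetric] by blast
  qed
qed

text \<open>Equality of concatenated vectors splits into its blocks, so the defining equation of the
  product map is the conjunction of those of the factors.\<close>

lemma copartial_rel_tensor:
  assumes l: "l \<in> carrier_mat k m" and p: "p \<in> carrier_mat k n"
    and l': "l' \<in> carrier_mat k' m'" and p': "p' \<in> carrier_mat k' n'"
  shows "tlinrel_tensor (copartial_rel l p) (copartial_rel l' p') = copartial_rel (mat_prod l l') (mat_prod p p')"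
proof -
  note rel = copartial_rel_iff[OF mat_prod_carrier[OF l l'] mat_prod_carrier[OF p p']]
  have iff: "(x @\<^sub>v x', y @\<^sub>v y') \<in> copartial_rel (mat_prod l l') (mat_prod p p')
      \<longleftrightarrow> (x, y) \<in> copartial_rel l p \<and> (x', y') \<in> copartial_rel l' p'"
    if c: "x \<in> carrier_vec m" "x' \<in> carrier_vec m'" "y \<in> carrier_vec n" "y' \<in> carrier_vec n'" for x x' y y'
    unfolding rel mat_prod_mult_vec[OF l l' c(1,2)] mat_prod_mult_vec[OF p p' c(3,4)]
      copartial_rel_iff[OF l p] copartial_rel_iff[OF l' p']
      append_vec_eq[OF mult_mat_vec_carrier[OF l c(1)] mult_mat_vec_carrier[OF p c(3)]]
    using c by simp
  show ?thesis
  proof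
    show "tlinrel_tensor (copartial_rel l p) (copartial_rel l' p') \<subseteq> copartial_rel (mat_prod l l') (mat_prod p p')"
    proof
      fix u assume "u \<in> tlinrel_tensor (copartial_rel l p) (copartial_rel l' p')"
      then obtain x y x' y' where u: "u = (x @\<^sub>v x', y @\<^sub>v y')"
        and 1: "(x, y) \<in> copartial_rel l p" and 2: "(x', y') \<in> copartial_rel l' p'"
        unfolding tlinrel_tensor_def by blast
      have "x \<in> carrier_vec m" "x' \<in> carrier_vec m'" "y \<in> carrier_vec n" "y' \<in> carrier_vec n'"
        using 1 2 unfolding copartial_rel_iff[OF l p] copartial_rel_iff[OF l' p'] by auto
      then show "u \<in> copartial_rel (mat_prod l l') (mat_prod p p')"
        unfolding u using iff 1 2 by blast
    qed
    show "copartial_rel (mat_prod l l') (mat_prod p p') \<subseteq> tlinrel_tensor (copartial_rel l p) (copartial_rel l' p')"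
    proof
      fix u assume u: "u \<in> copartial_rel (mat_prod l l') (mat_prod p p')"
      obtain a b where ab: "u = (a, b)" by (cases u)
      have "a \<in> carrier_vec (m + m')" "b \<in> carrier_vec (n + n')" using u unfolding ab rel by auto
      then obtain x x' y y' where c: "x \<in> carrier_vec m" "x' \<in> carrier_vec m'" "a = x @\<^sub>v x'"
        "y \<in> carrier_vec n" "y' \<in> carrier_vec n'" "b = y @\<^sub>v y'"
        by (metis carrier_vec_appendE)
      then have "(x, y) \<in> copartial_rel l p \<and> (x', y') \<in> copartial_rel l' p'"
        using iff[OF c(1,2,4,5)] u ab by simp
      then show "u \<in> tlinrel_tensor (copartial_rel l p) (copartial_rel l' p')"
        unfolding tlinrel_tensor_def ab c(3,6) by blast
    qed
  qed
qed

lemma graph_rel_copartial: "h \<in> carrier_mat n m \<Longrightarrow> graph_rel h = copartial_rel h (1\<^sub>m n)"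
  by (auto simp: graph_rel_def copartial_rel_def)

lemma tlinrel_to_gaussex_comp:
  assumes "L \<in> tlinrel_hom m n" "K \<in> tlinrel_hom n r"
  shows "tlinrel_to_gaussex (L O K) = gaussex_comp (tlinrel_to_gaussex K) (tlinrel_to_gaussex L)"
    and "L O K \<in> tlinrel_hom m r"
proof -
  obtain k l p where L: "l \<in> carrier_mat k m" "p \<in> carrier_mat k n" "surj_mat p" "L = copartial_rel l p"
    using assms(1) by (rule tlinrel_hom_copartial)
  obtain j g q where K: "g \<in> carrier_mat j n" "q \<in> carrier_mat j r" "surj_mat q" "K = copartial_rel g q"
    using assms(2) by (rule tlinrel_hom_copartial)
  obtain w i1 i2 where i: "is_pushout p g i1 i2" "i1 \<in> carrier_mat w k" "i2 \<in> carrier_mat w j"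
    using pushout_exists[OF L(2,3) K(1)] by metis
  note comp = gaussex_comp_class[OF L(1-3) gaussian_dirac0 K(1-3) gaussian_dirac0 i]
  have LK: "L O K = copartial_rel (i1 * l) (i2 * q)"
    unfolding L(4) K(4) by (rule copartial_rel_comp[OF L(1-3) K(1,2) i])
  show "L O K \<in> tlinrel_hom m r"
    unfolding LK by (rule copartial_rel_tlinrel[OF comp(2-4)])
  \<comment> \<open>The Dirac measure at 0 is preserved by linear maps and neutral for convolution,
    so composites of undecorated maps stay undecorated.\<close>
  have "conv_dist w (push i1 (dirac0 k)) (push i2 (dirac0 j)) = dirac0 w"
    by (simp add: push_dirac0[OF i(2)] push_dirac0[OF i(3)] conv_dirac0[OF vec_dist_dirac0])
  then show "tlinrel_to_gaussex (L O K) = gaussex_comp (tlinrel_to_gaussex K) (tlinrel_to_gaussex L)"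
    unfolding LK tlinrel_to_gaussex_eq[OF comp(2-4)]
    unfolding L(4) K(4) tlinrel_to_gaussex_eq[OF L(1-3)] tlinrel_to_gaussex_eq[OF K(1-3)] comp(1) by simp
qed

lemma tlinrel_to_gaussex_tensor:
  assumes "L \<in> tlinrel_hom m n" "L' \<in> tlinrel_hom m' n'"
  shows "tlinrel_to_gaussex (tlinrel_tensor L L') = gaussex_tensor (tlinrel_to_gaussex L) (tlinrel_to_gaussex L')"
    and "tlinrel_tensor L L' \<in> tlinrel_hom (m + m') (n + n')"
proof -
  obtain k l p where L: "l \<in> carrier_mat k m" "p \<in> carrier_mat k n" "surj_mat p" "L = copartial_rel l p"
    using assms(1) by (rule tlinrel_hom_copartial)
  obtain k' l' p' where L': "l' \<in> carrier_mat k' m'" "p' \<in> carrier_mat k' n'" "surj_mat p'" "L' = copartial_rel l' p'"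
    using assms(2) by (rule tlinrel_hom_copartial)
  note tens = gaussex_tensor_class[OF L(1-3) gaussian_dirac0 L'(1-3) gaussian_dirac0]
  have LL': "tlinrel_tensor L L' = copartial_rel (mat_prod l l') (mat_prod p p')"
    unfolding L(4) L'(4) by (rule copartial_rel_tensor[OF L(1,2) L'(1,2)])
  show "tlinrel_tensor L L' \<in> tlinrel_hom (m + m') (n + n')"
    unfolding LL' by (rule copartial_rel_tlinrel[OF tens(2-4)])
  show "tlinrel_to_gaussex (tlinrel_tensor L L') = gaussex_tensor (tlinrel_to_gaussex L) (tlinrel_to_gaussex L')"
    unfolding LL' tlinrel_to_gaussex_eq[OF tens(2-4)]
    unfolding L(4) L'(4) tlinrel_to_gaussex_eq[OF L(1-3)] tlinrel_to_gaussex_eq[OF L'(1-3)] tens(1) prod_dirac0 ..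
qed

lemma tlinrel_to_gaussex_linear:
  assumes "h \<in> carrier_mat n m" shows "tlinrel_to_gaussex (graph_rel h) = gaussex_linear h"
  unfolding graph_rel_copartial[OF assms] gaussex_linear_class[OF assms]
  by (rule tlinrel_to_gaussex_eq[OF assms one_carrier_mat surj_mat_one])

lemma linear_markov_tlinrel: "linear_markov tlinrel_hom (\<lambda>K L. L O K) tlinrel_tensor graph_rel"
proof (rule linear_markov_pullback[where F = tlinrel_to_gaussex and H = tlinrel_hom and cmp = "\<lambda>K L. L O K"
      and tens = tlinrel_tensor and J = graph_rel,
      OF linear_markov_gaussex inj_tlinrel_to_gaussex tlinrel_to_gaussex_closed
      tlinrel_to_gaussex_comp(1) tlinrel_to_gaussex_tensor(1) tlinrel_to_gaussex_linear
      tlinrel_to_gaussex_comp(2) tlinrel_to_gaussex_tensor(2)])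
  show "graph_rel M \<in> tlinrel_hom m n" if "M \<in> carrier_mat n m" for M m n
    unfolding graph_rel_copartial[OF that] by (rule copartial_rel_tlinrel[OF that one_carrier_mat surj_mat_one])
qed

theorem proposition4p8:
  shows
    "(\<exists>F. markov_functor Gauss GaussEx id F (\<lambda>m n. Ident GaussEx (m + n)) (Ident GaussEx 0) \<and>
          faithful Gauss F \<and>
          (\<forall>m n f \<psi>. (f, \<psi>) \<in> Hom Gauss m n \<longrightarrow> F (f, \<psi>) = gaussex_class (f, \<psi>, 1\<^sub>m n))) \<and>
     (\<exists>G. markov_functor TLinRel GaussEx id G (\<lambda>m n. Ident GaussEx (m + n)) (Ident GaussEx 0) \<and>
          faithful TLinRel G \<and>
          (\<forall>m n l p. copartial_map m n l p \<longrightarrow>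
             G (copartial_rel l p) = gaussex_class (l, dirac0 (dim_row p), p)))"
proof (intro conjI exI)
  show "markov_functor Gauss GaussEx id gauss_to_gaussex (\<lambda>m n. Ident GaussEx (m + n)) (Ident GaussEx 0)"
    unfolding Gauss_def GaussEx_linear
    by (rule linear_markov_functor[OF linear_markov_gauss linear_markov_gaussex gauss_to_gaussex_closed
          gauss_to_gaussex_comp(1) gauss_to_gaussex_tensor(1) gauss_to_gaussex_linear])
  show "faithful Gauss gauss_to_gaussex"
    by (simp add: faithful_def Gauss_def inj_gauss_to_gaussex)
  show "\<forall>m n f \<psi>. (f, \<psi>) \<in> Hom Gauss m n \<longrightarrow> gauss_to_gaussex (f, \<psi>) = gaussex_class (f, \<psi>, 1\<^sub>m n)"
    by (auto simp: Gauss_def gauss_hom_def gauss_to_gaussex_eq)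
  show "markov_functor TLinRel GaussEx id tlinrel_to_gaussex (\<lambda>m n. Ident GaussEx (m + n)) (Ident GaussEx 0)"
    unfolding TLinRel_def GaussEx_linear
    by (rule linear_markov_functor[OF linear_markov_tlinrel linear_markov_gaussex tlinrel_to_gaussex_closed
          tlinrel_to_gaussex_comp(1) tlinrel_to_gaussex_tensor(1) tlinrel_to_gaussex_linear])
  show "faithful TLinRel tlinrel_to_gaussex"
    by (simp add: faithful_def TLinRel_def inj_tlinrel_to_gaussex)
  show "\<forall>m n l p. copartial_map m n l p \<longrightarrow>
      tlinrel_to_gaussex (copartial_rel l p) = gaussex_class (l, dirac0 (dim_row p), p)"
    by (auto elim!: copartial_mapE simp: tlinrel_to_gaussex_eq)
qed

end
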